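(* Let $\mathcal{C}^b(0)$ be the set of bounded compatible pairs $(a,i)$ such that $a$ is a reduced word, and let $\mathcal{T}^b(0)$ be the set of pairs $(P,Q)$ of tableaux of the same partition shape such that $P$ is a reduced decreasing tableau and $Q$ is a RSSYT with $K_+(P)\ge K_-(Q)$. (1) For every reduced decreasing tableau $P$, the right nil key of $P$ equals $K_+(P)$. (2) The restriction of $\mathrm{Insert}$ gives a bijection $\mathcal{C}^b(0)\to\mathcal{T}^b(0)$. On $\mathcal{C}^b(0)$, $\mathrm{Insert}$ is computed by Edelman–Greene column insertion into reduced decreasing tableaux, recorded by RSSYT.
   Context: Compatible pairs. A pair of words $(a,i)$ is compatible if $a,i$ are words of positive integers of the same length, $i$ is weakly decreasing, and $i_j=i_{j+1}$ implies $a_j<a_{j+1}$. It is bounded if $i_j\le a_j$ for all $j$. A word is reduced if it is a reduced word of some permutation in $S_+=\bigcup_n S_n$; a tableau is reduced if its word is. Tableaux (English notation, partition shape). A decreasing tableau has positive integer entries strictly decreasing along rows (left to right) and down columns. An RSSYT is weakly decreasing along rows and strictly decreasing down columns. $\mathrm{word}(T)$ reads the columns from left to right, each from bottom to top. An RSVT fills each box $s$ with a nonempty finite set $T(s)\subset\mathbb{Z}_{>0}$ with $\min T(s)\ge\max T(t)$ if $t$ is immediately right of $s$ and $\min T(s)>\max T(t)$ if $t$ is immediately below $s$; an RSVT with all sets singletons is identified with an RSSYT. Hecke (column) insertion of $x$ into a decreasing tableau $T$ gives $(P,c,\alpha)$. Insert $x$ into column 1; if a number is output, insert it into the next column, and so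 on until there is no output. To insert $x$ into a column: (Case 1) If $x$ is $\le$ all entries of the column, there is no output; if appending $x$ at the bottom of the column yields a decreasing tableau (of partition shape), do so, let $c$ be the new box and $\alpha=1$; otherwise leave the column unchanged, let $c$ be the rightmost box in the row containing the bottom entry of this column and $\alpha=0$. (Case 2) Otherwise let $y$ be the largest entry of the column with $y<x$; output $y$, and replace $y$ by $x$ if the result is a decreasing tableau, else leave the column unchanged. $\mathrm{Insert}$ of the empty pair is the pair of empty tableaux; if $a=a'x$, $i=i'y$ and $(P',Q')=\mathrm{Insert}(a',i')$, Hecke insert $x$ into $P'$ to get $(P,c,\alpha)$ and obtain $Q$ from $Q'$ by adjoining a new box $c$ containing $\{y\}$ if $\alpha=1$, or adding $y$ to the set in box $c$ if $\alpha=0$; $\mathrm{Insert}(a,i)=(P,Q)$. Edelman–Greene column insertion (decreasing version) of $x$ into a reduced decreasing tableau: insert $x$ into column 1. To insert $x$ into a column: if $x$ is less than all entries, append it at the bottom and stop; if $x$ is in the column, leave the column unchanged and insert $x-1$ into the next column; otherwise replace the largest entry $y<x$ by $x$ and insert $y$ into the next column. The recording tableau $Q$ receives the letter $i_j$ in the box created by inserting $a_j$ (letters of $a$ being inserted from left to right, starting from the empty tableau). Right key of a decreasing tableau. For $S\subseteq\mathbb{Z}_{>0}$, $m\in\mathbb{Z}_{>0}$, let $m'$ be the smallest element of $S$ with $m'\ge m$; $S\star m=(S\setminus\{m'\})\cup\{m\}$ if $m'$ exists, else $S\cup\{m\}$; for words act letter by letter from left to right. $K_+(P)$ is the key tableau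 whose $j$-th column is $\emptyset\star\mathrm{word}(P_{\ge j})$, where $P_{\ge j}$ is $P$ with the first $j-1$ columns removed. Left key of an RSSYT. If $C_1C_2$ are adjacent columns (as sets) of an RSSYT and $C_2=\{a_1<\dots<a_m\}$, let $b_1$ be the smallest element of $C_1$ with $b_1\ge a_1$, and $b_j$ the smallest element of $C_1$ with $b_j\ge a_j$, $b_j>b_{j-1}$; $C_1\triangleleft C_2=\{b_1<\dots<b_m\}$ and $C_1\triangleleft\cdots\triangleleft C_k=C_1\triangleleft(C_2\triangleleft\cdots\triangleleft C_k)$. $K_-(T)$ is the key tableau whose $k$-th column is $C_1\triangleleft\cdots\triangleleft C_k$, where $C_1,C_2,\dots$ are the columns of $T$. For key tableaux of the same shape, $\ge$ is entrywise comparison. Right nil key (decreasing analogue of the Lascoux–Schützenberger nil key). Nilplactic (Coxeter–Knuth) equivalence on reduced words is generated by $u\,bac\,v\sim u\,bca\,v$ and $u\,acb\,v\sim u\,cab\,v$ for $a<b<c$, and $u\,i(i+1)i\,v\sim u\,(i+1)i(i+1)\,v$. Let $P$ be a reduced decreasing tableau of shape $\lambda$ with column lengths $\lambda'_1,\lambda'_2,\dots,\lambda'_k$ ($k=\lambda_1$). Consider words nilplactically equivalent to $\mathrm{word}(P)$ equipped with a factorization $v^{(1)}v^{(2)}\cdots v^{(k)}$ into strictly increasing words whose lengths form a rearrangement of $(\lambda'_1,\dots,\lambda'_k)$. It is known that the last factor $v^{(k)}$, as a set, depends only on its length. The right nil key of $P$ is the key tableau of shape $\lambda$ whose $j$-th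 column is the last factor of such a factorized word with last factor of length $\lambda'_j$. *)

theory Defs
  imports "HOL-Combinatorics.Combinatorics"
begin

abbreviation positive_word :: "nat list \<Rightarrow> bool" where
  "positive_word a \<equiv> (\<forall>x\<in>set a. 0 < x)"

definition word_perm :: "nat list \<Rightarrow> nat \<Rightarrow> nat" where
  "word_perm a = foldr (\<lambda>k w. transpose k (Suc k) \<circ> w) a id"

definition reduced_word_of :: "(nat \<Rightarrow> nat) \<Rightarrow> nat list \<Rightarrow> bool" where
  "reduced_word_of w a \<longleftrightarrow> positive_word a \<and> word_perm a = w \<and>
     (\<forall>b. positive_word b \<and> word_perm b = w \<longrightarrow> length a \<le> length b)"

definition S_plus :: "(nat \<Rightarrow> nat) set" where
  "S_plus = (\<Union>n. {w. w permutes {1..n}})"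

definition reduced :: "nat list \<Rightarrow> bool" where
  "reduced a \<longleftrightarrow> (\<exists>w\<in>S_plus. reduced_word_of w a)"

definition compatible :: "nat list \<Rightarrow> nat list \<Rightarrow> bool" where
  "compatible a i \<longleftrightarrow> positive_word a \<and> positive_word i \<and> length a = length i \<and>
     sorted_wrt (\<ge>) i \<and>
     (\<forall>j. Suc j < length a \<longrightarrow> i ! j = i ! Suc j \<longrightarrow> a ! j < a ! Suc j)"

definition bounded_compatible :: "nat list \<Rightarrow> nat list \<Rightarrow> bool" where
  "bounded_compatible a i \<longleftrightarrow> compatible a i \<and> (\<forall>j<length a. i ! j \<le> a ! j)"

text \<open>
  A filling of a Young diagram is the list of its columns from left to right, each column
  listed from top to bottom: \<open>T ! j ! r\<close> is the entry in row \<open>r\<close> and column \<open>j\<close>, both counted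
  from 0. Columns are nonempty, so that every filling has a unique representation.
  A box is a pair (row, column).
\<close>

type_synonym 'a filling = "'a list list"
type_synonym box = "nat \<times> nat"

abbreviation col_lengths :: "'a filling \<Rightarrow> nat list" where
  "col_lengths T \<equiv> map length T"

definition partition_shape :: "'a filling \<Rightarrow> bool" where
  "partition_shape T \<longleftrightarrow> [] \<notin> set T \<and> sorted_wrt (\<ge>) (col_lengths T)"

definition rows_wrt :: "('a \<Rightarrow> 'a \<Rightarrow> bool) \<Rightarrow> 'a filling \<Rightarrow> bool" where
  "rows_wrt R T \<longleftrightarrow>
     (\<forall>j<length T - 1. \<forall>r<length (T ! Suc j). R (T ! j ! r) (T ! Suc j ! r))"

definition decreasing_tableau :: "nat filling \<Rightarrow> bool" where
  "decreasing_tableau T \<longleftrightarrow> partition_shape T \<and> (\<forall>C\<in>set T. positive_word C) \<and>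
     (\<forall>C\<in>set T. sorted_wrt (>) C) \<and> rows_wrt (>) T"

definition RSSYT :: "nat filling \<Rightarrow> bool" where
  "RSSYT T \<longleftrightarrow> partition_shape T \<and> (\<forall>C\<in>set T. positive_word C) \<and>
     (\<forall>C\<in>set T. sorted_wrt (>) C) \<and> rows_wrt (\<ge>) T"

text \<open>The identification of an RSSYT with a set-valued tableau all of whose sets are singletons.\<close>

definition set_valued :: "nat filling \<Rightarrow> nat set filling" where
  "set_valued T = map (map (\<lambda>x. {x})) T"

definition tableau_word :: "nat filling \<Rightarrow> nat list" where
  "tableau_word T = concat (map rev T)"

definition reduced_decreasing_tableau :: "nat filling \<Rightarrow> bool" where
  "reduced_decreasing_tableau T \<longleftrightarrow> decreasing_tableau T \<and> reduced (tableau_word T)"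

text \<open>The column to the right of the last one is treated as an empty column.\<close>

definition column :: "'a filling \<Rightarrow> nat \<Rightarrow> 'a list" where
  "column T j = (if j < length T then T ! j else [])"

definition set_column :: "'a filling \<Rightarrow> nat \<Rightarrow> 'a list \<Rightarrow> 'a filling" where
  "set_column T j C = (if j < length T then T[j := C] else T @ [C])"

definition largest_below :: "nat \<Rightarrow> nat list \<Rightarrow> nat" where
  "largest_below x C = Max {z \<in> set C. z < x}"

definition replace_entry :: "nat \<Rightarrow> nat \<Rightarrow> nat list \<Rightarrow> nat list" where
  "replace_entry y x C = map (\<lambda>z. if z = y then x else z) C"

definition rightmost_box :: "'a filling \<Rightarrow> nat \<Rightarrow> box" where
  "rightmost_box T r = (r, Max {j \<in> {..<length T}. r < length (T ! j)})"

text \<open>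
  \<open>hecke_from j x T\<close> performs Hecke insertion of \<open>x\<close> starting in column \<open>j\<close> and returns
  \<open>(P, c, \<alpha>)\<close>. The situation in which nothing is appended to an empty column, so that the
  bottom entry of that column does not exist, does not arise when \<open>x\<close> is inserted
  into the first column of a decreasing tableau.
\<close>

function hecke_from :: "nat \<Rightarrow> nat \<Rightarrow> nat filling \<Rightarrow> nat filling \<times> box \<times> nat" where
  "hecke_from j x T =
     (let C = column T j in
      if \<forall>z\<in>set C. x \<le> z then
        (let T' = set_column T j (C @ [x]) in
         if decreasing_tableau T' then (T', (length C, j), 1)
         else (T, rightmost_box T (length C - 1), 0))
      else
        (let y = largest_below x C; T' = set_column T j (replace_entry y x C) in
         hecke_from (Suc j) y (if decreasing_tableau T' then T' else T)))"
  by pat_completeness auto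
termination
  by (relation "measure (\<lambda>(j, x, T). length T - j)")
     (auto simp: column_def set_column_def split: if_splits)

definition hecke_insert :: "nat \<Rightarrow> nat filling \<Rightarrow> nat filling \<times> box \<times> nat" where
  "hecke_insert x T = hecke_from 0 x T"

text \<open>A new box in column \<open>j\<close> is always the one directly below that column.\<close>

fun adjoin_box :: "box \<Rightarrow> 'a \<Rightarrow> 'a filling \<Rightarrow> 'a filling" where
  "adjoin_box (r, j) v Q = set_column Q j (column Q j @ [v])"

fun add_to_box :: "box \<Rightarrow> nat \<Rightarrow> nat set filling \<Rightarrow> nat set filling" where
  "add_to_box (r, j) y Q = Q[j := (Q ! j)[r := insert y (Q ! j ! r)]]"

definition Insert_step ::
    "nat filling \<times> nat set filling \<Rightarrow> nat \<times> nat \<Rightarrow> nat filling \<times> nat set filling" where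
  "Insert_step = (\<lambda>(P', Q') (x, y). case hecke_insert x P' of (P, c, \<alpha>) \<Rightarrow>
     (P, if \<alpha> = 1 then adjoin_box c {y} Q' else add_to_box c y Q'))"

definition Insert :: "nat list \<times> nat list \<Rightarrow> nat filling \<times> nat set filling" where
  "Insert = (\<lambda>(a, i). foldl Insert_step ([], []) (zip a i))"

function EG_from :: "nat \<Rightarrow> nat \<Rightarrow> nat filling \<Rightarrow> nat filling \<times> box" where
  "EG_from j x T =
     (let C = column T j in
      if \<forall>z\<in>set C. x < z then (set_column T j (C @ [x]), (length C, j))
      else if x \<in> set C then EG_from (Suc j) (x - 1) T
      else (let y = largest_below x C in
            EG_from (Suc j) y (set_column T j (replace_entry y x C))))"
  by pat_completeness auto
termination
  by (relation "measure (\<lambda>(j, x, T). length T - j)")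
     (auto simp: column_def set_column_def split: if_splits)

definition EG_step ::
    "nat filling \<times> nat filling \<Rightarrow> nat \<times> nat \<Rightarrow> nat filling \<times> nat filling" where
  "EG_step = (\<lambda>(P', Q') (x, y). case EG_from 0 x P' of (P, c) \<Rightarrow> (P, adjoin_box c y Q'))"

definition EG_Insert :: "nat list \<times> nat list \<Rightarrow> nat filling \<times> nat filling" where
  "EG_Insert = (\<lambda>(a, i). foldl EG_step ([], []) (zip a i))"

definition decreasing_column :: "nat set \<Rightarrow> nat list" where
  "decreasing_column S = rev (sorted_list_of_set S)"

definition star :: "nat set \<Rightarrow> nat \<Rightarrow> nat set" where
  "star S m = (if \<exists>s\<in>S. m \<le> s then insert m (S - {Min {s \<in> S. m \<le> s}}) else insert m S)"

definition K_plus :: "nat filling \<Rightarrow> nat filling" where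
  "K_plus P =
     map (\<lambda>j. decreasing_column (foldl star {} (tableau_word (drop j P)))) [0..<length P]"

text \<open>
  \<open>left_match C [a\<^sub>1, \<dots>, a\<^sub>m]\<close> is the list \<open>[b\<^sub>1, \<dots>, b\<^sub>m]\<close> in the definition of
  the operation on columns; passing to the elements of \<open>C\<close> above \<open>b\<^sub>j\<close> enforces that the
  next letter chosen exceeds \<open>b\<^sub>j\<close>. The sets whose minimum is taken are nonempty when the operation is
  applied to the columns of an RSSYT.
\<close>

fun left_match :: "nat set \<Rightarrow> nat list \<Rightarrow> nat list" where
  "left_match C [] = []"
| "left_match C (a # as) =
     (let b = Min {c \<in> C. a \<le> c} in b # left_match {c \<in> C. b < c} as)"

definition column_tri :: "nat set \<Rightarrow> nat set \<Rightarrow> nat set" where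
  "column_tri C1 C2 = set (left_match C1 (sorted_list_of_set C2))"

fun columns_tri :: "nat set list \<Rightarrow> nat set" where
  "columns_tri [] = {}"
| "columns_tri [C] = C"
| "columns_tri (C # D # Cs) = column_tri C (columns_tri (D # Cs))"

definition K_minus :: "nat filling \<Rightarrow> nat filling" where
  "K_minus T =
     map (\<lambda>k. decreasing_column (columns_tri (map set (take (Suc k) T)))) [0..<length T]"

definition key_ge :: "nat filling \<Rightarrow> nat filling \<Rightarrow> bool" where
  "key_ge K L \<longleftrightarrow> list_all2 (list_all2 (\<ge>)) K L"

inductive nilplactic_move :: "nat list \<Rightarrow> nat list \<Rightarrow> bool" where
  "a < b \<Longrightarrow> b < c \<Longrightarrow> nilplactic_move (u @ [b, a, c] @ v) (u @ [b, c, a] @ v)"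
| "a < b \<Longrightarrow> b < c \<Longrightarrow> nilplactic_move (u @ [a, c, b] @ v) (u @ [c, a, b] @ v)"
| "nilplactic_move (u @ [k, Suc k, k] @ v) (u @ [Suc k, k, Suc k] @ v)"

definition nilplactic :: "nat list \<Rightarrow> nat list \<Rightarrow> bool" where
  "nilplactic = equivclp (\<lambda>x y. reduced x \<and> reduced y \<and> nilplactic_move x y)"

definition nil_factorization :: "nat filling \<Rightarrow> nat list list \<Rightarrow> bool" where
  "nil_factorization P vs \<longleftrightarrow> nilplactic (tableau_word P) (concat vs) \<and>
     (\<forall>v\<in>set vs. sorted_wrt (<) v) \<and> mset (map length vs) = mset (col_lengths P)"

text \<open>
  The set of letters of a last factor of length \<open>m\<close>. It is only meaningful, and only used, when
  \<open>m\<close> is a column length of the reduced decreasing tableau \<open>P\<close>.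
\<close>

definition nil_last_factor :: "nat filling \<Rightarrow> nat \<Rightarrow> nat set" where
  "nil_last_factor P m =
     (THE S. \<exists>vs. nil_factorization P vs \<and> length (last vs) = m \<and> S = set (last vs))"

definition right_nil_key :: "nat filling \<Rightarrow> nat filling" where
  "right_nil_key P = map (\<lambda>m. decreasing_column (nil_last_factor P m)) (col_lengths P)"

definition Cb0 :: "(nat list \<times> nat list) set" where
  "Cb0 = {(a, i). bounded_compatible a i \<and> reduced a}"

definition Tb0 :: "(nat filling \<times> nat filling) set" where
  "Tb0 = {(P, Q). col_lengths P = col_lengths Q \<and> reduced_decreasing_tableau P \<and> RSSYT Q \<and>
     key_ge (K_plus P) (K_minus Q)}"

end

theory Submission
  imports Defs
begin

text \<open>
  Columns are treated as finite sets, and a letter \<open>x\<close> inserted into a column \<open>C\<close> with output \<open>y\<close> satisfies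
  \<open>x C \<sim> C' y\<close> in the nilplactic monoid. Hence the insertion tableau of \<open>a\<close> represents the class of the
  reversed word; a check of the elementary moves on one column shows that it depends only on this class.
  Row bumping and reverse insertion give the bijection without the bound.

  The letters of a reading word act by \<open>star\<close> compatibly with nilplactic equivalence. When a letter \<open>x\<close> with
  index \<open>y\<close> creates a box in column \<open>k\<close>, the two keys change in their \<open>k\<close>-th columns only, each by one letter:
  the \<open>k\<close>-th column of \<open>K_plus\<close> receives its least letter that is missing from column \<open>k + 1\<close>, and the \<open>k\<close>-th column of \<open>K_minus\<close>
  receives the least letter of column \<open>k - 1\<close> that it does not contain (or \<open>y\<close> if \<open>k\<close> is the first column). Counting the letters below
  a threshold shows that the comparison of the keys is preserved in both directions exactly when \<open>y \<le> x\<close>.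

  For the nil key, right insertion moves a column to the end of the word. Such a factorization is unique given its lengths,
  because every increasing factor adds a vertical strip and the shapes leave no choice.
\<close>

subsection \<open>Reduced words and nilplactic equivalence\<close>

text \<open>The tableau conditions are entrywise, while bumping moves entries between positions. The
  counts \<open>up C t\<close> avoid positions: neighbouring columns are compared by
  \<open>up D t \<le> up C (Suc t)\<close>, an insertion changes a count by one on an interval of
  thresholds, and \<open>star\<close> truncates counts. The arguments about tableaux and keys thus
  become inequalities at each threshold. Reducedness enters mainly through one fact: two equal
  letters separated only by letters that commute with them cancel. It forces \<open>x - 1\<close>
  into every column that already contains an inserted \<open>x\<close>, which is what makes the
  Edelman-Greene rule and its inverse work. That a reading word inserts to its own tableau is not
  computed. Reverse insertion produces some word with this tableau, and invariance under nilplactic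
  moves transfers the result to the reading word.\<close>

lemma word_perm_Nil [simp]: "word_perm [] = id"
  by (simp add: word_perm_def)

lemma word_perm_Cons [simp]: "word_perm (x # a) = transpose x (Suc x) \<circ> word_perm a"
  by (simp add: word_perm_def)

lemma word_perm_append [simp]: "word_perm (a @ b) = word_perm a \<circ> word_perm b"
  by (induction a) (auto simp: comp_assoc)

lemma transpose_cancel [simp]: "transpose x y \<circ> (transpose x y \<circ> f) = f"
  by (simp add: o_assoc)

lemma word_perm_rev: "word_perm (rev a) \<circ> word_perm a = id" "word_perm a \<circ> word_perm (rev a) = id"
proof -
  show *: "word_perm (rev a) \<circ> word_perm a = id" for a
  proof (induction a)
    case (Cons x a)
    have "word_perm (rev (x # a)) \<circ> word_perm (x # a) =
        word_perm (rev a) \<circ> (transpose x (Suc x) \<circ> (transpose x (Suc x) \<circ> word_perm a))"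
      by (simp add: comp_assoc)
    with Cons show ?case by simp
  qed simp
  show "word_perm a \<circ> word_perm (rev a) = id"
    using *[of "rev a"] by simp
qed

lemma word_perm_S_plus: "positive_word a \<Longrightarrow> word_perm a \<in> S_plus"
proof (induction a)
  case Nil
  have "id permutes {1..0::nat}" by (rule permutes_id)
  then show ?case unfolding S_plus_def word_perm_Nil by blast
next
  case (Cons x a)
  then obtain n where n: "word_perm a permutes {1..n}" by (auto simp: S_plus_def)
  have "word_perm a permutes {1..max n (Suc x)}" "transpose x (Suc x) permutes {1..max n (Suc x)}"
    using n Cons.prems by (auto intro!: permutes_subset[OF n] permutes_swap_id)
  then have "word_perm (x # a) permutes {1..max n (Suc x)}"
    unfolding word_perm_Cons by (intro permutes_compose)
  then show ?case unfolding S_plus_def by blast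
qed

text \<open>The permutation can only be \<open>word_perm a\<close>, and every positive word
  multiplies to an element of \<open>S_plus\<close>; what remains is minimality of the
  length.\<close>

lemma reduced_iff: "reduced a \<longleftrightarrow> positive_word a \<and>
   (\<forall>b. positive_word b \<and> word_perm b = word_perm a \<longrightarrow> length a \<le> length b)"
  using word_perm_S_plus[of a] unfolding reduced_def reduced_word_of_def by auto

lemma reduced_Nil [simp]: "reduced []"
  by (auto simp: reduced_iff)

text \<open>A shorter word for the factor could be substituted into the whole word.\<close>

lemma reduced_factor: assumes "reduced (u @ v @ w)" shows "reduced v"
  unfolding reduced_iff
proof (intro conjI allI impI)
  show "positive_word v" using assms by (auto simp: reduced_iff)
  fix b assume b: "positive_word b \<and> word_perm b = word_perm v"
  then have "positive_word (u @ b @ w) \<and> word_perm (u @ b @ w) = word_perm (u @ v @ w)"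
    using assms by (auto simp: reduced_iff)
  then have "length (u @ v @ w) \<le> length (u @ b @ w)"
    using assms unfolding reduced_iff by blast
  then show "length v \<le> length b" by simp
qed

lemma reduced_append1: "reduced (u @ v) \<Longrightarrow> reduced u"
  and reduced_append2: "reduced (u @ v) \<Longrightarrow> reduced v"
  using reduced_factor[of "[]" u v] reduced_factor[of u v "[]"] by auto

lemma reduced_tl: "reduced (x # v) \<Longrightarrow> reduced v"
  using reduced_append2[of "[x]" v] by simp

text \<open>Reversal inverts the product, so a shorter word for the inverse would, reversed, shorten
  \<open>a\<close>.\<close>

lemma reduced_rev: assumes "reduced a" shows "reduced (rev a)"
  unfolding reduced_iff
proof (intro conjI allI impI)
  show "positive_word (rev a)" using assms by (auto simp: reduced_iff)
  fix b assume b: "positive_word b \<and> word_perm b = word_perm (rev a)"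
  have "word_perm (rev b) = word_perm (rev b) \<circ> (word_perm (rev a) \<circ> word_perm a)"
    by (simp add: word_perm_rev)
  also have "\<dots> = (word_perm (rev b) \<circ> word_perm b) \<circ> word_perm a"
    using b by (simp add: o_assoc)
  also have "\<dots> = word_perm a" by (simp add: word_perm_rev)
  finally have "length a \<le> length (rev b)"
    using assms b unfolding reduced_iff by (metis set_rev)
  then show "length (rev a) \<le> length b" by simp
qed

lemma not_reduced_if_shorter:
  "positive_word b \<Longrightarrow> word_perm b = word_perm a \<Longrightarrow> length b < length a \<Longrightarrow> \<not> reduced a"
  by (auto simp: reduced_iff not_le)

lemma transpose_comm: "Suc x < y \<Longrightarrow>
    transpose x (Suc x) \<circ> (transpose y (Suc y) \<circ> f) = transpose y (Suc y) \<circ> (transpose x (Suc x) \<circ> f)"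
  for x y :: nat and f :: "nat \<Rightarrow> nat"
  by (rule ext) (auto simp: transpose_def)

lemma transpose_braid:
  "transpose x (Suc x) \<circ> (transpose (Suc x) (Suc (Suc x)) \<circ> (transpose x (Suc x) \<circ> f)) =
   transpose (Suc x) (Suc (Suc x)) \<circ> (transpose x (Suc x) \<circ> (transpose (Suc x) (Suc (Suc x)) \<circ> f))"
  for x :: nat and f :: "nat \<Rightarrow> nat"
  by (rule ext) (auto simp: transpose_def)

text \<open>The moves without the requirement that both words be reduced. They preserve product,
  length and letters, hence reducedness, so on reduced words this agrees with
  \<open>nilplactic\<close> (\<open>nilplactic_iff\<close>).\<close>

definition np :: "nat list \<Rightarrow> nat list \<Rightarrow> bool" where
  "np = equivclp nilplactic_move"

lemma move_word_perm: "nilplactic_move a b \<Longrightarrow> word_perm a = word_perm b"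
proof (induction rule: nilplactic_move.induct)
  case (1 a b c u v)
  then show ?case using transpose_comm[of a c "word_perm v"] by (simp add: comp_assoc)
next
  case (2 a b c u v)
  then show ?case using transpose_comm[of a c "transpose b (Suc b) \<circ> word_perm v"]
    by (simp add: comp_assoc)
next
  case (3 u k v)
  show ?case by (simp add: comp_assoc transpose_braid)
qed

lemma move_length: "nilplactic_move a b \<Longrightarrow> length a = length b"
  by (induction rule: nilplactic_move.induct) auto

lemma move_set: "nilplactic_move a b \<Longrightarrow> set a = set b"
  by (induction rule: nilplactic_move.induct) auto

lemma move_cong: "nilplactic_move a b \<Longrightarrow> nilplactic_move (u @ a @ v) (u @ b @ v)"
proof (induction rule: nilplactic_move.induct)
  case (1 a b c u' v')
  then show ?case using nilplactic_move.intros(1)[of a b c "u @ u'" "v' @ v"] by simp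
next
  case (2 a b c u' v')
  then show ?case using nilplactic_move.intros(2)[of a b c "u @ u'" "v' @ v"] by simp
next
  case (3 u' k v')
  then show ?case using nilplactic_move.intros(3)[of "u @ u'" k "v' @ v"] by simp
qed

lemma np_refl [simp, intro]: "np a a"
  by (simp add: np_def)

lemma np_sym: "np a b \<Longrightarrow> np b a"
  by (simp add: np_def equivclp_sym)

lemma np_trans [trans]: "np a b \<Longrightarrow> np b c \<Longrightarrow> np a c"
  unfolding np_def by (rule equivclp_trans)

lemma np_move: "nilplactic_move a b \<Longrightarrow> np a b"
  by (simp add: np_def r_into_equivclp)

lemma np_induct [consumes 1, case_names refl step]:
  assumes "np a b" "P a"
    "\<And>b c. np a b \<Longrightarrow> nilplactic_move b c \<or> nilplactic_move c b \<Longrightarrow> P b \<Longrightarrow> P c"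
  shows "P b"
  using assms unfolding np_def by (rule equivclp_induct)

lemma np_word_perm: "np a b \<Longrightarrow> word_perm b = word_perm a"
  by (induction rule: np_induct) (auto dest: move_word_perm)

lemma np_length: "np a b \<Longrightarrow> length b = length a"
  by (induction rule: np_induct) (auto dest: move_length)

lemma np_set: "np a b \<Longrightarrow> set b = set a"
  by (induction rule: np_induct) (auto dest: move_set)

lemma np_reduced: "np a b \<Longrightarrow> reduced a \<longleftrightarrow> reduced b"
  using np_word_perm[of a b] np_length[of a b] np_set[of a b] by (simp add: reduced_iff)

lemma np_cong: "np a b \<Longrightarrow> np (u @ a @ v) (u @ b @ v)"
proof (induction rule: np_induct)
  case (step b c)
  then show ?case by (meson move_cong np_move np_sym np_trans)
qed simp

lemma np_append: "np a b \<Longrightarrow> np c d \<Longrightarrow> np (a @ c) (b @ d)"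
  using np_cong[of a b "[]" c] np_cong[of c d b "[]"] np_trans by fastforce

lemma np_append1: "np a b \<Longrightarrow> np (a @ c) (b @ c)"
  by (rule np_append) auto

lemma np_append2: "np a b \<Longrightarrow> np (c @ a) (c @ b)"
  by (rule np_append) auto

lemma np_Cons: "np a b \<Longrightarrow> np (x # a) (x # b)"
  using np_append2[of a b "[x]"] by simp

lemma nilplactic_iff: assumes "reduced a" shows "nilplactic a b \<longleftrightarrow> np a b"
proof
  assume "np a b"
  then show "nilplactic a b"
  proof (induction rule: np_induct)
    case (step b c)
    have "reduced b" "reduced c"
      using step.hyps assms np_reduced np_move by metis+
    then show ?case using step.IH step.hyps(2) unfolding nilplactic_def
      by (metis (mono_tags, lifting) equivclp_sym equivclp_trans r_into_equivclp)
  qed (simp add: nilplactic_def)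
next
  assume "nilplactic a b"
  then show "np a b" unfolding nilplactic_def
  proof (induction rule: equivclp_induct)
    case (step b c)
    then show ?case by (meson np_move np_sym np_trans)
  qed simp
qed

lemma np_bac: "a < b \<Longrightarrow> b < c \<Longrightarrow> np (b # a # c # v) (b # c # a # v)"
  using nilplactic_move.intros(1)[of a b c "[]" v] np_move by simp

lemma np_cab: "a < b \<Longrightarrow> b < c \<Longrightarrow> np (c # a # b # v) (a # c # b # v)"
  using nilplactic_move.intros(2)[of a b c "[]" v] np_move np_sym by simp

lemma np_braid: "np (k # Suc k # k # v) (Suc k # k # Suc k # v)"
  using nilplactic_move.intros(3)[of "[]" k v] np_move by simp

text \<open>When \<open>x\<close> passes a letter \<open>u\<close>, the letter after
  \<open>u\<close> lies strictly between \<open>u\<close> and \<open>x\<close> and licenses the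
  move; for the last letter of \<open>us\<close> this is \<open>y\<close>.\<close>

lemma np_push_left:
  assumes "sorted_wrt (<) (us @ [y])" "y < x"
  shows "np (x # us @ y # vs) (us @ x # y # vs)"
  using assms
proof (induction us)
  case (Cons u us)
  obtain w ws where w: "us @ y # vs = w # ws" "u < w" "w < x"
    using Cons.prems by (cases us) auto
  have "np (x # u # w # ws) (u # x # w # ws)" using w by (intro np_cab) auto
  moreover have "np (u # x # us @ y # vs) (u # us @ x # y # vs)"
    using Cons by (intro np_Cons) auto
  ultimately show ?case using w np_trans by simp
qed simp

text \<open>When \<open>y\<close> passes a letter \<open>v\<close>, the letter in front of
  \<open>y\<close> lies strictly between \<open>y\<close> and \<open>v\<close> and licenses the
  move; then \<open>v\<close> takes over this role.\<close>

lemma np_push_right: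
  assumes "sorted_wrt (<) (x # vs)" "y < x"
  shows "np (x # y # vs) (x # vs @ [y])"
  using assms
proof (induction vs arbitrary: x)
  case (Cons v vs)
  have "np (x # y # v # vs) (x # v # y # vs)" using Cons by (intro np_bac) auto
  moreover have "np (x # v # y # vs) (x # v # vs @ [y])" using Cons by (intro np_Cons Cons.IH) auto
  ultimately show ?case using np_trans by simp
qed simp

lemma word_perm_commute:
  fixes f :: "nat \<Rightarrow> nat"
  shows "(\<forall>u\<in>set us. Suc u < x \<or> Suc x < u) \<Longrightarrow>
    word_perm us \<circ> (transpose x (Suc x) \<circ> f) = transpose x (Suc x) \<circ> (word_perm us \<circ> f)"
proof (induction us arbitrary: f)
  case (Cons u us)
  have "transpose u (Suc u) \<circ> (transpose x (Suc x) \<circ> (word_perm us \<circ> f)) =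
      transpose x (Suc x) \<circ> (transpose u (Suc u) \<circ> (word_perm us \<circ> f))"
    using transpose_comm[of u x "word_perm us \<circ> f"] transpose_comm[of x u "word_perm us \<circ> f"] Cons.prems by auto
  moreover have "word_perm us \<circ> (transpose x (Suc x) \<circ> f) = transpose x (Suc x) \<circ> (word_perm us \<circ> f)"
    using Cons.prems by (intro Cons.IH) simp
  ultimately show ?case unfolding word_perm_Cons comp_assoc by simp
qed simp

text \<open>All letters of \<open>us\<close> commute with \<open>x\<close>, so the two copies of
  \<open>x\<close> meet and cancel.\<close>

lemma not_reduced_repeat:
  assumes "\<forall>u\<in>set us. Suc u < x \<or> Suc x < u"
  shows "\<not> reduced (x # us @ x # vs)"
proof
  assume r: "reduced (x # us @ x # vs)"
  have "word_perm (us @ vs) = word_perm (x # us @ x # vs)"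
    using word_perm_commute[OF assms, of "word_perm vs"] by simp
  with r show False
    using not_reduced_if_shorter[of "us @ vs" "x # us @ x # vs"] by (auto simp: reduced_iff)
qed

lemma not_reduced_twice: "\<not> reduced (x # x # vs)"
  using not_reduced_repeat[of "[]" x vs] by simp

subsection \<open>Columns as sets\<close>

text \<open>In a column listed from top to bottom, this is the length of the initial segment of
  entries at least \<open>t\<close>.\<close>

definition up :: "nat set \<Rightarrow> nat \<Rightarrow> nat" where
  "up C t = card {c \<in> C. t \<le> c}"

abbreviation asc :: "nat set \<Rightarrow> nat list" where
  "asc \<equiv> sorted_list_of_set"

definition word_of :: "nat set list \<Rightarrow> nat list" where
  "word_of T = concat (map asc T)"

lemma word_of_Nil [simp]: "word_of [] = []"
  and word_of_Cons [simp]: "word_of (C # T) = asc C @ word_of T"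
  and word_of_append [simp]: "word_of (T @ U) = word_of T @ word_of U"
  by (simp_all add: word_of_def)

text \<open>The \<open>Suc\<close> encodes strictness: \<open>D\<close> is no longer than
  \<open>C\<close>, and each of its entries is smaller than the left neighbour in \<open>C\<close>.
  See \<open>columns_compare\<close>; \<open>wdom\<close> is the weak version.\<close>

definition dom :: "nat set \<Rightarrow> nat set \<Rightarrow> bool" where
  "dom C D \<longleftrightarrow> (\<forall>t. up D t \<le> up C (Suc t))"

definition wdom :: "nat set \<Rightarrow> nat set \<Rightarrow> bool" where
  "wdom C D \<longleftrightarrow> (\<forall>t. up D t \<le> up C t)"

definition fcol :: "nat set list \<Rightarrow> nat set" where
  "fcol T = (case T of [] \<Rightarrow> {} | C # _ \<Rightarrow> C)"

lemma fcol_simps [simp]: "fcol [] = {}" "fcol (C # T) = C"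
  by (simp_all add: fcol_def)

fun Tab :: "nat set list \<Rightarrow> bool" where
  "Tab [] = True"
| "Tab (C # T) = (finite C \<and> C \<noteq> {} \<and> 0 \<notin> C \<and> dom C (fcol T) \<and> Tab T)"

lemma up_empty [simp]: "up {} t = 0" by (simp add: up_def)

lemma up_antimono: "finite C \<Longrightarrow> s \<le> t \<Longrightarrow> up C t \<le> up C s"
  unfolding up_def by (rule card_mono) auto

lemma up_mono: "finite C \<Longrightarrow> D \<subseteq> C \<Longrightarrow> up D t \<le> up C t"
  unfolding up_def by (rule card_mono) auto

lemma up_insert: "finite C \<Longrightarrow> x \<notin> C \<Longrightarrow> up (insert x C) t = up C t + (if t \<le> x then 1 else 0)"
proof -
  assume "finite C" "x \<notin> C"
  moreover have "{c \<in> insert x C. t \<le> c} = (if t \<le> x then insert x {c \<in> C. t \<le> c} else {c \<in> C. t \<le> c})"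
    by auto
  ultimately show ?thesis by (simp add: up_def)
qed

lemma up_remove: "finite C \<Longrightarrow> x \<in> C \<Longrightarrow> up C t = up (C - {x}) t + (if t \<le> x then 1 else 0)"
  using up_insert[of "C - {x}" x t] by (simp add: insert_absorb)

lemma up_Suc: "finite C \<Longrightarrow> up C t = up C (Suc t) + (if t \<in> C then 1 else 0)"
proof -
  assume f: "finite C"
  have "{c \<in> C. t \<le> c} = (if t \<in> C then insert t {c \<in> C. Suc t \<le> c} else {c \<in> C. Suc t \<le> c})"
    by (auto simp: Suc_le_eq le_less)
  then show ?thesis using f by (simp add: up_def)
qed

lemma up_eq_gap: "finite C \<Longrightarrow> s \<le> t \<Longrightarrow> (\<And>c. c \<in> C \<Longrightarrow> s \<le> c \<Longrightarrow> t \<le> c) \<Longrightarrow> up C s = up C t"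
  unfolding up_def by (rule arg_cong[where f = card]) (auto intro: le_trans)

lemma up_pos_iff: "finite C \<Longrightarrow> 0 < up C t \<longleftrightarrow> (\<exists>c\<in>C. t \<le> c)"
  by (auto simp: up_def card_gt_0_iff)

lemma up_0: "up C 0 = card C"
  by (simp add: up_def)

lemma dom_empty [simp]: "dom C {}" "wdom C {}"
  by (simp_all add: dom_def wdom_def)

subsection \<open>Inserting a letter into a column\<close>

text \<open>The output is 0 when the letter is appended at the bottom; 0 is never a letter.\<close>

definition out :: "nat \<Rightarrow> nat set \<Rightarrow> nat" where
  "out x C = (if x \<in> C then x - 1 else Max (insert 0 {z \<in> C. z < x}))"

text \<open>The second branch covers both replacing and appending: if the output is 0, nothing is
  removed from a column of positive letters.\<close>

definition bump :: "nat \<Rightarrow> nat set \<Rightarrow> nat set" where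
  "bump x C = (if x \<in> C then C else insert x (C - {out x C}))"

text \<open>The last clause is what reducedness of \<open>x # asc C\<close> provides
  (\<open>good_if_reduced\<close>). It makes the output \<open>x - 1\<close> of the special case a
  letter of the column, like every other output.\<close>

definition good :: "nat \<Rightarrow> nat set \<Rightarrow> bool" where
  "good x C \<longleftrightarrow> finite C \<and> 0 \<notin> C \<and> 0 < x \<and> (x \<in> C \<longrightarrow> x - 1 \<in> C)"

definition letter :: "nat \<Rightarrow> nat list" where
  "letter y = (if y = 0 then [] else [y])"

lemma out_less: "good x C \<Longrightarrow> out x C < x"
  unfolding good_def out_def by (auto simp: Max_less_iff)

lemma out_in: "good x C \<Longrightarrow> out x C \<noteq> 0 \<Longrightarrow> out x C \<in> C"
proof -
  assume g: "good x C" and n: "out x C \<noteq> 0"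
  have "Max (insert 0 {z \<in> C. z < x}) \<in> insert 0 {z \<in> C. z < x}"
    using g by (intro Max_in) (auto simp: good_def)
  then show ?thesis using g n by (auto simp: good_def out_def split: if_splits)
qed

lemma out_gap: "good x C \<Longrightarrow> z \<in> C \<Longrightarrow> z < x \<Longrightarrow> z \<le> out x C"
  unfolding good_def out_def by auto

lemma out_eqI: "good x C \<Longrightarrow> x \<notin> C \<Longrightarrow> y \<in> insert 0 C \<Longrightarrow> y < x \<Longrightarrow> (\<And>z. z \<in> C \<Longrightarrow> z < x \<Longrightarrow> z \<le> y) \<Longrightarrow> out x C = y"
  unfolding good_def out_def by (auto intro!: Max_eqI)

lemma out_mem: "good x C \<Longrightarrow> x \<in> C \<Longrightarrow> out x C = x - 1 \<and> 0 < x - 1"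
  unfolding good_def out_def by (metis gr0I)

lemma out_0_iff:
  assumes "good x C"
  shows "out x C = 0 \<longleftrightarrow> (\<forall>z\<in>C. x < z)"
proof
  assume 0: "out x C = 0"
  show "\<forall>z\<in>C. x < z"
  proof
    fix z assume z: "z \<in> C"
    have "\<not> z < x" using out_gap[OF assms z] 0 z assms by (auto simp: good_def)
    moreover have "z \<noteq> x" using out_mem[OF assms] 0 z by auto
    ultimately show "x < z" by simp
  qed
next
  assume "\<forall>z\<in>C. x < z"
  then show "out x C = 0" using out_in[OF assms] out_less[OF assms] by fastforce
qed

lemma bump_in [simp]: "x \<in> bump x C"
  by (simp add: bump_def)

lemma bump_finite [simp]: "finite C \<Longrightarrow> finite (bump x C)"
  by (simp add: bump_def)

lemma bump_0: "0 \<notin> C \<Longrightarrow> 0 < x \<Longrightarrow> 0 \<notin> bump x C"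
  by (simp add: bump_def)

lemma bump_append: "good x C \<Longrightarrow> out x C = 0 \<Longrightarrow> bump x C = insert x C \<and> x \<notin> C"
  using out_0_iff[of x C] by (auto simp: bump_def good_def)

lemma card_bump: "good x C \<Longrightarrow> card (bump x C) = card C + (if out x C = 0 then 1 else 0)"
proof (cases "out x C = 0")
  case True
  moreover assume "good x C"
  ultimately show ?thesis using bump_append[of x C] by (simp add: good_def)
next
  case False
  moreover assume g: "good x C"
  ultimately show ?thesis using out_in[of x C] card_Suc_Diff1[of C "out x C"]
    by (auto simp: bump_def good_def)
qed

text \<open>Replacing \<open>y\<close> by \<open>x\<close> raises the counts on the interval of
  thresholds above \<open>y\<close> and up to \<open>x\<close>. The second disjunct is the threshold
  0, which the interval misses when \<open>x\<close> is appended and the output is the conventional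
  0.\<close>

lemma up_bump: "good x C \<Longrightarrow> up (bump x C) t = up C t + (if x \<notin> C \<and> out x C < t \<and> t \<le> x \<or> t = 0 \<and> out x C = 0 then 1 else 0)"
proof (cases "x \<in> C")
  case True
  moreover assume g: "good x C"
  ultimately show ?thesis using out_mem[of x C] by (simp add: bump_def)
next
  case F: False
  assume g: "good x C"
  show ?thesis
  proof (cases "out x C = 0")
    case True
    then show ?thesis using F g up_insert[of C x t] bump_append[of x C] by (auto simp: good_def)
  next
    case False
    with g have "out x C \<in> C" by (rule out_in)
    then show ?thesis using F False g up_insert[of "C - {out x C}" x t] up_remove[of C "out x C" t] out_less[OF g]
      by (auto simp: bump_def good_def)
  qed
qed

lemma up_bump_ge: "good x C \<Longrightarrow> up C t \<le> up (bump x C) t"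
  by (simp add: up_bump)

lemma asc_unique: "finite C \<Longrightarrow> sorted_wrt (<) l \<Longrightarrow> set l = C \<Longrightarrow> asc C = l"
  using sorted_list_of_set.idem_if_sorted_distinct[of l] by (auto simp: strict_sorted_iff)

lemma sorted_asc [simp]: "sorted_wrt (<) (asc C)"
  using strict_sorted_iff by (auto simp: strict_sorted_iff)

lemma asc_split:
  assumes "finite C" "y \<in> C"
  shows "asc C = asc {c \<in> C. c < y} @ y # asc {c \<in> C. y < c}"
  using assms by (intro asc_unique) (auto simp: sorted_wrt_append)

lemma asc_insert_less: "finite C \<Longrightarrow> \<forall>z\<in>C. x < z \<Longrightarrow> asc (insert x C) = x # asc C"
  by (intro asc_unique) auto

text \<open>If \<open>C\<close> contained \<open>x\<close> but not \<open>x - 1\<close>, then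
  \<open>x\<close> would commute with all smaller letters of \<open>C\<close> and cancel against its
  copy in \<open>C\<close>.\<close>

lemma good_if_reduced:
  assumes "finite C" "0 \<notin> C" "reduced (x # asc C)"
  shows "good x C"
proof (rule ccontr)
  have "0 < x" using assms(3) by (auto simp: reduced_iff)
  moreover assume "\<not> good x C"
  ultimately have x: "x \<in> C" "x - 1 \<notin> C" using assms unfolding good_def by auto
  have "\<forall>u\<in>set (asc {c \<in> C. c < x}). Suc u < x"
  proof
    fix u assume "u \<in> set (asc {c \<in> C. c < x})"
    then have "u \<in> C" "u < x" using assms(1) by auto
    then show "Suc u < x" using x(2) by (cases "Suc u = x") auto
  qed
  then have "\<not> reduced (x # asc {c \<in> C. c < x} @ x # asc {c \<in> C. x < c})"
    by (intro not_reduced_repeat) auto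
  then show False using assms(3) asc_split[OF assms(1) x(1)] by simp
qed

text \<open>The letter \<open>x\<close> moves right to the place of the expelled \<open>y\<close>,
  and \<open>y\<close> moves on to the right end. If \<open>x\<close> is already in
  \<open>C\<close>, a braid move in between turns \<open>x y x\<close> into \<open>y x y\<close>
  with \<open>y = x - 1\<close>.\<close>

lemma np_column:
  assumes "good x C"
  shows "np (x # asc C) (asc (bump x C) @ letter (out x C))"
proof (cases "out x C = 0")
  case True
  have "finite C" using assms by (simp add: good_def)
  then have "asc (bump x C) = x # asc C" using True bump_append[OF assms True] out_0_iff[OF assms]
    by (metis asc_insert_less)
  then show ?thesis using True by (simp add: letter_def)
next
  case n: False
  have f: "finite C" using assms by (simp add: good_def)
  define y where "y = out x C"
  have y: "y \<in> C" "y < x" "0 < y" using n out_in[OF assms] out_less[OF assms] by (auto simp: y_def)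
  let ?us = "asc {c \<in> C. c < y}"
  show ?thesis
  proof (cases "x \<in> C")
    case False
    let ?vs = "asc {c \<in> C. y < c}"
    have gap: "c \<in> C \<Longrightarrow> y < c \<Longrightarrow> x < c" for c
      using out_gap[OF assms, of c] False by (metis y_def not_less nat_neq_iff)
    have s: "sorted_wrt (<) (?us @ [y])" "sorted_wrt (<) (x # ?vs)"
      using f gap by (auto simp: sorted_wrt_append)
    have "np (x # ?us @ y # ?vs) (?us @ x # y # ?vs)"
      using s y by (intro np_push_left)
    also have "np \<dots> (?us @ x # ?vs @ [y])"
      using s y by (intro np_append2 np_push_right)
    also have "asc (bump x C) = ?us @ x # ?vs"
      using f False y gap by (intro asc_unique)
        (auto simp: bump_def y_def[symmetric] sorted_wrt_append dest: less_trans)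
    then have "?us @ x # ?vs @ [y] = asc (bump x C) @ letter (out x C)"
      using y by (simp add: letter_def y_def[symmetric])
    finally show ?thesis using asc_split[OF f y(1)] by simp
  next
    case True
    have yx: "x = Suc y" using out_mem[OF assms True] y by (auto simp: y_def)
    let ?vs = "asc {c \<in> C. x < c}"
    have a: "asc C = ?us @ y # x # ?vs"
      using f True y yx by (intro asc_unique) (auto simp: sorted_wrt_append)
    have s: "sorted_wrt (<) (?us @ [y])" "sorted_wrt (<) (x # ?vs)"
      using f by (auto simp: sorted_wrt_append)
    have "np (x # ?us @ y # x # ?vs) (?us @ x # y # x # ?vs)"
      using s y by (intro np_push_left)
    also have "np \<dots> (?us @ y # x # y # ?vs)"
      unfolding yx by (intro np_append2 np_sym[OF np_braid])
    also have "np \<dots> (?us @ y # x # ?vs @ [y])"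
      using s y by (intro np_append2 np_Cons np_push_right)
    finally show ?thesis using a True y by (simp add: bump_def letter_def y_def[symmetric])
  qed
qed

subsection \<open>Inserting a letter into a tableau\<close>

text \<open>The carried letter 0 signals that the insertion has stopped in an earlier
  column.\<close>

fun ins :: "nat \<Rightarrow> nat set list \<Rightarrow> nat set list" where
  "ins x [] = (if x = 0 then [] else [{x}])"
| "ins x (C # T) = (if x = 0 then C # T else bump x C # ins (out x C) T)"

fun new_col :: "nat \<Rightarrow> nat set list \<Rightarrow> nat" where
  "new_col x [] = 0"
| "new_col x (C # T) = (if out x C = 0 then 0 else Suc (new_col (out x C) T))"

definition insertable :: "nat \<Rightarrow> nat set list \<Rightarrow> bool" where
  "insertable x T \<longleftrightarrow> Tab T \<and> reduced (x # word_of T)"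

lemma ins_0 [simp]: "ins 0 T = T"
  by (cases T) auto

lemma insertable_pos: "insertable x T \<Longrightarrow> 0 < x"
  by (simp add: insertable_def reduced_iff)

lemma good_empty [simp]: "good x {} \<longleftrightarrow> 0 < x"
  by (simp add: good_def)

lemma out_empty [simp]: "out x {} = 0"
  by (simp add: out_def)

lemma bump_empty [simp]: "bump x {} = {x}"
  by (simp add: bump_def)

lemma fcol_ins: "x \<noteq> 0 \<Longrightarrow> fcol (ins x T) = bump x (fcol T)"
  by (cases T) auto

lemma insertable_good: "insertable x T \<Longrightarrow> good x (fcol T)"
proof (cases T)
  case (Cons C U)
  assume "insertable x T"
  then have "finite C" "0 \<notin> C" "reduced ((x # asc C) @ word_of U)"
    using Cons by (auto simp: insertable_def)
  then show ?thesis using Cons good_if_reduced reduced_append1 by (metis fcol_simps(2))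
qed (use insertable_pos in auto)

lemma insertable_good_Cons: "insertable x (C # T) \<Longrightarrow> good x C"
  using insertable_good[of x "C # T"] by simp

text \<open>By \<open>np_column\<close> the word is equivalent to one in which the output stands
  directly before the remaining columns, and suffixes of reduced words are reduced.\<close>

lemma insertable_next:
  assumes "insertable x (C # T)" "out x C \<noteq> 0"
  shows "insertable (out x C) T"
proof -
  have "np (x # asc C @ word_of T) ((asc (bump x C) @ letter (out x C)) @ word_of T)"
    using np_append1[OF np_column[OF insertable_good_Cons[OF assms(1)]]] by simp
  then have "reduced (asc (bump x C) @ out x C # word_of T)"
    using assms np_reduced by (auto simp: insertable_def letter_def)
  then show ?thesis using assms reduced_append2 by (auto simp: insertable_def)
qed

lemma ins_np: "insertable x T \<Longrightarrow> np (x # word_of T) (word_of (ins x T))"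
proof (induction T arbitrary: x)
  case Nil
  then show ?case using insertable_pos by auto
next
  case (Cons C T)
  have p: "x \<noteq> 0" using insertable_pos[OF Cons.prems] by simp
  have 1: "np (x # word_of (C # T)) (asc (bump x C) @ letter (out x C) @ word_of T)"
    using np_append1[OF np_column[OF insertable_good_Cons[OF Cons.prems]]] by simp
  have "np (letter (out x C) @ word_of T) (word_of (ins (out x C) T))"
    using Cons.IH insertable_next[OF Cons.prems] by (auto simp: letter_def)
  then have "np (asc (bump x C) @ letter (out x C) @ word_of T) (word_of (ins x (C # T)))"
    using p by (auto intro: np_append2)
  with 1 show ?case by (rule np_trans)
qed

lemma reduced_ins: "insertable x T \<Longrightarrow> reduced (word_of (ins x T))"
  using ins_np[of x T] np_reduced insertable_def by blast

text \<open>The condition under which inserting \<open>x\<close> to the right of \<open>C\<close> keeps the rows decreasing.\<close>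

definition valid :: "nat set \<Rightarrow> nat set \<Rightarrow> nat \<Rightarrow> bool" where
  "valid C D x \<longleftrightarrow> x \<in> D \<or> up D x < up C (Suc x)"

text \<open>A count of \<open>D\<close> rises only at thresholds between the output and
  \<open>x\<close>, where it was equal to the count at \<open>x\<close>; so the single strict
  inequality in \<open>valid\<close> suffices.\<close>

lemma dom_bump:
  assumes "finite C" "dom C D" "good x D" "valid C D x"
  shows "dom C (bump x D)"
  unfolding dom_def
proof
  fix t
  have f: "finite D" using assms by (simp add: good_def)
  show "up (bump x D) t \<le> up C (Suc t)"
  proof (cases "x \<notin> D \<and> out x D < t \<and> t \<le> x \<or> t = 0 \<and> out x D = 0")
    case True
    have x: "x \<notin> D" "t \<le> x" using True out_0_iff[OF assms(3)] by auto
    have "up D t = up D x"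
    proof (rule up_eq_gap[OF f x(2)], rule ccontr)
      fix c assume c: "c \<in> D" "t \<le> c" "\<not> x \<le> c"
      then have "c \<le> out x D" using out_gap[OF assms(3)] by simp
      moreover have "0 < c" using c assms(3) by (metis good_def gr0I)
      ultimately show False using True c by auto
    qed
    moreover have "up D x < up C (Suc x)" using assms(4) x by (simp add: valid_def)
    moreover have "up C (Suc x) \<le> up C (Suc t)" using x assms(1) by (intro up_antimono) auto
    ultimately show ?thesis using up_bump[OF assms(3), of t] by simp
  next
    case False
    then show ?thesis using up_bump[OF assms(3), of t] assms(2) by (auto simp: dom_def)
  qed
qed

text \<open>The strict inequality for the next column comes from \<open>x\<close> itself, which lies
  in the new column above its output: either it is newly counted there, or, if it was present, it
  separates the counts at \<open>x\<close> and \<open>Suc x\<close>.\<close>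

lemma valid_next:
  assumes "dom C D" "finite D" "good x C" "out x C \<noteq> 0"
  shows "dom (bump x C) D" "valid (bump x C) D (out x C)"
proof -
  show "dom (bump x C) D" using assms(1) up_bump_ge[OF assms(3)] unfolding dom_def by (meson le_trans)
  have f: "finite C" using assms by (simp add: good_def)
  show "valid (bump x C) D (out x C)"
  proof (cases "x \<in> C")
    case True
    then have x: "x = Suc (out x C)" using out_mem[OF assms(3)] by simp
    have "up D x \<le> up C (Suc x)" using assms(1) by (simp add: dom_def)
    then have "up D x < up C x" using up_Suc[OF f, of x] True by simp
    then show ?thesis using up_Suc[OF assms(2), of "out x C"] x True
      by (auto simp: valid_def bump_def)
  next
    case False
    then show ?thesis using up_bump[OF assms(3), of "Suc (out x C)"] out_less[OF assms(3)] assms(1)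
      by (auto simp: valid_def dom_def intro!: le_imp_less_Suc)
  qed
qed

lemma Tab_finite: "Tab T \<Longrightarrow> finite (fcol T)"
  by (cases T) auto

lemma Tab_ins: "insertable x T \<Longrightarrow> Tab (ins x T)"
proof (induction T arbitrary: x)
  case Nil
  then show ?case using insertable_pos by (auto simp: dom_def)
next
  case (Cons C T)
  have g: "good x C" by (rule insertable_good_Cons[OF Cons.prems])
  have T: "Tab T" "dom C (fcol T)" "finite C" "0 \<notin> C" "0 < x"
    using Cons.prems insertable_pos[OF Cons.prems] by (auto simp: insertable_def)
  have "Tab (ins (out x C) T)"
    using Cons.IH insertable_next[OF Cons.prems] T by (cases "out x C = 0") auto
  moreover have "dom (bump x C) (fcol (ins (out x C) T))"
  proof (cases "out x C = 0")
    case True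
    then show ?thesis using T up_bump_ge[OF g] unfolding dom_def by (auto intro: le_trans)
  next
    case False
    then show ?thesis using T valid_next[OF T(2) Tab_finite[OF T(1)] g False]
        insertable_good[OF insertable_next[OF Cons.prems False]]
      by (auto simp: fcol_ins intro!: dom_bump)
  qed
  ultimately show ?case using T bump_0[of C x] bump_in[of x C] by (auto simp del: bump_in)
qed

section \<open>Growth of the shape under insertion\<close>

definition col :: "'a set list \<Rightarrow> nat \<Rightarrow> 'a set" where
  "col T j = (if j < length T then T ! j else {})"

lemma col_simps [simp]: "col [] j = {}" "col (C # T) 0 = C" "col (C # T) (Suc j) = col T j"
  by (simp_all add: col_def)

lemma fcol_col: "fcol T = col T 0"
  by (cases T) auto

lemma card_ins: "insertable x T \<Longrightarrow> card (col (ins x T) j) = card (col T j) + (if j = new_col x T then 1 else 0)"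
proof (induction T arbitrary: x j)
  case Nil
  then show ?case using insertable_pos by (cases j) auto
next
  case (Cons C T)
  have "0 < x" using Cons.prems by (rule insertable_pos)
  then show ?case
    using Cons.IH[of "out x C"] insertable_next[OF Cons.prems] card_bump[OF insertable_good_Cons[OF Cons.prems]]
    by (cases j; cases "out x C = 0") auto
qed

lemma new_col_le_length: "new_col x T \<le> length T"
  by (induction T arbitrary: x) auto

subsection \<open>The row bumping lemma\<close>

text \<open>The letter \<open>x\<close> now lies in the column below \<open>x'\<close>, so the
  output of \<open>x'\<close> is at least \<open>x\<close>, which exceeds the output of
  \<open>x\<close>.\<close>

lemma bump_less:
  assumes "good x C" "good x' (bump x C)" "x < x'"
  shows "out x C < out x' (bump x C)"
proof (cases "x' \<in> bump x C")
  case True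
  then show ?thesis using out_mem[OF assms(2)] out_less[OF assms(1)] assms(3) by simp
next
  case False
  then show ?thesis using out_gap[OF assms(2), of x] out_less[OF assms(1)] assms(3) by simp
qed

text \<open>Letters of the new column below \<open>x\<close> are at most the output of
  \<open>x\<close>, and strictly smaller if that output was removed. If \<open>x\<close> was
  present, its output is \<open>x - 1\<close>, and the later output is below
  \<open>x' \<le> x - 1\<close>.\<close>

lemma bump_greater:
  assumes "good x C" "good x' (bump x C)" "x' < x" "out x' (bump x C) \<noteq> 0"
  shows "out x' (bump x C) < out x C"
proof -
  have below: "z \<in> bump x C \<Longrightarrow> z < x \<Longrightarrow> z \<le> out x C \<and> (x \<in> C \<or> z \<noteq> out x C)" for z
    using out_gap[OF assms(1), of z] by (auto simp: bump_def split: if_splits)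
  have *: "out x' (bump x C) \<in> bump x C" "out x' (bump x C) < x'"
    using out_in[OF assms(2,4)] out_less[OF assms(2)] by auto
  show ?thesis
  proof (cases "x \<in> C")
    case True
    then show ?thesis using * out_mem[OF assms(1)] assms(3) by linarith
  next
    case False
    then show ?thesis using * below[of "out x' (bump x C)"] assms(3) by simp
  qed
qed

text \<open>By \<open>bump_less\<close> the later letter stays the larger one in every column, so
  its output is nonzero where the earlier letter stops, and it goes on to the right.\<close>

lemma new_col_less:
  "insertable x T \<Longrightarrow> insertable x' (ins x T) \<Longrightarrow> x < x' \<Longrightarrow> new_col x T < new_col x' (ins x T)"
proof (induction T arbitrary: x x')
  case Nil
  have "0 < x" using Nil insertable_pos by auto
  then show ?case using Nil bump_less[of x "{}" x'] insertable_good_Cons[of x' "{x}" "[]"] by simp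
next
  case (Cons C T)
  have p: "0 < x" using Cons insertable_pos by auto
  then have g: "good x C" "good x' (bump x C)"
    using Cons.prems insertable_good_Cons by auto
  note b = bump_less[OF g Cons.prems(3)]
  then have i: "insertable (out x' (bump x C)) (ins (out x C) T)"
    using insertable_next[of x' "bump x C" "ins (out x C) T"] Cons.prems(2) p by simp
  show ?case
  proof (cases "out x C = 0")
    case True
    then show ?thesis using p b by simp
  next
    case False
    then show ?thesis using p b Cons.IH[OF insertable_next[OF Cons.prems(1)] i] by simp
  qed
qed

text \<open>As long as the later letter has a nonzero output, \<open>bump_greater\<close> makes the
  output of the earlier one nonzero too; the earlier insertion cannot stop first.\<close>

lemma new_col_greater:
  "insertable x T \<Longrightarrow> insertable x' (ins x T) \<Longrightarrow> x' < x \<Longrightarrow> new_col x' (ins x T) \<le> new_col x T"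
proof (induction T arbitrary: x x')
  case Nil
  have "0 < x" using Nil insertable_pos by auto
  then show ?case using Nil bump_greater[of x "{}" x'] insertable_good_Cons[of x' "{x}" "[]"] by auto
next
  case (Cons C T)
  have p: "0 < x" using Cons insertable_pos by auto
  then have g: "good x C" "good x' (bump x C)"
    using Cons.prems insertable_good_Cons by auto
  show ?case
  proof (cases "out x' (bump x C) = 0")
    case True
    then show ?thesis using p by simp
  next
    case False
    note b = bump_greater[OF g Cons.prems(3) False]
    then have i: "insertable (out x' (bump x C)) (ins (out x C) T)"
      using insertable_next[OF _ False, of "ins (out x C) T"] Cons.prems(2) p by simp
    show ?thesis using p b Cons.IH[OF insertable_next[OF Cons.prems(1)] i] by auto
  qed
qed

text \<open>The case of equal letters, left open by the two lemmas on row bumping: the word would be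
  equivalent to one beginning with \<open>x x\<close>.\<close>

lemma not_insertable_twice: "insertable x T \<Longrightarrow> \<not> insertable x (ins x T)"
  using ins_np[of x T] np_Cons[of "x # word_of T" "word_of (ins x T)" x] np_reduced not_reduced_twice
  by (auto simp: insertable_def)

subsection \<open>Reverse insertion\<close>

text \<open>The result shows which rule was applied: a nonzero output survives in the new column
  exactly if \<open>x\<close> was already present. In every case this determines \<open>x\<close>
  and then \<open>C\<close>.\<close>

lemma column_inj:
  assumes "good x C" "good x' C'" "bump x C = bump x' C'" "out x C = out x' C'"
  shows "x = x' \<and> C = C'"
proof (cases "out x C = 0")
  case True
  then have n: "bump x C = insert x C" "x \<notin> C" "bump x' C' = insert x' C'" "x' \<notin> C'"
    using bump_append[OF assms(1)] bump_append[OF assms(2)] assms(4) by simp_all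
  have lt: "\<forall>z\<in>C. x < z" "\<forall>z\<in>C'. x' < z" using True assms(4) out_0_iff[OF assms(1)] out_0_iff[OF assms(2)] by simp_all
  have "x = x'"
  proof (rule ccontr)
    assume "x \<noteq> x'"
    moreover have "x \<in> insert x' C'" "x' \<in> insert x C" using n assms(3) by (metis insertI1)+
    ultimately have "x \<in> C'" "x' \<in> C" by auto
    then have "x < x'" "x' < x" using lt by simp_all
    then show False by simp
  qed
  then show ?thesis using n assms(3) by (metis insert_ident)
next
  case False
  define y where "y = out x C"
  have y': "y = out x' C'" using assms(4) by (simp add: y_def)
  have y: "y \<in> C" "y < x" "y \<in> C'" "y < x'"
    using out_in[OF assms(1)] out_less[OF assms(1)] False unfolding y_def[symmetric] apply simp_all
    using out_in[OF assms(2)] out_less[OF assms(2)] False unfolding y'[symmetric] y_def[symmetric] by simp_all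
  have "x \<in> C \<longleftrightarrow> y \<in> bump x C" using y(1,2) unfolding bump_def y_def[symmetric] by auto
  moreover have "x' \<in> C' \<longleftrightarrow> y \<in> bump x' C'" using y(3,4) unfolding bump_def y'[symmetric] by auto
  ultimately have iff: "x \<in> C \<longleftrightarrow> y \<in> bump x C" "x' \<in> C' \<longleftrightarrow> y \<in> bump x C"
    using assms(3) by simp_all
  show ?thesis
  proof (cases "y \<in> bump x C")
    case True
    then have "x = Suc y" "x' = Suc y"
      using iff out_mem[OF assms(1)] out_mem[OF assms(2)] y_def y' by linarith+
    moreover have "x \<in> C" "x' \<in> C'" using True iff by simp_all
    then have "bump x C = C" "bump x' C' = C'" by (simp_all add: bump_def)
    ultimately show ?thesis using assms(3) by simp
  next
    case F: False
    then have m: "x \<notin> C" "x' \<notin> C'" using iff by simp_all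
    then have "bump x C = insert x (C - {y})" "bump x' C' = insert x' (C' - {y})"
      unfolding bump_def y_def[symmetric] y'[symmetric] by simp_all
    then have n: "bump x C = insert x (C - {y})" "bump x C = insert x' (C' - {y})"
      using assms(3) by simp_all
    have gap: "\<And>z. z \<in> C \<Longrightarrow> z < x \<Longrightarrow> z \<le> y" "\<And>z. z \<in> C' \<Longrightarrow> z < x' \<Longrightarrow> z \<le> y"
      using out_gap[OF assms(1)] out_gap[OF assms(2)] y_def y' by simp_all
    have "x = x'"
    proof (rule ccontr)
      assume "x \<noteq> x'"
      moreover have "x \<in> insert x' (C' - {y})" "x' \<in> insert x (C - {y})" using n by (metis insertI1)+
      ultimately have "x \<in> C'" "x' \<in> C" by auto
      then show False using gap[of x] gap(1)[of x'] y \<open>x \<noteq> x'\<close> by linarith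
    qed
    moreover have "C - {y} = C' - {y}" using n m calculation by (metis DiffD1 insert_ident)
    then have "C = C'" using y by (metis insert_Diff)
    ultimately show ?thesis by simp
  qed
qed

text \<open>The position of the new box says in which column the output becomes 0; the columns
  before it are undone by \<open>column_inj\<close>.\<close>

lemma ins_inj:
  "insertable x T \<Longrightarrow> insertable x' T' \<Longrightarrow> ins x T = ins x' T' \<Longrightarrow> new_col x T = new_col x' T' \<Longrightarrow> x = x' \<and> T = T'"
proof (induction T arbitrary: x x' T')
  case Nil
  have p: "0 < x" "0 < x'" using Nil insertable_pos by auto
  show ?case
  proof (cases T')
    case Nil
    then show ?thesis using Nil.prems p by simp
  next
    case (Cons C' U)
    have "out x' C' = 0" "bump x' C' = {x}" using Nil Cons p by (auto split: if_splits)
    then have "insert x' C' = {x}" "x' \<notin> C'" using bump_append insertable_good_Cons Nil Cons by metis+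
    moreover have "C' \<noteq> {}" using Nil Cons by (simp add: insertable_def)
    ultimately show ?thesis by auto
  qed
next
  case (Cons C T)
  have p: "0 < x" "0 < x'" using Cons insertable_pos by auto
  have g: "good x C" using Cons.prems insertable_good_Cons by auto
  show ?case
  proof (cases T')
    case Nil
    then have "out x C = 0" "bump x C = {x'}" using Nil Cons p by (auto split: if_splits)
    then have "insert x C = {x'}" "x \<notin> C" using bump_append g by metis+
    moreover have "C \<noteq> {}" using Cons by (simp add: insertable_def)
    ultimately show ?thesis by auto
  next
    case T': (Cons C' T'')
    have g': "good x' C'" using Cons.prems insertable_good_Cons T' by auto
    have e: "bump x C = bump x' C'" "ins (out x C) T = ins (out x' C') T''"
      using Cons.prems T' p by auto
    have "out x C = out x' C' \<and> T = T''"
    proof (cases "out x C = 0")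
      case True
      then have "out x' C' = 0" using Cons.prems T' p by (auto split: if_splits)
      then show ?thesis using True e by simp
    next
      case False
      have k: "new_col x' (C' # T'') = Suc (new_col (out x C) T)" using Cons.prems(4) T' False by simp
      then have n: "out x' C' \<noteq> 0" by (metis new_col.simps(2) nat.distinct(1))
      then have "new_col (out x C) T = new_col (out x' C') T''" using k by simp
      moreover have "insertable (out x' C') T''" using Cons.prems(2) T' n by (intro insertable_next) simp_all
      ultimately show ?thesis using Cons.IH[OF insertable_next[OF Cons.prems(1) False]] e(2) by blast
    qed
    then show ?thesis using column_inj[OF g g' e(1)] T' by simp
  qed
qed

lemma up_le_card: "finite C \<Longrightarrow> up C t \<le> card C"
  using up_antimono[of C 0 t] by (simp add: up_0)

text \<open>Reverse insertion from a corner: the columns right of \<open>C\<close> are treated by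
  the induction hypothesis, which returns a letter \<open>y\<close> that must be pushed back through
  \<open>C\<close>.\<close>

lemma ins_surj:
  assumes "Tab T" "reduced (word_of T)" "k < length T" "card (col T (Suc k)) < card (col T k)"
  shows "\<exists>x T'. insertable x T' \<and> ins x T' = T \<and> new_col x T' = k"
  using assms
proof (induction T arbitrary: k)
  case (Cons C U)
  have C: "finite C" "C \<noteq> {}" "0 \<notin> C" "dom C (fcol U)" "Tab U" using Cons.prems by auto
  show ?case
  proof (cases k)
    case 0
    \<comment> \<open>The bottom entry of the corner column, which an insertion stopping here must
      have appended.\<close>
    define x where "x = Min C"
    have x: "x \<in> C" "\<And>c. c \<in> C \<Longrightarrow> x \<le> c" using C by (auto simp: x_def)
    have x0: "0 < x" using x C by (metis gr0I)
    define C' where "C' = C - {x}"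
    have g: "good x C'" using C x0 by (auto simp: good_def C'_def)
    have lt: "\<forall>z\<in>C'. x < z" using x by (auto simp: C'_def le_less)
    then have o: "out x C' = 0" using out_0_iff[OF g] by simp
    have n: "bump x C' = C" using bump_append[OF g o] x by (auto simp: C'_def)
    have c: "card (fcol U) \<le> card C'" using Cons.prems(4) 0 x C by (simp add: C'_def fcol_col)
    show ?thesis
    proof (cases "C' = {}")
      case True
      then have "fcol U = {}" using c Tab_finite[OF C(5)] by simp
      then have "U = []" using C(5) by (cases U) auto
      moreover have "C = {x}" using True x by (auto simp: C'_def)
      moreover have "insertable x []" using Cons.prems(2) \<open>C = {x}\<close> \<open>U = []\<close> by (simp add: insertable_def)
      ultimately show ?thesis using 0 x0 by (intro exI[of _ x] exI[of _ "[]"]) auto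
    next
      case False
      have "dom C' (fcol U)" unfolding dom_def
      proof
        fix t
        show "up (fcol U) t \<le> up C' (Suc t)"
        proof (cases "Suc t \<le> x")
          case True
          have "up C' (Suc t) = card C'" unfolding up_def using True lt by (intro arg_cong[where f = card]) auto
          then show ?thesis using c up_le_card[OF Tab_finite[OF C(5)], of t] by simp
        next
          case False
          then show ?thesis using up_remove[of C x "Suc t"] C x by (auto simp: C'_def dom_def dest: spec[of _ t])
        qed
      qed
      then have "Tab (C' # U)" using False C by (auto simp: C'_def)
      moreover have "reduced (x # word_of (C' # U))"
        using Cons.prems(2) asc_insert_less[of C' x] lt g bump_append[OF g o] n by (auto simp: good_def)
      ultimately show ?thesis using 0 x0 o n
        by (intro exI[of _ x] exI[of _ "C' # U"]) (auto simp: insertable_def)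
    qed
  next
    case (Suc k')
    obtain y U' where y: "insertable y U'" "ins y U' = U" "new_col y U' = k'"
      using Cons.IH[of k'] Cons.prems Suc reduced_append2 by fastforce
    have y0: "0 < y" using y insertable_pos by auto
    define D where "D = fcol U'"
    have gD: "good y D" using y insertable_good by (simp add: D_def)
    have fU: "fcol U = bump y D" using fcol_ins[of y U'] y y0 by (simp add: D_def)
    have upD: "up D t \<le> up C (Suc t)" for t
      using up_bump_ge[OF gD, of t] C(4) fU unfolding dom_def by (metis le_trans)
    have r: "reduced (asc C @ y # word_of U')"
      using np_append2[OF ins_np[OF y(1)], of "asc C"] y(2) Cons.prems(2) np_reduced by auto
    have main: "\<exists>x C'. good x C' \<and> out x C' = y \<and> bump x C' = C \<and> C' \<noteq> {} \<and> dom C' D"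
    proof (cases "y \<in> C")
      case True
      \<comment> \<open>The word contains \<open>y\<close>, then the letters of \<open>C\<close>
        above \<open>y\<close>, then \<open>y\<close> again. Without \<open>Suc y\<close> among them
        the two copies would cancel.\<close>
      have "Suc y \<in> C"
      proof (rule ccontr)
        assume n: "Suc y \<notin> C"
        have "reduced (asc {c \<in> C. c < y} @ (y # asc {c \<in> C. y < c} @ y # word_of U'))"
          using r asc_split[OF C(1) True] by simp
        then have "reduced (y # asc {c \<in> C. y < c} @ y # word_of U')" by (rule reduced_append2)
        moreover have "\<forall>u\<in>set (asc {c \<in> C. y < c}). Suc u < y \<or> Suc y < u"
          using C(1) n by (auto intro: Suc_lessI)
        ultimately show False using not_reduced_repeat by blast
      qed
      then have "good (Suc y) C" "out (Suc y) C = y" "bump (Suc y) C = C"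
        using True C by (auto simp: good_def out_def bump_def)
      moreover have "dom C D" using upD by (simp add: dom_def)
      ultimately show ?thesis using C by blast
    next
      case False
      have "0 < up (fcol U) y" using up_pos_iff[of "fcol U" y] fU gD by (auto simp: good_def)
      then have "0 < up C (Suc y)" using C(4) unfolding dom_def by (meson less_le_trans)
      then have ne: "{c \<in> C. y < c} \<noteq> {}" using C up_pos_iff by (auto simp: Suc_le_eq)
      \<comment> \<open>The only letter whose insertion can have replaced \<open>y\<close>; it
        exists because a letter of \<open>D\<close> after insertion of \<open>y\<close> is dominated
        by a larger one in \<open>C\<close>.\<close>
      define x where "x = Min {c \<in> C. y < c}"
      have x: "x \<in> C" "y < x" using Min_in[OF _ ne] C by (auto simp: x_def)
      have gap: "\<And>c. c \<in> C \<Longrightarrow> y < c \<Longrightarrow> x \<le> c" using C by (auto simp: x_def)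
      define C' where "C' = insert y (C - {x})"
      have g: "good x C'" using C x y0 by (auto simp: good_def C'_def)
      have o: "out x C' = y" using gap x by (intro out_eqI[OF g]) (auto simp: C'_def not_less[symmetric])
      have n: "bump x C' = C" using x False by (auto simp: bump_def o) (auto simp: C'_def)
      have "dom C' D" unfolding dom_def
      proof
        fix t
        note u = up_bump[OF g, of "Suc t", unfolded n o]
        show "up D t \<le> up C' (Suc t)"
        proof (cases "y \<le> t \<and> t < x")
          case T: True
          have "up C (Suc t) = up C (Suc y)"
            using gap C T by (intro up_eq_gap[symmetric]) fastforce+
          moreover have "up D t \<le> up D y" using T gD by (intro up_antimono) (auto simp: good_def)
          \<comment> \<open>Exchanging \<open>x\<close> for \<open>y\<close> costs one letter at
            thresholds above \<open>y\<close>, so strictness is required. If \<open>y\<close> lies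
            in \<open>D\<close>, so does \<open>y - 1\<close>, and the inequality at threshold
            \<open>y - 1\<close> has the slack, as \<open>y\<close> is not in
            \<open>C\<close>.\<close>
          moreover have "up D y < up C (Suc y)"
          proof (cases "y \<in> D")
            case True
            then have "up D (y - 1) = up D y + 1"
              using up_Suc[of D "y - 1"] gD by (auto simp: good_def)
            moreover have "up D (y - 1) \<le> up C y" using upD[of "y - 1"] y0 by simp
            moreover have "up C y = up C (Suc y)" using up_Suc[OF C(1), of y] \<open>y \<notin> C\<close> by simp
            ultimately show ?thesis by simp
          next
            case False
            then have "up (bump y D) y = up D y + 1" using up_bump[OF gD, of y] out_less[OF gD] by simp
            then show ?thesis using C(4) fU unfolding dom_def by (metis Suc_eq_plus1 Suc_le_eq)
          qed
          ultimately show ?thesis using u T by (auto simp: C'_def split: if_splits)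
        next
          case False
          then show ?thesis using upD[of t] u by auto
        qed
      qed
      then show ?thesis using g o n by (auto simp: C'_def)
    qed
    then obtain x C' where x: "good x C'" "out x C' = y" "bump x C' = C" "C' \<noteq> {}" "dom C' D" by blast
    have x0: "0 < x" using x by (simp add: good_def)
    have "np (x # asc C' @ word_of U') (asc C @ y # word_of U')"
      using np_append1[OF np_column[OF x(1)], of "word_of U'"] x y0 by (simp add: letter_def)
    then have "reduced (x # word_of (C' # U'))" using r np_reduced by auto
    then have "insertable x (C' # U')" using x y by (auto simp: insertable_def good_def D_def)
    moreover have "ins x (C' # U') = C # U" "new_col x (C' # U') = k" using x0 y0 by (simp_all add: x(2,3) y(2,3) Suc)
    ultimately show ?thesis by blast
  qed
qed simp

subsection \<open>Insertion respects nilplactic equivalence\<close>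

text \<open>Triples are required to be positive, so that the zeros produced by \<open>out\<close> only occur in triples that
  agree after deleting zeros.\<close>

definition move3 :: "nat list \<Rightarrow> nat list \<Rightarrow> bool" where
  "move3 w w' \<longleftrightarrow> 0 \<notin> set w \<and>
    ((\<exists>a b c. a < b \<and> b < c \<and> w = [b, a, c] \<and> w' = [b, c, a]) \<or>
     (\<exists>a b c. a < b \<and> b < c \<and> w = [a, c, b] \<and> w' = [c, a, b]) \<or>
     (\<exists>k. w = [k, Suc k, k] \<and> w' = [Suc k, k, Suc k]))"

abbreviation nz :: "nat list \<Rightarrow> nat list" where
  "nz w \<equiv> filter (\<lambda>x. x \<noteq> 0) w"

definition rel3 :: "nat list \<Rightarrow> nat list \<Rightarrow> bool" where
  "rel3 w w' \<longleftrightarrow> nz w = nz w' \<or> move3 w w' \<or> move3 w' w"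

lemma rel3_bac: "a < b \<Longrightarrow> b < c \<Longrightarrow> rel3 [b, a, c] [b, c, a]"
  by (cases "a = 0") (auto simp: rel3_def move3_def)

lemma rel3_acb: "a < b \<or> a = 0 \<Longrightarrow> b < c \<Longrightarrow> rel3 [a, c, b] [c, a, b]"
  by (cases "a = 0") (auto simp: rel3_def move3_def)

lemma rel3_braid: "0 < k \<Longrightarrow> rel3 [k, Suc k, k] [Suc k, k, Suc k]"
  by (auto simp: rel3_def move3_def)

lemma rel3_sym: "rel3 w w' \<Longrightarrow> rel3 w' w"
  by (auto simp: rel3_def)

lemma bump_notin: "x \<notin> C \<Longrightarrow> out x C = y \<Longrightarrow> bump x C = insert x (C - {y})"
  by (simp add: bump_def)

lemma bump_mem: "x \<in> C \<Longrightarrow> bump x C = C"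
  by (simp add: bump_def)

lemma out_mem': "x \<in> C \<Longrightarrow> out x C = x - 1"
  by (simp add: out_def)

lemma out_in_0: "good x C \<Longrightarrow> out x C \<in> insert 0 C"
  using out_in by blast

text \<open>With outputs \<open>p\<close> and \<open>q\<close> one has \<open>p < a < q < c\<close>,
  so the two insertions touch disjoint ranges of letters.\<close>

lemma column_commute:
  assumes g: "good a C" "good c C" "good a (bump c C)" "good c (bump a C)"
    and lt: "a < c" "a < out c C"
  shows "out a (bump c C) = out a C" "out c (bump a C) = out c C" "bump a (bump c C) = bump c (bump a C)"
proof -
  define p q where pq: "p = out a C" "q = out c C"
  have p: "p \<in> insert 0 C" "p < a" "\<And>z. z \<in> C \<Longrightarrow> z < a \<Longrightarrow> z \<le> p"
    using out_in_0[OF g(1)] out_less[OF g(1)] out_gap[OF g(1)] by (auto simp: pq)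
  have q: "q \<in> C" "q < c" "a < q" "\<And>z. z \<in> C \<Longrightarrow> z < c \<Longrightarrow> z \<le> q"
    using out_in[OF g(2)] out_less[OF g(2)] out_gap[OF g(2)] lt by (auto simp: pq)
  have na: "bump a C = (if a \<in> C then C else insert a (C - {p}))" by (simp add: bump_def pq)
  have bump': "bump c C = (if c \<in> C then C else insert c (C - {q}))" by (simp add: bump_def pq)
  have 1: "out a (bump c C) = p"
  proof (cases "a \<in> C")
    case True
    then have "a \<in> bump c C" using q by (auto simp: bump')
    then show ?thesis using True by (simp add: out_mem' pq)
  next
    case False
    then show ?thesis using p q lt by (intro out_eqI[OF g(3)]) (auto simp: bump' split: if_splits)
  qed
  have 2: "out c (bump a C) = q"
  proof (cases "c \<in> C")
    case True
    then have "c \<in> bump a C" using p lt by (auto simp: na)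
    then show ?thesis using True by (simp add: out_mem' pq)
  next
    case False
    then show ?thesis using p q lt by (intro out_eqI[OF g(4)]) (auto simp: na split: if_splits)
  qed
  show "out a (bump c C) = out a C" "out c (bump a C) = out c C" using 1 2 by (simp_all add: pq)
  show "bump a (bump c C) = bump c (bump a C)"
  proof -
    have "bump a (bump c C) = (if a \<in> bump c C then bump c C else insert a (bump c C - {p}))"
      using 1 by (simp add: bump_def[of a "bump c C"])
    moreover have "bump c (bump a C) = (if c \<in> bump a C then bump a C else insert c (bump a C - {q}))"
      using 2 by (simp add: bump_def[of c "bump a C"])
    ultimately show ?thesis unfolding na bump' using p(2) q(2,3) lt by auto
  qed
qed

text \<open>The position of \<open>a\<close> relative to the output \<open>q\<close> of
  \<open>c\<close> decides how the outputs are related. If \<open>a < q\<close>, the insertions of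
  \<open>a\<close> and \<open>c\<close> commute and the outputs satisfy the same kind of move; if
  \<open>a = q\<close>, they satisfy a braid move on \<open>a - 1\<close> and \<open>a\<close>; if
  \<open>q < a\<close>, they satisfy a move of the other kind.\<close>

lemma column_bac:
  assumes lt: "a < b" "b < c"
    and g: "good c C" "good a (bump c C)" "good b (bump a (bump c C))"
    and h: "good a C" "good c (bump a C)" "good b (bump c (bump a C))"
  shows "bump b (bump a (bump c C)) = bump b (bump c (bump a C)) \<and>
    rel3 [out b (bump a (bump c C)), out a (bump c C), out c C] [out b (bump c (bump a C)), out c (bump a C), out a C]"
proof -
  define q where "q = out c C"
  have q: "q \<in> insert 0 C" "q < c" "\<And>z. z \<in> C \<Longrightarrow> z < c \<Longrightarrow> z \<le> q"
    using out_in_0[OF g(1)] out_less[OF g(1)] out_gap[OF g(1)] by (auto simp: q_def)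
  have a0: "0 < a" using h(1) by (simp add: good_def)
  consider "a < q" | "a = q" | "q < a" by linarith
  then show ?thesis
  proof cases
    case 1
    note cm = column_commute[OF h(1) g(1) g(2) h(2) _ 1[unfolded q_def]]
    have ac: "a < c" using lt by simp
    define D where "D = bump a (bump c C)"
    define o' where "o' = out b D"
    have gD: "good b D" using g(3) by (simp add: D_def)
    have "a \<in> D" by (simp add: D_def)
    then have ao: "a \<le> o'" using out_gap[OF gD] lt by (simp add: o'_def)
    then have oD: "o' \<in> D" using out_in[OF gD] a0 by (simp add: o'_def)
    have ob: "o' < b" using out_less[OF gD] by (simp add: o'_def)
    have "o' < q"
    proof (cases "c \<in> C")
      case True
      then show ?thesis using ob lt by (simp add: q_def out_mem')
    next
      case False
      have "bump c C = insert c (C - {q})" using False by (simp add: bump_def q_def)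
      then have "q \<notin> bump c C" using q by auto
      then have "q \<notin> D" using 1 by (auto simp: D_def bump_def)
      moreover have "o' = a \<or> o' \<in> C"
        using oD ob lt by (auto simp: D_def bump_def split: if_splits)
      ultimately show ?thesis using q(3)[of o'] ob lt 1 oD by (metis less_trans le_neq_implies_less)
    qed
    moreover have "out a C < o'" using out_less[OF h(1)] ao by simp
    ultimately have "rel3 [o', out a C, q] [o', q, out a C]" by (intro rel3_bac)
    then show ?thesis using cm[OF ac] by (simp add: o'_def D_def q_def)
  next
    case 2
    have q3: "\<And>z. z \<in> C \<Longrightarrow> z < c \<Longrightarrow> z \<le> a" using q(3) 2 by simp
    have aC: "a \<in> C" using 2 q(1) a0 by simp
    have a1: "a - 1 \<in> C" "0 < a - 1" using h(1) aC out_mem[OF h(1) aC] by (auto simp: good_def)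
    have cC: "c \<notin> C" using 2 lt out_mem'[of c C] by (auto simp: q_def)
    have bC: "b \<notin> C" using q(3)[of b] 2 lt by auto
    have n1: "bump c C = insert c (C - {a})" using cC 2 by (simp add: bump_def q_def)
    have o2: "out a (bump c C) = a - 1" unfolding n1
      using a1 g(2) lt by (intro out_eqI) (auto simp: n1)
    have n2: "bump a (bump c C) = insert a (insert c (C - {a}) - {a - 1})"
      using o2 lt by (subst bump_notin[OF _ o2]) (auto simp: n1)
    have o3: "out b (bump a (bump c C)) = a"
      using g(3) lt q3 bC by (intro out_eqI) (auto simp: n2)
    have n3: "bump b (bump a (bump c C)) = insert b (bump a (bump c C) - {a})"
      using lt bC by (intro bump_notin[OF _ o3]) (auto simp: n2)
    have m1: "bump a C = C" "out a C = a - 1" using aC by (simp_all add: bump_mem out_mem')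
    have m2: "out c (bump a C) = a" "bump c (bump a C) = insert c (C - {a})" using m1 n1 2 by (simp_all add: q_def)
    have o3': "out b (bump c (bump a C)) = a - 1"
    proof (rule out_eqI[OF h(3)])
      fix z assume z: "z \<in> bump c (bump a C)" "z < b"
      then have "z \<le> a" "z \<noteq> a" using q3[of z] lt by (auto simp: m2)
      then show "z \<le> a - 1" by simp
    qed (use a1 lt bC in \<open>auto simp: m2\<close>)
    have n3': "bump b (bump c (bump a C)) = insert b (insert c (C - {a}) - {a - 1})"
      using lt bC by (subst bump_notin[OF _ o3']) (auto simp: m2)
    have "bump b (bump a (bump c C)) = bump b (bump c (bump a C))"
      unfolding n3 n3' unfolding n2 using a1 lt by auto
    moreover have "rel3 [a, a - 1, a] [a - 1, a, a - 1]"
      using rel3_sym[OF rel3_braid[OF a1(2)]] a1 by simp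
    ultimately show ?thesis using o2 o3 m1 m2 o3' 2 by (simp add: q_def[symmetric])
  next
    case 3
    have aC: "a \<notin> C" using 3 q(3)[of a] lt by auto
    have bC: "b \<notin> C" using q(3)[of b] 3 lt by auto
    have cC: "c \<notin> C" using 3 lt out_mem'[of c C] by (auto simp: q_def)
    have oa: "out a C = q" using q 3 lt aC by (intro out_eqI[OF h(1)]) auto
    have n1: "bump c C = insert c (C - {q})" using cC by (simp add: bump_def q_def)
    define p where "p = out a (bump c C)"
    have p: "p \<in> insert 0 (bump c C)" "p < a" "\<And>z. z \<in> bump c C \<Longrightarrow> z < a \<Longrightarrow> z \<le> p"
      using out_in_0[OF g(2)] out_less[OF g(2)] out_gap[OF g(2)] by (auto simp: p_def)
    have pq: "p < q \<or> p = 0" using p(1,2) q(3)[of p] lt by (auto simp: n1)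
    have n2: "bump a (bump c C) = insert a (insert c (C - {q}) - {p})"
      using lt aC by (subst bump_notin[OF _ p_def[symmetric]]) (auto simp: n1)
    have o3: "out b (bump a (bump c C)) = a"
      using g(3) lt q(3) 3 bC by (intro out_eqI) (auto simp: n2 dest!: q(3))
    have n3: "bump b (bump a (bump c C)) = insert b (bump a (bump c C) - {a})"
      using lt bC by (intro bump_notin[OF _ o3]) (auto simp: n2)
    have m1: "bump a C = insert a (C - {q})" using aC oa by (simp add: bump_def)
    have o2': "out c (bump a C) = a"
      using h(2) lt q(3) 3 cC by (intro out_eqI) (auto simp: m1 dest!: q(3))
    have m2: "bump c (bump a C) = insert c (C - {q})"
      using lt cC aC by (subst bump_notin[OF _ o2']) (auto simp: m1)
    have o3': "out b (bump c (bump a C)) = p"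
    proof (rule out_eqI[OF h(3)])
      fix z assume z: "z \<in> bump c (bump a C)" "z < b"
      then have "z < a" using q(3)[of z] 3 lt by (auto simp: m2)
      then show "z \<le> p" using p(3)[of z] z by (simp add: m2 n1)
    qed (use p lt bC in \<open>auto simp: m2 n1\<close>)
    have n3': "bump b (bump c (bump a C)) = insert b (insert c (C - {q}) - {p})"
      using lt bC by (subst bump_notin[OF _ o3']) (auto simp: m2)
    have "bump b (bump a (bump c C)) = bump b (bump c (bump a C))"
      unfolding n3 n3' unfolding n2 using aC lt by auto
    moreover have "rel3 [a, p, q] [p, a, q]"
      using rel3_sym[OF rel3_acb[OF pq 3]] .
    ultimately show ?thesis using o3 o3' o2' oa by (simp add: p_def[symmetric] q_def[symmetric])
  qed
qed

text \<open>On both sides \<open>b\<close> enters first. It then separates \<open>a\<close> from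
  \<open>c\<close>: the output of \<open>c\<close> is at least \<open>b\<close>, so
  \<open>column_commute\<close> applies.\<close>

lemma column_acb:
  assumes lt: "a < b" "b < c"
    and g: "good b C" "good c (bump b C)" "good a (bump c (bump b C))"
    and h: "good a (bump b C)" "good c (bump a (bump b C))"
  shows "bump a (bump c (bump b C)) = bump c (bump a (bump b C)) \<and>
    rel3 [out a (bump c (bump b C)), out c (bump b C), out b C] [out c (bump a (bump b C)), out a (bump b C), out b C]"
proof -
  define B where "B = bump b C"
  define o' p q where opq: "o' = out b C" "p = out a B" "q = out c B"
  have bB: "b \<in> B" by (simp add: B_def)
  then have q: "b \<le> q" using out_gap[of c B b] g(2) lt by (simp add: B_def opq)
  have ob: "o' < b" using out_less[OF g(1)] by (simp add: opq)
  have gB: "good a B" "good c B" using g h by (simp_all add: B_def)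
  have cm: "out a (bump c B) = p" "out c (bump a B) = q" "bump a (bump c B) = bump c (bump a B)"
    using column_commute[of a B c] gB g(3) h(2) q lt by (simp_all add: B_def opq)
  have "p < o' \<or> p = 0"
  proof (cases "p = 0")
    case False
    have p: "p \<in> B" "p < a" using out_in[OF gB(1)] out_less[OF gB(1)] False by (simp_all add: opq)
    show ?thesis
    proof (cases "b \<in> C")
      case True
      then have "o' = b - 1" by (simp add: opq out_mem')
      then show ?thesis using p lt by linarith
    next
      case b: False
      then have "B = insert b (C - {o'})" by (simp add: B_def opq bump_def)
      then show ?thesis using p lt out_gap[OF g(1), of p] by (auto simp: opq)
    qed
  qed simp
  then have "rel3 [p, q, o'] [q, p, o']" using ob q by (intro rel3_acb) auto
  then show ?thesis using cm by (simp add: B_def[symmetric] opq[symmetric])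
qed

text \<open>If \<open>k\<close> lies in \<open>C\<close>, so does \<open>k - 1\<close>, and the
  outputs form a braid on \<open>k - 1\<close> and \<open>k\<close>. Otherwise \<open>Suc k\<close>
  is missing as well, and the outputs are related by a move of the form \<open>a c b\<close> to
  \<open>c a b\<close>.\<close>

lemma column_braid:
  assumes g: "good k C" "good (Suc k) (bump k C)" "good k (bump (Suc k) (bump k C))"
    and h: "good (Suc k) C" "good k (bump (Suc k) C)"
  shows "bump k (bump (Suc k) (bump k C)) = bump (Suc k) (bump k (bump (Suc k) C)) \<and>
    rel3 [out k (bump (Suc k) (bump k C)), out (Suc k) (bump k C), out k C]
      [out (Suc k) (bump k (bump (Suc k) C)), out k (bump (Suc k) C), out (Suc k) C]"
proof (cases "k \<in> C")
  case True
  have k: "k - 1 \<in> C" "0 < k - 1" using g(1) out_mem[OF g(1) True] True by (auto simp: good_def)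
  have r: "rel3 [k - 1, k, k - 1] [k, k - 1, k]" using rel3_braid[OF k(2)] k by simp
  have m: "bump k C = C" "out k C = k - 1" using True by (simp_all add: bump_mem out_mem')
  show ?thesis
  proof (cases "Suc k \<in> C")
    case True
    then show ?thesis using m r by (simp add: bump_mem out_mem')
  next
    case False
    have o1: "out (Suc k) C = k" using True False by (intro out_eqI[OF h(1)]) auto
    define Y where "Y = insert (Suc k) (C - {k})"
    have n1: "bump (Suc k) C = Y" using False o1 by (simp add: bump_def Y_def)
    have o2: "out k Y = k - 1" using k h(2)[unfolded n1] by (intro out_eqI) (auto simp: Y_def)
    have n2: "bump k Y = insert k (Y - {k - 1})" by (intro bump_notin[OF _ o2]) (auto simp: Y_def)
    have "Suc k \<in> bump k Y" using k by (auto simp: n2) (auto simp: Y_def)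
    then have "bump (Suc k) (bump k Y) = bump k Y" "out (Suc k) (bump k Y) = k" by (simp_all add: bump_mem out_mem')
    then show ?thesis using m n1 o1 o2 r by simp
  qed
next
  case F: False
  then have F': "Suc k \<notin> C" using h(1) by (auto simp: good_def)
  define p where "p = out k C"
  have p: "p \<in> insert 0 C" "p < k" "\<And>z. z \<in> C \<Longrightarrow> z < k \<Longrightarrow> z \<le> p"
    using out_in_0[OF g(1)] out_less[OF g(1)] out_gap[OF g(1)] by (auto simp: p_def)
  define Y where "Y = insert (Suc k) (C - {p})"
  have n1: "bump k C = insert k (C - {p})" using F by (simp add: bump_def p_def)
  have o2: "out (Suc k) (bump k C) = k" using g(2) F' by (intro out_eqI) (auto simp: n1)
  have n2: "bump (Suc k) (bump k C) = Y" using F F' by (subst bump_notin[OF _ o2]) (auto simp: n1 Y_def)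
  have o1': "out (Suc k) C = p" using p F F' by (intro out_eqI[OF h(1)]) (auto simp: less_Suc_eq)
  have n1': "bump (Suc k) C = Y" using F' o1' by (simp add: bump_def Y_def)
  define p' where "p' = out k Y"
  have gY: "good k Y" using h(2) by (simp add: n1')
  have p': "p' \<in> insert 0 Y" "p' < k"
    using out_in_0[OF gY] out_less[OF gY] by (auto simp: p'_def)
  have pp: "p' < p \<or> p' = 0" using p'(1,2) p(3)[of p'] by (auto simp: Y_def)
  have n3: "bump k Y = insert k (Y - {p'})" using F by (intro bump_notin) (auto simp: Y_def p'_def)
  have "Suc k \<in> bump k Y" using p' by (auto simp: n3) (auto simp: Y_def)
  then have "bump (Suc k) (bump k Y) = bump k Y" "out (Suc k) (bump k Y) = k" by (simp_all add: bump_mem out_mem')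
  moreover have "rel3 [p', k, p] [k, p', p]" by (rule rel3_acb[OF pp p(2)])
  ultimately show ?thesis using o2 o1' by (simp add: n2 n1' p_def[symmetric] p'_def[symmetric])
qed

text \<open>The last letter is inserted first, so the word is absorbed from its right end into the
  tableau read after it. Inserting the letters of \<open>a\<close> from left to right is therefore
  \<open>insw (rev a)\<close>.\<close>

abbreviation insw :: "nat list \<Rightarrow> nat set list \<Rightarrow> nat set list" where
  "insw w T \<equiv> foldr ins w T"

lemma insw_nz: "insw (nz w) T = insw w T"
  by (induction w) auto

lemma insw_np:
  "Tab T \<Longrightarrow> reduced (w @ word_of T) \<Longrightarrow> Tab (insw w T) \<and> np (w @ word_of T) (word_of (insw w T))"
proof (induction w)
  case (Cons x w)
  then have IH: "Tab (insw w T)" "np (w @ word_of T) (word_of (insw w T))"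
    using reduced_tl by auto
  then have n: "np (x # w @ word_of T) (x # word_of (insw w T))" by (intro np_Cons)
  then have i: "insertable x (insw w T)" using IH Cons.prems np_reduced by (auto simp: insertable_def)
  show ?case using Tab_ins[OF i] np_trans[OF n ins_np[OF i]] by simp
qed simp

text \<open>Each insertion rewrites the word by \<open>np_column\<close>, so the next letter meets
  its column inside a reduced word and is \<open>good\<close> there.\<close>

lemma column3:
  assumes "finite C" "0 \<notin> C" "reduced ([x, y, z] @ asc C @ v)"
  shows "good z C" "good y (bump z C)" "good x (bump y (bump z C))"
    "reduced (nz [out x (bump y (bump z C)), out y (bump z C), out z C] @ v)"
proof -
  have r: "reduced (z # asc C)" using reduced_factor[of "[x, y]" "z # asc C" v] assms by simp
  show z: "good z C" by (rule good_if_reduced[OF assms(1,2) r])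
  have n1: "np ([x, y, z] @ asc C @ v) ([x, y] @ asc (bump z C) @ letter (out z C) @ v)"
    using np_cong[OF np_column[OF z], of "[x, y]" v] by simp
  have r1: "reduced ([x] @ (y # asc (bump z C)) @ letter (out z C) @ v)" using n1 assms(3) np_reduced by simp
  have f1: "finite (bump z C)" "0 \<notin> bump z C" using z by (simp_all add: bump_0 good_def)
  show y: "good y (bump z C)" by (rule good_if_reduced[OF f1 reduced_factor[OF r1]])
  have n2: "np ([x, y] @ asc (bump z C) @ letter (out z C) @ v)
      ([x] @ asc (bump y (bump z C)) @ letter (out y (bump z C)) @ letter (out z C) @ v)"
    using np_cong[OF np_column[OF y], of "[x]" "letter (out z C) @ v"] by simp
  have r2: "reduced ([] @ (x # asc (bump y (bump z C))) @ letter (out y (bump z C)) @ letter (out z C) @ v)"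
    using n2 r1 np_reduced by simp
  have f2: "finite (bump y (bump z C))" "0 \<notin> bump y (bump z C)" using y by (simp_all add: bump_0 good_def)
  show x: "good x (bump y (bump z C))" by (rule good_if_reduced[OF f2 reduced_factor[OF r2]])
  have n3: "np ([x] @ asc (bump y (bump z C)) @ letter (out y (bump z C)) @ letter (out z C) @ v)
      (asc (bump x (bump y (bump z C))) @ letter (out x (bump y (bump z C))) @ letter (out y (bump z C)) @ letter (out z C) @ v)"
    using np_cong[OF np_column[OF x], of "[]" "letter (out y (bump z C)) @ letter (out z C) @ v"] by simp
  have "reduced (asc (bump x (bump y (bump z C))) @ letter (out x (bump y (bump z C))) @ letter (out y (bump z C)) @ letter (out z C) @ v)"
    using n3 r2 np_reduced by simp
  then have "reduced (letter (out x (bump y (bump z C))) @ letter (out y (bump z C)) @ letter (out z C) @ v)"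
    by (rule reduced_append2)
  moreover have "letter a @ letter b @ letter c @ v = nz [a, b, c] @ v" for a b c
    by (simp add: letter_def)
  ultimately show "reduced (nz [out x (bump y (bump z C)), out y (bump z C), out z C] @ v)" by simp
qed

lemma column_move3:
  assumes "move3 [x, y, z] [x', y', z']" "finite C" "0 \<notin> C"
    "reduced ([x, y, z] @ asc C @ v)" "reduced ([x', y', z'] @ asc C @ v)"
  shows "bump x (bump y (bump z C)) = bump x' (bump y' (bump z' C)) \<and>
    rel3 [out x (bump y (bump z C)), out y (bump z C), out z C] [out x' (bump y' (bump z' C)), out y' (bump z' C), out z' C]"
proof -
  note g = column3[OF assms(2,3,4)] and h = column3[OF assms(2,3,5)]
  consider (1) "y < x" "x < z" "x' = x" "y' = z" "z' = y" | (2) "x < z" "z < y" "x' = y" "y' = x" "z' = z"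
    | (3) "y = Suc x" "z = x" "x' = Suc x" "y' = x" "z' = Suc x"
    using assms(1) by (auto simp: move3_def)
  then show ?thesis
  proof cases
    case 1
    show ?thesis using column_bac[of y x z C] g h 1 by simp
  next
    case 2
    show ?thesis using column_acb[of x z y C] g h 2 by simp
  next
    case 3
    show ?thesis using column_braid[of x C] g h 3 by simp
  qed
qed

text \<open>The first column turns the two triples into output triples related by
  \<open>rel3\<close>, and the induction hypothesis applies to these on the remaining
  columns.\<close>

lemma insw_move3:
  "move3 [x, y, z] [x', y', z'] \<Longrightarrow> Tab T \<Longrightarrow> reduced ([x, y, z] @ word_of T) \<Longrightarrow>
    reduced ([x', y', z'] @ word_of T) \<Longrightarrow> insw [x, y, z] T = insw [x', y', z'] T"
proof (induction T arbitrary: x y z x' y' z')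
  case Nil
  have p: "0 < x" "0 < y" "0 < z" "0 < x'" "0 < y'" "0 < z'"
    using Nil.prems by (auto simp: reduced_iff)
  \<comment> \<open>The first letter inserted is appended to an empty column, so its output is 0.
    Since \<open>move3\<close> demands positive triples, \<open>rel3\<close> can here only mean
    equality after deleting zeros.\<close>
  let ?o = "[out x (bump y {z}), out y {z}, 0]" and ?o' = "[out x' (bump y' {z'}), out y' {z'}, 0]"
  have r: "bump x (bump y {z}) = bump x' (bump y' {z'})" "rel3 ?o ?o'"
    using column_move3[OF Nil.prems(1), of "{}" "[]"] Nil.prems by auto
  then have "insw ?o [] = insw ?o' []"
    using insw_nz[of ?o "[]"] insw_nz[of ?o' "[]"] by (auto simp: rel3_def move3_def simp del: foldr.simps filter.simps)
  then show ?case using p r by simp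
next
  case (Cons C T)
  have p: "0 < x" "0 < y" "0 < z" "0 < x'" "0 < y'" "0 < z'"
    using Cons.prems by (auto simp: reduced_iff)
  have f: "finite C" "0 \<notin> C" "Tab T" using Cons.prems by auto
  have red: "reduced ([x, y, z] @ asc C @ word_of T)" "reduced ([x', y', z'] @ asc C @ word_of T)"
    using Cons.prems by auto
  define u where "u = [out x (bump y (bump z C)), out y (bump z C), out z C]"
  define u' where "u' = [out x' (bump y' (bump z' C)), out y' (bump z' C), out z' C]"
  have r: "bump x (bump y (bump z C)) = bump x' (bump y' (bump z' C))" "rel3 u u'"
    using column_move3[OF Cons.prems(1) f(1,2) red] by (simp_all add: u_def u'_def)
  have ru: "reduced (nz u @ word_of T)" "reduced (nz u' @ word_of T)"
    using column3(4)[OF f(1,2) red(1)] column3(4)[OF f(1,2) red(2)] by (simp_all add: u_def u'_def)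
  have "insw u T = insw u' T"
  proof (cases "nz u = nz u'")
    case True
    then show ?thesis using insw_nz by metis
  next
    case False
    have IH: "insw v T = insw v' T" if mv: "move3 v v'" and rv: "reduced (nz v @ word_of T)" "reduced (nz v' @ word_of T)" for v v'
    proof -
      have "0 \<notin> set v" "0 \<notin> set v'" using mv by (auto simp: move3_def)
      then have "nz v = v" "nz v' = v'" by (auto simp: filter_id_conv intro: gr0I)
      moreover obtain a b c a' b' c' where "v = [a, b, c]" "v' = [a', b', c']"
        using mv unfolding move3_def by blast
      ultimately show ?thesis using Cons.IH[of a b c a' b' c'] mv rv f(3) by simp
    qed
    show ?thesis using r(2) False IH[OF _ ru] IH[OF _ ru(2,1)] by (auto simp: rel3_def)
  qed
  then show ?case using p r(1) by (simp add: u_def u'_def)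
qed

lemma insw_move:
  assumes "nilplactic_move w w'" "reduced w"
  shows "insw w [] = insw w' []"
proof -
  obtain u v m m' where w: "w = u @ m @ v" "w' = u @ m' @ v"
    and m: "(\<exists>a b c. a < b \<and> b < c \<and> m = [b, a, c] \<and> m' = [b, c, a]) \<or>
     (\<exists>a b c. a < b \<and> b < c \<and> m = [a, c, b] \<and> m' = [c, a, b]) \<or>
     (\<exists>k. m = [k, Suc k, k] \<and> m' = [Suc k, k, Suc k])"
    using assms(1)
  proof cases
    case (1 a b c u v)
    then show ?thesis by (intro that[of u "[b, a, c]" v "[b, c, a]"]) auto
  next
    case (2 a b c u v)
    then show ?thesis by (intro that[of u "[a, c, b]" v "[c, a, b]"]) auto
  next
    case (3 u k v)
    then show ?thesis by (intro that[of u "[k, Suc k, k]" v "[Suc k, k, Suc k]"]) auto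
  qed
  obtain x y z x' y' z' where xyz: "m = [x, y, z]" "m' = [x', y', z']" using m by blast
  have r': "reduced w'" using assms np_move np_reduced by blast
  have rm: "reduced (m @ v)" "reduced (m' @ v)" "reduced v"
    using assms(2) r' w reduced_append2 by metis+
  have "0 \<notin> set m" using rm(1) by (auto simp: reduced_iff)
  then have mv: "move3 m m'" using m by (simp add: move3_def)
  have T: "Tab (insw v [])" "np v (word_of (insw v []))" using insw_np[of "[]" v] rm by auto
  have "reduced (m @ word_of (insw v []))" "reduced (m' @ word_of (insw v []))"
    using rm np_append2[OF T(2)] np_reduced by blast+
  then have "insw m (insw v []) = insw m' (insw v [])"
    using insw_move3 mv T(1) xyz by metis
  then show ?thesis by (simp add: w)
qed

lemma insw_invariant: "np w w' \<Longrightarrow> reduced w \<Longrightarrow> insw w [] = insw w' []"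
proof (induction rule: np_induct)
  case (step b c)
  have "reduced b" "reduced c" using step by (meson np_move np_reduced)+
  then show ?case using step insw_move by metis
qed simp

lemma Tab_mem: "Tab T \<Longrightarrow> C \<in> set T \<Longrightarrow> finite C \<and> C \<noteq> {} \<and> 0 \<notin> C"
  by (induction T) auto

text \<open>The last column always has a corner at its bottom, so reverse insertion can be repeated
  until the tableau is empty.\<close>

lemma insw_surj: "Tab T \<Longrightarrow> reduced (word_of T) \<Longrightarrow> \<exists>w. reduced w \<and> insw w [] = T"
proof (induction "length (word_of T)" arbitrary: T rule: less_induct)
  case less
  show ?case
  proof (cases "T = []")
    case True
    then show ?thesis by (intro exI[of _ "[]"]) simp
  next
    case False
    have "col T (length T - 1) \<in> set T" using False by (simp add: col_def)
    then have "col T (length T - 1) \<noteq> {} \<and> finite (col T (length T - 1))" using less.prems(1)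
      Tab_mem by blast
    then have "card (col T (Suc (length T - 1))) < card (col T (length T - 1))"
      using False by (simp add: col_def[of _ "length T"] card_gt_0_iff)
    then obtain x T' where x: "insertable x T'" "ins x T' = T"
      using ins_surj[OF less.prems, of "length T - 1"] False by auto
    have n: "np (x # word_of T') (word_of T)" using ins_np[OF x(1)] x(2) by simp
    obtain w where w: "reduced w" "insw w [] = T'"
      using less.hyps[of T'] x(1) np_length[OF n] reduced_tl by (auto simp: insertable_def)
    have "np (x # w) (word_of T)"
      using np_Cons[of w "word_of T'" x] insw_np[of "[]" w] w n np_trans by auto
    then have "reduced (x # w)" using less.prems(2) np_reduced by blast
    then show ?thesis using w x by (intro exI[of _ "x # w"]) simp
  qed
qed

text \<open>Some word \<open>w\<close> inserts to \<open>T\<close>, hence \<open>w\<close> is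
  equivalent to the reading word of \<open>T\<close>, and equivalent words have the same
  tableau.\<close>

lemma insw_word_of:
  assumes "Tab T" "reduced (word_of T)"
  shows "insw (word_of T) [] = T"
proof -
  obtain w where w: "reduced w" "insw w [] = T" using insw_surj[OF assms] by blast
  then have "np w (word_of T)" using insw_np[of "[]" w] by simp
  then show ?thesis using insw_invariant w by metis
qed

subsection \<open>The star action\<close>

lemma star_iff: "finite S \<Longrightarrow> x \<in> star S m \<longleftrightarrow> x = m \<or> x \<in> S \<and> (x < m \<or> (\<exists>s\<in>S. m \<le> s \<and> s < x))"
proof (cases "\<exists>s\<in>S. m \<le> s")
  case True
  assume "finite S"
  then have f: "finite {s \<in> S. m \<le> s}" "{s \<in> S. m \<le> s} \<noteq> {}" using True by auto
  define n where "n = Min {s \<in> S. m \<le> s}"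
  have n: "n \<in> S" "m \<le> n" "\<And>s. s \<in> S \<Longrightarrow> m \<le> s \<Longrightarrow> n \<le> s"
    using Min_in[OF f] Min_le[OF f(1)] by (auto simp: n_def)
  have "star S m = insert m (S - {n})" using True by (simp add: star_def n_def)
  moreover have "x \<noteq> n \<longleftrightarrow> x < m \<or> (\<exists>s\<in>S. m \<le> s \<and> s < x)" if x: "x \<in> S"
  proof
    assume "x \<noteq> n"
    then have "n < x" if "m \<le> x" using n(3)[OF x that] by simp
    then show "x < m \<or> (\<exists>s\<in>S. m \<le> s \<and> s < x)" using n(1,2) by (meson not_le)
  next
    assume "x < m \<or> (\<exists>s\<in>S. m \<le> s \<and> s < x)"
    then show "x \<noteq> n" using n(2,3) by (meson not_le)
  qed
  ultimately show ?thesis by blast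
next
  case False
  then show ?thesis by (auto simp: star_def not_le)
qed

lemma finite_star [simp]: "finite S \<Longrightarrow> finite (star S m)"
  by (simp add: star_def)

abbreviation act :: "nat set \<Rightarrow> nat list \<Rightarrow> nat set" where
  "act S w \<equiv> foldl star S w"

lemma finite_act [simp]: "finite S \<Longrightarrow> finite (act S w)"
  by (induction w arbitrary: S) auto

text \<open>Removing the least letter \<open>n \<ge> m\<close> and adding \<open>m\<close> lowers
  the counts exactly for thresholds in \<open>m < t \<le> n\<close>, where they equal
  \<open>up S m\<close>; this is truncation at \<open>up S m - 1\<close>. Identities between
  \<open>star\<close> actions thus become arithmetic of \<open>min\<close>.\<close>

lemma up_star:
  assumes "finite S"
  shows "up (star S m) t = (if t \<le> m then up S t + (if up S m = 0 then 1 else 0) else min (up S t) (up S m - 1))"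
proof (cases "\<exists>s\<in>S. m \<le> s")
  case True
  have f: "finite {s \<in> S. m \<le> s}" "{s \<in> S. m \<le> s} \<noteq> {}" using True assms by auto
  define n where "n = Min {s \<in> S. m \<le> s}"
  have n: "n \<in> S" "m \<le> n" "\<And>s. s \<in> S \<Longrightarrow> m \<le> s \<Longrightarrow> n \<le> s"
    using Min_in[OF f] Min_le[OF f(1)] by (auto simp: n_def)
  have st: "star S m = insert m (S - {n})" using True by (simp add: star_def n_def)
  have pos: "0 < up S m" using True up_pos_iff[OF assms] by blast
  have mn: "m \<notin> S - {n}" using n by force
  have u: "up (star S m) t = up (S - {n}) t + (if t \<le> m then 1 else 0)"
    using up_insert[OF _ mn, of t] assms by (simp add: st)
  have r: "up S t = up (S - {n}) t + (if t \<le> n then 1 else 0)"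
    by (rule up_remove[OF assms n(1)])
  have *: "up S t = up S m" if "m \<le> t" "t \<le> n" using that n(3)
    by (intro up_eq_gap[OF assms, symmetric]) (auto intro: le_trans)
  have **: "up S t < up S m" if "n < t"
  proof -
    have "up S n = up S m" using n by (intro up_eq_gap[OF assms, symmetric]) auto
    moreover have "up S (Suc n) < up S n" using up_Suc[OF assms, of n] n(1) by simp
    moreover have "up S t \<le> up S (Suc n)" using that by (intro up_antimono[OF assms]) auto
    ultimately show ?thesis by simp
  qed
  consider "t \<le> m" | "m < t" "t \<le> n" | "n < t" using n(2) by linarith
  then show ?thesis
  proof cases
    case 1
    then show ?thesis using u r n(2) pos by simp
  next
    case 2
    then show ?thesis using u r *[OF less_imp_le] pos by simp
  next
    case 3
    then show ?thesis using u r **[OF 3] n(2) by simp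
  qed
next
  case False
  have m: "m \<notin> S" using False by auto
  have 0: "up S m = 0" using up_pos_iff[OF assms, of m] False by auto
  have "up (star S m) t = up S t + (if t \<le> m then 1 else 0)"
    using up_insert[OF assms m] False by (simp add: star_def)
  moreover have "up S t = 0" if "m < t" using up_antimono[OF assms, of m t] that 0 by simp
  ultimately show ?thesis using 0 by auto
qed

lemma set_eq_up: "finite S \<Longrightarrow> finite S' \<Longrightarrow> (\<And>t. up S t = up S' t) \<Longrightarrow> S = S'"
proof (rule set_eqI)
  fix t assume "finite S" "finite S'" "\<And>t. up S t = up S' t"
  then show "t \<in> S \<longleftrightarrow> t \<in> S'" using up_Suc[of S t] up_Suc[of S' t] by (auto split: if_splits)
qed

lemma star_bac:
  assumes "finite S" "a < b" "b < c"
  shows "star (star (star S b) a) c = star (star (star S b) c) a"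
proof (rule set_eq_up)
  fix t
  have m: "up S b \<le> up S a" "up S c \<le> up S b" using assms by (auto intro: up_antimono)
  consider "t \<le> a" "up S a \<le> up S t" | "a < t" "t \<le> b" "up S t \<le> up S a" "up S b \<le> up S t"
    | "b < t" "t \<le> c" "up S t \<le> up S b" "up S c \<le> up S t" | "c < t" "up S t \<le> up S c"
    using up_antimono[OF assms(1)] by (meson nle_le not_le less_imp_le)
  then show "up (star (star (star S b) a) c) t = up (star (star (star S b) c) a) t"
  proof cases
    case 1
    then show ?thesis using assms(2,3) m by (auto simp: up_star assms(1) min_def)
  next
    case 2
    then show ?thesis using assms(2,3) m by (auto simp: up_star assms(1) min_def)
  next
    case 3
    then show ?thesis using assms(2,3) m by (auto simp: up_star assms(1) min_def)
  next
    case 4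
    then show ?thesis using assms(2,3) m by (auto simp: up_star assms(1) min_def)
  qed
qed (use assms in auto)

lemma star_acb:
  assumes "finite S" "a < b" "b < c"
  shows "star (star (star S a) c) b = star (star (star S c) a) b"
proof (rule set_eq_up)
  fix t
  have m: "up S b \<le> up S a" "up S c \<le> up S b" using assms by (auto intro: up_antimono)
  consider "t \<le> a" "up S a \<le> up S t" | "a < t" "t \<le> b" "up S t \<le> up S a" "up S b \<le> up S t"
    | "b < t" "t \<le> c" "up S t \<le> up S b" "up S c \<le> up S t" | "c < t" "up S t \<le> up S c"
    using up_antimono[OF assms(1)] by (meson nle_le not_le less_imp_le)
  then show "up (star (star (star S a) c) b) t = up (star (star (star S c) a) b) t"
  proof cases
    case 1
    then show ?thesis using assms(2,3) m by (auto simp: up_star assms(1) min_def)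
  next
    case 2
    then show ?thesis using assms(2,3) m by (auto simp: up_star assms(1) min_def)
  next
    case 3
    then show ?thesis using assms(2,3) m by (auto simp: up_star assms(1) min_def)
  next
    case 4
    then show ?thesis using assms(2,3) m by (auto simp: up_star assms(1) min_def)
  qed
qed (use assms in auto)

text \<open>The arithmetic uses that the counts at \<open>k\<close> and \<open>Suc k\<close> differ
  by at most one.\<close>

lemma star_braid:
  assumes "finite S"
  shows "star (star (star S k) (Suc k)) k = star (star (star S (Suc k)) k) (Suc k)"
proof (rule set_eq_up)
  fix t
  have m: "up S (Suc k) \<le> up S k" "up S k \<le> Suc (up S (Suc k))"
    using up_Suc[OF assms, of k] by auto
  consider "t \<le> k" "up S k \<le> up S t" | "t = Suc k" | "Suc k < t" "up S t \<le> up S (Suc k)"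
    using up_antimono[OF assms] by (metis less_imp_le not_less_eq linorder_neqE_nat not_less)
  then show "up (star (star (star S k) (Suc k)) k) t = up (star (star (star S (Suc k)) k) (Suc k)) t"
  proof cases
    case 1
    have ?thesis if "up S k = 0" using that 1 m by (simp add: up_star assms)
    moreover have ?thesis if "0 < up S k" "up S (Suc k) = 0"
    proof -
      have "up S k = 1" using that m by simp
      then show ?thesis using that 1 by (simp add: up_star assms)
    qed
    moreover have ?thesis if "0 < up S (Suc k)"
    proof -
      consider "up S k = up S (Suc k)" | "up S k = Suc (up S (Suc k))" using m by linarith
      then show ?thesis using that 1 by cases (simp_all add: up_star assms)
    qed
    ultimately show ?thesis using m by linarith
  next
    case 2
    consider "up S k = up S (Suc k)" | "up S k = Suc (up S (Suc k))" using m by linarith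
    then show ?thesis unfolding 2 by cases (simp_all add: up_star assms)
  next
    case 3
    consider "up S k = up S (Suc k)" | "up S k = Suc (up S (Suc k))" using m by linarith
    then show ?thesis using 3 by cases (simp_all add: up_star assms)
  qed
qed (use assms in auto)

lemma act_np: "np w w' \<Longrightarrow> finite S \<Longrightarrow> act S w = act S w'"
proof (induction rule: np_induct)
  case (step b c)
  have "act S u = act S v" if "nilplactic_move u v" for u v
    using that
  proof cases
    case (1 a b c u v)
    then show ?thesis using star_bac[of "act S u" a b c] step.prems by simp
  next
    case (2 a b c u v)
    then show ?thesis using star_acb[of "act S u" a b c] step.prems by simp
  next
    case (3 u k v)
    then show ?thesis using star_braid[of "act S u" k] step.prems by simp
  qed
  then show ?case using step by metis
qed simp

lemma act_keep: "finite S \<Longrightarrow> x \<in> S \<Longrightarrow> \<forall>y\<in>set v. x < y \<Longrightarrow> x \<in> act S v"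
  by (induction v arbitrary: S) (auto simp: star_iff)

text \<open>A letter only removes letters that are at least as large, so an increasing word never
  destroys what it has added.\<close>

lemma act_superset: "finite S \<Longrightarrow> sorted_wrt (<) v \<Longrightarrow> set v \<subseteq> act S v"
proof (induction v arbitrary: S)
  case (Cons y v)
  then show ?case using act_keep[of "star S y" y v] by (auto simp: star_iff)
qed simp

lemma act_subset: "finite S \<Longrightarrow> act S v \<subseteq> S \<union> set v"
proof (induction v arbitrary: S)
  case (Cons y v)
  then have "act (star S y) v \<subseteq> star S y \<union> set v" by simp
  moreover have "star S y \<subseteq> insert y S" using Cons.prems by (auto simp: star_iff)
  ultimately show ?case by auto
qed simp

lemma act_asc: "finite C \<Longrightarrow> act {} (asc C) = C"
  using act_superset[of "{}" "asc C"] act_subset[of "{}" "asc C"] by auto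

lemma act_mono: "finite S' \<Longrightarrow> S \<subseteq> S' \<Longrightarrow> act S w \<subseteq> act S' w"
proof (induction w arbitrary: S S')
  case (Cons m w)
  have "finite S" using Cons.prems finite_subset by blast
  then have "star S m \<subseteq> star S' m"
    unfolding subset_iff star_iff[OF \<open>finite S\<close>] star_iff[OF Cons.prems(1)] using Cons.prems(2) by blast
  then show ?case using Cons by simp
qed simp

text \<open>A letter is only removed in favour of one that is not larger, so the least letter ever
  seen stays visible as a lower bound.\<close>

lemma act_lower_bound: "finite S \<Longrightarrow> (\<forall>s\<in>act S w. y \<le> s) \<longleftrightarrow> (\<forall>s\<in>S. y \<le> s) \<and> (\<forall>m\<in>set w. y \<le> m)"
proof (induction w arbitrary: S)
  case (Cons m w)
  have "(\<forall>s\<in>star S m. y \<le> s) \<longleftrightarrow> (\<forall>s\<in>S. y \<le> s) \<and> y \<le> m"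
  proof (intro iffI conjI ballI)
    assume a: "\<forall>s\<in>star S m. y \<le> s"
    show m: "y \<le> m" using a Cons.prems by (simp add: star_iff)
    fix s assume s: "s \<in> S"
    show "y \<le> s"
    proof (cases "s < m")
      case True
      then show ?thesis using a s Cons.prems by (simp add: star_iff)
    next
      case False
      then show ?thesis using m by simp
    qed
  qed (use Cons.prems in \<open>auto simp: star_iff\<close>)
  then show ?case using Cons by auto
qed simp

text \<open>Domination lets every letter find one to replace, and it survives the replacement
  because the remaining letters of the word are larger.\<close>

lemma card_act_sorted:
  "finite S \<Longrightarrow> sorted_wrt (<) l \<Longrightarrow> (\<And>t. up (set l) t \<le> up S t) \<Longrightarrow> card (act S l) = card S"
proof (induction l arbitrary: S)
  case (Cons d l)
  have n: "d \<notin> set l" using Cons.prems(2) by auto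
  have ul: "up (set (d # l)) t = up (set l) t + (if t \<le> d then 1 else 0)" for t
    using up_insert[OF _ n, of t] by simp
  have d: "up (set l) d + 1 \<le> up S d" using Cons.prems(3)[of d] ul[of d] by simp
  have "up (set l) t \<le> up (star S d) t" for t
  proof (cases "t \<le> d")
    case True
    then show ?thesis using Cons.prems(3)[of t] ul[of t] by (simp add: up_star[OF Cons.prems(1)])
  next
    case False
    then have "up (set l) t \<le> up (set l) d" by (intro up_antimono) auto
    then show ?thesis using Cons.prems(3)[of t] ul[of t] d False by (simp add: up_star[OF Cons.prems(1)])
  qed
  then have "card (act (star S d) l) = card (star S d)" using Cons by (intro Cons.IH) auto
  also have "\<dots> = card S" using d up_star[OF Cons.prems(1), of d 0] by (simp add: up_0)
  finally show ?case by simp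
qed simp

text \<open>After a column has been read it is contained in the result, which therefore dominates
  the next column.\<close>

lemma card_act_word_of: "finite S \<Longrightarrow> Tab T \<Longrightarrow> wdom S (fcol T) \<Longrightarrow> card (act S (word_of T)) = card S"
proof (induction T arbitrary: S)
  case (Cons C T)
  have f: "finite C" using Cons.prems by simp
  have 1: "card (act S (asc C)) = card S" using Cons.prems by (intro card_act_sorted) (auto simp: wdom_def)
  have "C \<subseteq> act S (asc C)" using act_superset[OF Cons.prems(1), of "asc C"] f by simp
  then have "up C t \<le> up (act S (asc C)) t" for t using Cons.prems by (intro up_mono) auto
  moreover have "up (fcol T) t \<le> up C t" for t
    using Cons.prems(2) up_antimono[OF f, of t "Suc t"] unfolding Tab.simps dom_def by (meson le_SucI order_refl le_trans)
  ultimately have "wdom (act S (asc C)) (fcol T)" unfolding wdom_def by (meson le_trans)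
  then show ?case using 1 Cons by simp
qed simp

lemma dom_wdom: "finite C \<Longrightarrow> dom C D \<Longrightarrow> wdom C D"
  unfolding dom_def wdom_def using up_antimono[of C] by (meson le_SucI order_refl le_trans)

text \<open>This invariant holds for the results of acting on \<open>{}\<close>, on a column, and on the column with a further box.\<close>

definition star_inv :: "nat set \<Rightarrow> nat set \<Rightarrow> nat set \<Rightarrow> bool" where
  "star_inv S0 S1 S2 \<longleftrightarrow> finite S1 \<and> S0 \<subseteq> S1 \<and>
     (S2 = S1 \<or> (\<exists>z. z \<notin> S1 \<and> S2 = insert z S1 \<and> (\<forall>s\<in>S2. s < z \<longrightarrow> s \<in> S0)))"

text \<open>Let \<open>z\<close> be the extra letter. If \<open>z < m\<close>, or if a letter of
  \<open>S0\<close> from \<open>m\<close> on lies below \<open>z\<close>, then \<open>z\<close>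
  remains the extra letter. Otherwise \<open>m\<close> removes \<open>z\<close> from
  \<open>S2\<close>, while \<open>S1\<close> loses its next letter \<open>n\<close>, which becomes
  the new extra letter, or loses nothing, and the two sets coincide.\<close>

lemma star_inv_step: "star_inv S0 S1 S2 \<Longrightarrow> star_inv (star S0 m) (star S1 m) (star S2 m)"
proof -
  assume inv: "star_inv S0 S1 S2"
  then have f: "finite S1" "finite S0" "finite S2" and sub: "S0 \<subseteq> S1"
    by (auto simp: star_inv_def intro: finite_subset)
  have sub': "star S0 m \<subseteq> star S1 m" using act_mono[OF f(1) sub, of "[m]"] by simp
  show ?thesis
  proof (cases "S2 = S1")
    case True
    then show ?thesis using f sub' by (simp add: star_inv_def)
  next
    case False
    then obtain z where z: "z \<notin> S1" "S2 = insert z S1" "\<forall>s\<in>S2. s < z \<longrightarrow> s \<in> S0"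
      using inv unfolding star_inv_def by blast
    consider (1) "z < m" | (2) "\<exists>s\<in>S0. m \<le> s \<and> s < z" | (3) "m \<le> z" "\<not> (\<exists>s\<in>S2. m \<le> s \<and> s < z)"
      using z(3) by (meson not_le)
    then show ?thesis
    proof cases
      case 1
      have "star S2 m = insert z (star S1 m)" using 1 z f by (auto simp: star_iff)
      moreover have "z \<notin> star S1 m" using 1 z f by (auto simp: star_iff)
      moreover have "\<forall>s\<in>star S2 m. s < z \<longrightarrow> s \<in> star S0 m" using 1 z f by (auto simp: star_iff)
      ultimately show ?thesis using f sub' by (auto simp: star_inv_def)
    next
      case 2
      then obtain s where s: "s \<in> S0" "m \<le> s" "s < z" by blast
      have "s \<in> S1" using s sub by blast
      then have "star S2 m = insert z (star S1 m)"
        using s z f by (intro set_eqI) (auto simp: star_iff intro: less_trans le_trans)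
      moreover have "z \<notin> star S1 m" using s z f by (auto simp: star_iff)
      moreover have "\<forall>s\<in>star S2 m. s < z \<longrightarrow> s \<in> star S0 m"
      proof (intro ballI impI)
        fix x assume x: "x \<in> star S2 m" "x < z"
        then consider "x = m" | "x \<in> S2" "x < m" | s' where "x \<in> S2" "s' \<in> S2" "m \<le> s'" "s' < x"
          using star_iff[OF f(3)] by blast
        then show "x \<in> star S0 m"
        proof cases
          case 3
          then have "x \<in> S0" "s' \<in> S0" using z(3) x(2) less_trans by blast+
          then show ?thesis using 3 star_iff[OF f(2)] by blast
        qed (use x z(3) star_iff[OF f(2)] in blast)+
      qed
      ultimately show ?thesis using f sub' by (auto simp: star_inv_def)
    next
      case 3
      have e2: "star S2 m = insert m S1"
        using 3 z f by (intro set_eqI) (auto simp: star_iff, metis linorder_neqE_nat not_le)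
      show ?thesis
      proof (cases "\<exists>s\<in>S1. m \<le> s")
        case False
        then have "star S1 m = insert m S1" by (simp add: star_def)
        then show ?thesis using f sub' e2 by (simp add: star_inv_def)
      next
        case True
        define n where "n = Min {s \<in> S1. m \<le> s}"
        have ff: "finite {s \<in> S1. m \<le> s}" "{s \<in> S1. m \<le> s} \<noteq> {}" using True f by auto
        have n: "n \<in> S1" "m \<le> n" "\<And>s. s \<in> S1 \<Longrightarrow> m \<le> s \<Longrightarrow> n \<le> s"
          using Min_in[OF ff] Min_le[OF ff(1)] by (auto simp: n_def)
        have zn: "z < n" using 3 n z by (metis insertI2 linorder_neqE_nat)
        have e1: "star S1 m = insert m (S1 - {n})" using True by (simp add: star_def n_def)
        have nn: "n \<noteq> m" using 3 zn by simp
        have "star S2 m = insert n (star S1 m)" using e1 e2 n by auto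
        moreover have "n \<notin> star S1 m" using e1 nn by simp
        moreover have "\<forall>s\<in>star S2 m. s < n \<longrightarrow> s \<in> star S0 m"
        proof (intro ballI impI)
          fix s assume s: "s \<in> star S2 m" "s < n"
          show "s \<in> star S0 m"
          proof (cases "s = m")
            case False
            then have "s \<in> S1" using s e2 by auto
            then have "s < m" using n(3)[of s] s(2) by (meson not_le)
            then show ?thesis using \<open>s \<in> S1\<close> z 3 f by (auto simp: star_iff)
          qed (use f in \<open>simp add: star_iff\<close>)
        qed
        ultimately show ?thesis using f sub' by (auto simp: star_inv_def)
      qed
    qed
  qed
qed

lemma star_inv_act: "star_inv S0 S1 S2 \<Longrightarrow> star_inv (act S0 w) (act S1 w) (act S2 w)"
  by (induction w arbitrary: S0 S1 S2) (auto intro: star_inv_step)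

subsection \<open>The columns of the right key under insertion\<close>

definition right_key :: "nat set list \<Rightarrow> nat \<Rightarrow> nat set" where
  "right_key T j = act {} (word_of (drop j T))"

lemma finite_right_key [simp]: "finite (right_key T j)"
  by (simp add: right_key_def)

lemma Tab_drop: "Tab T \<Longrightarrow> Tab (drop j T)"
proof (induction T arbitrary: j)
  case (Cons C T)
  then show ?case by (cases j) auto
qed simp

lemma right_key_eq: "Tab T \<Longrightarrow> right_key T j = act (col T j) (word_of (drop (Suc j) T))"
proof (cases "j < length T")
  case True
  assume T: "Tab T"
  have "drop j T = T ! j # drop (Suc j) T" using True by (rule Cons_nth_drop_Suc[symmetric])
  moreover have "finite (T ! j)" using True T Tab_mem nth_mem by blast
  ultimately show ?thesis using True by (simp add: right_key_def col_def act_asc)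
qed (simp add: right_key_def col_def)

lemma finite_col: "Tab T \<Longrightarrow> finite (col T j)"
  using Tab_mem[of T "T ! j"] by (auto simp: col_def)

lemma Tab_dom: "Tab T \<Longrightarrow> dom (col T j) (col T (Suc j))"
proof (induction T arbitrary: j)
  case (Cons C T)
  then show ?case by (cases j) (auto simp: fcol_col)
qed simp

lemma fcol_drop: "fcol (drop j T) = col T j"
  by (cases "j < length T") (auto simp: col_def fcol_col)

lemma card_right_key: "Tab T \<Longrightarrow> card (right_key T j) = card (col T j)"
  using card_act_word_of[of "col T j" "drop (Suc j) T"] dom_wdom[of "col T j" "col T (Suc j)"]
  by (simp add: right_key_eq fcol_drop finite_col Tab_drop Tab_dom)

lemma right_key_nested: "Tab T \<Longrightarrow> right_key T (Suc j) \<subseteq> right_key T j"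
  using act_mono[of "col T j" "{}"] by (simp add: right_key_eq[of T j] finite_col) (simp add: right_key_def)

text \<open>The witness is the letter carried into column \<open>j\<close>. Key columns depend only
  on tails of the tableau, and this makes \<open>ins_np\<close> applicable to the tails.\<close>

lemma drop_ins:
  "insertable x T \<Longrightarrow> j \<le> new_col x T \<Longrightarrow> \<exists>y. insertable y (drop j T) \<and> drop j (ins x T) = ins y (drop j T) \<and> new_col y (drop j T) = new_col x T - j"
proof (induction T arbitrary: x j)
  case Nil
  then show ?case by auto
next
  case (Cons C T)
  show ?case
  proof (cases j)
    case 0
    then show ?thesis using Cons.prems(1) by (intro exI[of _ x]) (simp del: ins.simps new_col.simps)
  next
    case (Suc i)
    then have n: "out x C \<noteq> 0" "i \<le> new_col (out x C) T" using Cons.prems(2) by (auto split: if_splits)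
    then show ?thesis using Cons.IH[OF insertable_next[OF Cons.prems(1) n(1)] n(2)] Suc insertable_pos[OF Cons.prems(1)]
      by simp
  qed
qed

lemma drop_ins': "new_col x T < j \<Longrightarrow> drop j (ins x T) = drop j T"
proof (induction T arbitrary: x j)
  case (Cons C T)
  then show ?case by (cases j) (auto split: if_splits)
qed auto

text \<open>Inserting into a tail puts one letter in front of its word up to equivalence. The
  resulting runs of \<open>star\<close> start from sets that differ by one letter,
  \<open>star_inv\<close> limits the difference of the results, and the column lengths decide
  whether a difference remains.\<close>

lemma right_key_ins:
  assumes "insertable x T" "k = new_col x T"
  shows "j \<noteq> k \<Longrightarrow> right_key (ins x T) j = right_key T j"
    and "\<exists>z. z \<notin> right_key T k \<and> right_key (ins x T) k = insert z (right_key T k) \<and> (\<forall>s\<in>right_key (ins x T) k. s < z \<longrightarrow> s \<in> right_key T (Suc k))"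
proof -
  have T: "Tab T" "Tab (ins x T)" using assms Tab_ins by (auto simp: insertable_def)
  have card: "card (right_key (ins x T) j) = card (right_key T j) + (if j = k then 1 else 0)" for j
    using card_right_key[OF T(1)] card_right_key[OF T(2)] card_ins[OF assms(1)] assms(2) by simp
  {
    assume "j \<noteq> k"
    show "right_key (ins x T) j = right_key T j"
    proof (cases "k < j")
      case True
      then show ?thesis using assms drop_ins' by (simp add: right_key_def)
    next
      case False
      then obtain y where y: "insertable y (drop j T)" "drop j (ins x T) = ins y (drop j T)"
        using drop_ins[OF assms(1), of j] assms(2) by auto
      have "right_key (ins x T) j = act {} (y # word_of (drop j T))"
        using act_np[OF ins_np[OF y(1)], of "{}"] y(2) by (simp add: right_key_def)
      moreover have "star {} y = {y}" by (simp add: star_def)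
      \<comment> \<open>Column \<open>j\<close> keeps its length, so the run from \<open>{y}\<close>
        must end in the same set as the run from \<open>{}\<close>.\<close>
      moreover have "star_inv {} {} {y}" by (simp add: star_inv_def)
      ultimately have "star_inv (right_key T j) (right_key T j) (right_key (ins x T) j)"
        using star_inv_act[of "{}" "{}" "{y}" "word_of (drop j T)"] by (simp add: right_key_def)
      then show ?thesis using card[of j] \<open>j \<noteq> k\<close> by (auto simp: star_inv_def)
    qed
  }
  obtain y where y: "insertable y (drop k T)" "drop k (ins x T) = ins y (drop k T)" "new_col y (drop k T) = 0"
    using drop_ins[OF assms(1), of k] assms(2) by auto
  define C where "C = col T k"
  define w where "w = word_of (drop (Suc k) T)"
  have fC: "finite C" using finite_col[OF T(1)] by (simp add: C_def)
  have g: "good y C" using insertable_good[OF y(1)] by (simp add: C_def fcol_drop)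
  have "word_of (drop k T) = asc C @ w"
  proof (cases "k < length T")
    case True
    then show ?thesis by (simp add: C_def w_def col_def Cons_nth_drop_Suc[symmetric])
  qed (simp add: C_def w_def col_def)
  moreover have lt: "\<forall>z\<in>C. y < z"
  proof (cases "drop k T")
    case Nil
    then show ?thesis by (simp add: C_def col_def)
  next
    case (Cons a list)
    then have "C = a" using fcol_drop[of k T] by (simp add: C_def)
    then show ?thesis using y(3) Cons out_0_iff[OF g] by (auto split: if_splits)
  qed
  ultimately have "right_key (ins x T) k = act {} (asc (insert y C) @ w)"
    using act_np[OF ins_np[OF y(1)], of "{}"] y(2) asc_insert_less[OF fC lt] by (simp add: right_key_def)
  then have "right_key (ins x T) k = act (insert y C) w" using act_asc[of "insert y C"] fC by (simp del: sorted_list_of_set_insert_remove)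
  moreover have "\<exists>z. z \<notin> C \<and> insert y C = insert z C \<and> (\<forall>s\<in>insert y C. s < z \<longrightarrow> s \<in> {})"
    using lt by (intro exI[of _ y]) auto
  then have "star_inv {} C (insert y C)" using fC by (simp add: star_inv_def)
  ultimately have "star_inv (right_key T (Suc k)) (right_key T k) (right_key (ins x T) k)"
    using star_inv_act[of "{}" C "insert y C" w] right_key_eq[OF T(1), of k] by (simp add: right_key_def w_def C_def)
  \<comment> \<open>Column \<open>k\<close> gains a box, which excludes the case of equal sets in
    the invariant.\<close>
  moreover have "right_key (ins x T) k \<noteq> right_key T k" using card[of k] by auto
  ultimately show "\<exists>z. z \<notin> right_key T k \<and> right_key (ins x T) k = insert z (right_key T k) \<and> (\<forall>s\<in>right_key (ins x T) k. s < z \<longrightarrow> s \<in> right_key T (Suc k))"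
    unfolding star_inv_def by blast
qed

lemma right_key_0_lower_bound:
  assumes "insertable x T"
  shows "(\<forall>s\<in>right_key (ins x T) 0. y \<le> s) \<longleftrightarrow> y \<le> x \<and> (\<forall>s\<in>right_key T 0. y \<le> s)"
proof -
  have 1: "right_key (ins x T) 0 = act {} (x # word_of T)" "right_key T 0 = act {} (word_of T)"
    using act_np[OF ins_np[OF assms], of "{}"] by (simp_all add: right_key_def)
  show ?thesis unfolding 1 act_lower_bound[OF finite.emptyI] by simp
qed

subsection \<open>The left key\<close>

declare left_match.simps(2) [simp del]

text \<open>Hall's condition in counting form: under it the greedy choice in
  \<open>left_match\<close> never takes the minimum of an empty set.\<close>

definition matchable :: "nat set \<Rightarrow> nat list \<Rightarrow> bool" where
  "matchable X l \<longleftrightarrow> finite X \<and> sorted_wrt (<) l \<and> (\<forall>t. up (set l) t \<le> up X t)"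

abbreviation lm :: "nat set \<Rightarrow> nat list \<Rightarrow> nat set" where
  "lm X l \<equiv> set (left_match X l)"

lemma up_greater: "finite X \<Longrightarrow> b \<in> X \<Longrightarrow> up {c \<in> X. b < c} t = (if t \<le> b then up X b - 1 else up X t)"
proof -
  assume a: "finite X" "b \<in> X"
  have "{c \<in> {c \<in> X. b < c}. t \<le> c} = (if t \<le> b then {c \<in> X. Suc b \<le> c} else {c \<in> X. t \<le> c})"
    by auto
  then have "up {c \<in> X. b < c} t = (if t \<le> b then up X (Suc b) else up X t)" by (simp add: up_def)
  then show ?thesis using up_Suc[of X b] a by simp
qed

lemma matchable_tl: "matchable X (a # l) \<Longrightarrow> matchable X l"
  unfolding matchable_def using up_mono[of "set (a # l)" "set l"] by (auto intro: order_trans)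

text \<open>No letter of \<open>X\<close> lies between \<open>a\<close> and the choice
  \<open>b\<close>, so the count at \<open>a\<close> leaves room for all of \<open>l\<close> above
  \<open>b\<close>; this settles thresholds up to \<open>b\<close>, and larger ones are unaffected
  by the choice.\<close>

lemma matchable_Cons:
  assumes "matchable X (a # l)"
  obtains b where "b = Min {c \<in> X. a \<le> c}" "b \<in> X" "a \<le> b" "\<And>c. c \<in> X \<Longrightarrow> a \<le> c \<Longrightarrow> b \<le> c"
    "left_match X (a # l) = b # left_match {c \<in> X. b < c} l" "matchable {c \<in> X. b < c} l"
proof -
  have f: "finite X" and s: "sorted_wrt (<) (a # l)" and u: "\<And>t. up (set (a # l)) t \<le> up X t"
    using assms by (auto simp: matchable_def)
  have ul: "up (set (a # l)) t = up (set l) t + (if t \<le> a then 1 else 0)" for t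
    using s up_insert[of "set l" a t] by auto
  have "0 < up X a" using u[of a] ul[of a] by simp
  then have ne: "finite {c \<in> X. a \<le> c}" "{c \<in> X. a \<le> c} \<noteq> {}" using up_pos_iff[OF f] f by auto
  define b where "b = Min {c \<in> X. a \<le> c}"
  have b: "b \<in> X" "a \<le> b" "\<And>c. c \<in> X \<Longrightarrow> a \<le> c \<Longrightarrow> b \<le> c"
    using Min_in[OF ne] Min_le[OF ne(1)] by (auto simp: b_def)
  have "up X a = up X b" using b by (intro up_eq_gap[OF f]) auto
  moreover have "{c \<in> set l. a \<le> c} = set l" using s by auto
  then have "up (set l) a = card (set l)" by (simp add: up_def)
  ultimately have c: "card (set l) \<le> up X b - 1" using u[of a] ul[of a] by simp
  have "up (set l) t \<le> up {c \<in> X. b < c} t" for t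
  proof (cases "t \<le> b")
    case True
    then show ?thesis using c up_le_card[of "set l" t] by (simp add: up_greater[OF f b(1)])
  next
    case False
    then show ?thesis using u[of t] ul[of t] by (simp add: up_greater[OF f b(1)])
  qed
  then have "matchable {c \<in> X. b < c} l" using f s by (auto simp: matchable_def)
  then show ?thesis using that[OF b_def b] by (simp add: b_def[symmetric] left_match.simps(2))
qed

lemma left_match_props:
  "matchable X l \<Longrightarrow> lm X l \<subseteq> X \<and> card (lm X l) = length l \<and> (\<forall>t. up (set l) t \<le> up (lm X l) t)"
proof (induction l arbitrary: X)
  case (Cons a l)
  obtain b where b: "b \<in> X" "a \<le> b" "left_match X (a # l) = b # left_match {c \<in> X. b < c} l" "matchable {c \<in> X. b < c} l"
    by (rule matchable_Cons[OF Cons.prems]) (rule that; assumption)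
  note IH = Cons.IH[OF b(4)]
  then have n: "b \<notin> lm {c \<in> X. b < c} l" by auto
  have "a \<notin> set l" using Cons.prems by (auto simp: matchable_def)
  then have "up (set (a # l)) t \<le> up (lm X (a # l)) t" for t
    using b up_insert[OF _ n, of t] up_insert[of "set l" a t] IH by (auto intro: le_SucI)
  then show ?case using IH b n by auto
qed simp

lemma left_match_restrict:
  "matchable X l \<Longrightarrow> \<forall>x\<in>set l. a \<le> x \<Longrightarrow> left_match {c \<in> X. a \<le> c} l = left_match X l"
proof (cases l)
  case (Cons x l')
  assume m: "matchable X l" and a: "\<forall>x\<in>set l. a \<le> x"
  obtain b where b: "b = Min {c \<in> X. x \<le> c}" "x \<le> b"
    by (rule matchable_Cons[OF m[unfolded Cons]]) (rule that; assumption)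
  have "{c \<in> {c \<in> X. a \<le> c}. x \<le> c} = {c \<in> X. x \<le> c}" "{c \<in> {c \<in> X. a \<le> c}. b < c} = {c \<in> X. b < c}"
    using a b(2) Cons by auto
  then show ?thesis using Cons b(1) by (simp add: Let_def left_match.simps(2))
qed simp

lemma matchable_restrict:
  assumes "matchable X l" "\<forall>x\<in>set l. a \<le> x"
  shows "matchable {c \<in> X. a \<le> c} l"
proof -
  have "up (set l) t \<le> up {c \<in> X. a \<le> c} t" for t
  proof (cases "a \<le> t")
    case True
    then have "{c \<in> {c \<in> X. a \<le> c}. t \<le> c} = {c \<in> X. t \<le> c}" by auto
    then show ?thesis using assms(1) by (simp add: matchable_def up_def)
  next
    case False
    then have "{c \<in> {c \<in> X. a \<le> c}. t \<le> c} = {c \<in> X. a \<le> c}" "{c \<in> set l. t \<le> c} = {c \<in> set l. a \<le> c}"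
      using assms(2) by auto
    then show ?thesis using assms(1) by (simp add: matchable_def up_def)
  qed
  then show ?thesis using assms by (simp add: matchable_def)
qed

lemma left_match_add_least:
  "matchable X (y # l) \<Longrightarrow> \<forall>x\<in>X. y \<le> x \<Longrightarrow>
    \<exists>u. u \<in> X \<and> u \<notin> lm X l \<and> lm X (y # l) = insert u (lm X l) \<and> (\<forall>x\<in>X. x < u \<longrightarrow> x \<in> lm X l)"
proof (induction l arbitrary: X y)
  case Nil
  obtain b where b: "b \<in> X" "y \<le> b" "\<And>c. c \<in> X \<Longrightarrow> y \<le> c \<Longrightarrow> b \<le> c" "left_match X [y] = b # left_match {c \<in> X. b < c} []"
    by (rule matchable_Cons[OF Nil(1)]) (rule that; assumption)
  then show ?case using Nil(2) by (intro exI[of _ b]) (auto simp: not_le[symmetric])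
next
  case (Cons f l)
  obtain b where b: "b \<in> X" "y \<le> b" "\<And>c. c \<in> X \<Longrightarrow> y \<le> c \<Longrightarrow> b \<le> c"
    "left_match X (y # f # l) = b # left_match {c \<in> X. b < c} (f # l)" "matchable {c \<in> X. b < c} (f # l)"
    by (rule matchable_Cons[OF Cons.prems(1)]) (rule that; assumption)
  define X' where "X' = {c \<in> X. b < c}"
  have X: "X = insert b X'" using b(1,3) Cons.prems(2) by (auto simp: X'_def le_less)
  have m: "matchable X (f # l)" by (rule matchable_tl[OF Cons.prems(1)])
  obtain c where c: "c \<in> X" "f \<le> c" "\<And>d. d \<in> X \<Longrightarrow> f \<le> d \<Longrightarrow> c \<le> d"
    "left_match X (f # l) = c # left_match {d \<in> X. c < d} l"
    by (rule matchable_Cons[OF m]) (rule that; assumption)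
  show ?case
  proof (cases "f \<le> b")
    case True
    then have cb: "c = b" using c(1,3) b(1,3) Cons.prems(2) by (meson le_antisym)
    have "\<forall>x\<in>X'. f \<le> x" using True by (auto simp: X'_def)
    then obtain u where u: "u \<in> X'" "u \<notin> lm X' l" "lm X' (f # l) = insert u (lm X' l)" "\<forall>x\<in>X'. x < u \<longrightarrow> x \<in> lm X' l"
      using Cons.IH[of X' f] b(5) by (auto simp: X'_def)
    have "lm X (f # l) = insert b (lm X' l)" using c(4) cb by (simp add: X'_def)
    moreover have "lm X (y # f # l) = insert b (lm X' (f # l))" using b(4) by (simp add: X'_def)
    moreover have "b < u" "u \<in> X" using u(1) by (auto simp: X'_def)
    moreover have "\<forall>x\<in>X. x < u \<longrightarrow> x \<in> insert b (lm X' l)" using u(4) X by blast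
    ultimately show ?thesis using u(2,3) by (intro exI[of _ u]) auto
  next
    case False
    have "left_match {c \<in> X. Suc b \<le> c} (f # l) = left_match X (f # l)"
      using False m by (intro left_match_restrict[OF m]) (auto simp: matchable_def)
    moreover have "{c \<in> X. Suc b \<le> c} = X'" by (auto simp: X'_def)
    ultimately have e: "lm X (f # l) = lm X' (f # l)" by simp
    have "lm X' (f # l) \<subseteq> X'" using left_match_props[OF b(5)] by (simp add: X'_def)
    then have "b \<notin> lm X (f # l)" using e by (auto simp: X'_def)
    moreover have "lm X (y # f # l) = insert b (lm X (f # l))" using b(4) e by (simp add: X'_def)
    moreover have "\<forall>x\<in>X. b \<le> x" using b(3) Cons.prems(2) by simp
    ultimately show ?thesis using b(1) by (intro exI[of _ b]) (simp add: not_less[symmetric])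
  qed
qed

text \<open>Discarding the letters of \<open>X\<close> below \<open>a\<close> does not change the
  matchings and puts \<open>left_match_add_least\<close> in force.\<close>

lemma left_match_restrict_head:
  assumes "matchable X (a # l)" "sorted_wrt (<) g" "set g \<subseteq> set l" "matchable X g"
  obtains u where "u \<in> X" "a \<le> u" "u \<notin> lm X g" "lm X (a # g) = insert u (lm X g)"
    "\<forall>x\<in>X. a \<le> x \<longrightarrow> x < u \<longrightarrow> x \<in> lm X g"
proof -
  have s: "sorted_wrt (<) (a # g)" "\<forall>x\<in>set (a # g). a \<le> x" using assms by (auto simp: matchable_def less_imp_le)
  have "up (set (a # g)) t \<le> up (set (a # l)) t" for t using assms(3) by (intro up_mono) auto
  then have m: "matchable X (a # g)" using assms(1) s unfolding matchable_def by (meson order_trans)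
  define X0 where "X0 = {c \<in> X. a \<le> c}"
  have "matchable X0 (a # g)" unfolding X0_def by (rule matchable_restrict[OF m s(2)])
  moreover have "\<forall>x\<in>X0. a \<le> x" by (simp add: X0_def)
  ultimately obtain u where "u \<in> X0 \<and> u \<notin> lm X0 g \<and> lm X0 (a # g) = insert u (lm X0 g) \<and> (\<forall>x\<in>X0. x < u \<longrightarrow> x \<in> lm X0 g)"
    using left_match_add_least[of X0 a g] by blast
  moreover have "left_match X0 g = left_match X g" "left_match X0 (a # g) = left_match X (a # g)"
    unfolding X0_def using left_match_restrict[OF assms(4)] left_match_restrict[OF m] s(2) by auto
  ultimately have "u \<in> X0" "u \<notin> lm X g" "lm X (a # g) = insert u (lm X g)" "\<forall>x\<in>X0. x < u \<longrightarrow> x \<in> lm X g"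
    by simp_all
  then show ?thesis using that[of u] by (simp add: X0_def)
qed

lemma matchable_subset:
  assumes "matchable X l" "sorted_wrt (<) g" "set g \<subseteq> set l"
  shows "matchable X g"
  using assms up_mono[of "set l" "set g"] unfolding matchable_def by (auto intro: order_trans)

text \<open>If \<open>a\<close> is missing from \<open>g\<close>, adding it only enlarges the image,
  so both lists may be assumed to start with the same greedy choice.\<close>

lemma left_match_nested:
  "matchable X l \<Longrightarrow> sorted_wrt (<) g \<Longrightarrow> set g \<subseteq> set l \<Longrightarrow> lm X g \<subseteq> lm X l"
proof (induction l arbitrary: X g)
  case (Cons a l)
  obtain b where b: "b = Min {c \<in> X. a \<le> c}" "left_match X (a # l) = b # left_match {c \<in> X. b < c} l" "matchable {c \<in> X. b < c} l"
    by (rule matchable_Cons[OF Cons.prems(1)]) (rule that; assumption)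
  have al: "\<forall>x\<in>set l. a < x" using Cons.prems(1) by (simp add: matchable_def)
  have e: "left_match X (a # g') = b # left_match {c \<in> X. b < c} g'" for g' using b(1) by (simp add: Let_def left_match.simps(2))
  show ?case
  proof (cases "a \<in> set g")
    case True
    then obtain g' where g: "g = a # g'" using Cons.prems(2,3) al by (cases g) fastforce+
    then have "set g' \<subseteq> set l" "sorted_wrt (<) g'" using Cons.prems(2,3) by auto
    then show ?thesis using Cons.IH[OF b(3)] b(2) e[of g'] g by auto
  next
    case False
    then have gl: "set g \<subseteq> set l" using Cons.prems(3) by auto
    obtain u where "lm X (a # g) = insert u (lm X g)"
      using left_match_restrict_head[OF Cons.prems(1,2) gl matchable_subset[OF Cons.prems]] by metis
    then have "lm X g \<subseteq> lm X (a # g)" by auto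
    then show ?thesis using Cons.IH[OF b(3) Cons.prems(2) gl] b(2) e[of g] by auto
  qed
qed simp

text \<open>Hypothesis and conclusion have the same shape: the added letter is the least one missing
  from the smaller set. This is what permits iteration over the columns in
  \<open>tri_add\<close>.\<close>

lemma left_match_add:
  "matchable X l \<Longrightarrow> sorted_wrt (<) g \<Longrightarrow> set g \<subseteq> set l \<Longrightarrow> v \<in> set l \<Longrightarrow> v \<notin> set g \<Longrightarrow>
    \<forall>e\<in>set l. e < v \<longrightarrow> e \<in> set g \<Longrightarrow>
    \<exists>u. u \<in> lm X l \<and> u \<notin> lm X g \<and> lm X (asc (insert v (set g))) = insert u (lm X g) \<and>
      (\<forall>x\<in>lm X l. x < u \<longrightarrow> x \<in> lm X g)"
proof (induction l arbitrary: X g)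
  case (Cons a l)
  obtain b where b: "b = Min {c \<in> X. a \<le> c}" "left_match X (a # l) = b # left_match {c \<in> X. b < c} l" "matchable {c \<in> X. b < c} l"
    by (rule matchable_Cons[OF Cons.prems(1)]) (rule that; assumption)
  have al: "\<forall>x\<in>set l. a < x" using Cons.prems(1) by (simp add: matchable_def)
  have e: "left_match X (a # g') = b # left_match {c \<in> X. b < c} g'" for g' using b(1) by (simp add: Let_def left_match.simps(2))
  show ?case
  proof (cases "a \<in> set g")
    case True
    then obtain g' where g: "g = a # g'" using Cons.prems(2,3) al by (cases g) fastforce+
    have g': "set g' \<subseteq> set l" "sorted_wrt (<) g'" "v \<in> set l" "v \<notin> set g'" "\<forall>e\<in>set l. e < v \<longrightarrow> e \<in> set g'"
      using Cons.prems g al by auto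
    define X' where "X' = {c \<in> X. b < c}"
    obtain u where u: "u \<in> lm X' l" "u \<notin> lm X' g'" "lm X' (asc (insert v (set g'))) = insert u (lm X' g')"
      "\<forall>x\<in>lm X' l. x < u \<longrightarrow> x \<in> lm X' g'"
      using Cons.IH[OF b(3) g'(2,1,3,4,5)] by (auto simp: X'_def)
    have "lm X' l \<subseteq> X'" using left_match_props[OF b(3)] by (simp add: X'_def)
    then have "u \<noteq> b" using u(1) by (auto simp: X'_def)
    have "asc (insert v (set g)) = a # asc (insert v (set g'))"
    proof -
      have "insert v (set g) = insert a (insert v (set g'))" using g by auto
      moreover have "\<forall>z\<in>insert v (set g'). a < z" using g' al by auto
      ultimately show ?thesis using asc_insert_less[of "insert v (set g')" a] by simp
    qed
    then have "lm X (asc (insert v (set g))) = insert b (insert u (lm X' g'))" using e u(3) by (simp add: X'_def)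
    moreover have "lm X g = insert b (lm X' g')" "lm X (a # l) = insert b (lm X' l)"
      using g e b(2) by (simp_all add: X'_def)
    ultimately show ?thesis using u \<open>u \<noteq> b\<close> by (intro exI[of _ u]) auto
  next
    case False
    then have gl: "set g \<subseteq> set l" using Cons.prems(3) by auto
    have va: "v = a" using Cons.prems(4,6) al False by auto
    have as: "asc (insert v (set g)) = a # g"
      using va gl al Cons.prems(2) by (intro asc_unique) auto
    obtain u where u: "a \<le> u" "u \<notin> lm X g" "lm X (a # g) = insert u (lm X g)"
      "\<forall>x\<in>X. a \<le> x \<longrightarrow> x < u \<longrightarrow> x \<in> lm X g"
      using left_match_restrict_head[OF Cons.prems(1,2) gl matchable_subset[OF Cons.prems(1-3)]] by metis
    have ge: "\<forall>x\<in>set (a # l). a \<le> x" using al by (auto simp: less_imp_le)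
    have "lm X (a # l) \<subseteq> {c \<in> X. a \<le> c}"
      using left_match_restrict[OF Cons.prems(1) ge] left_match_props[OF matchable_restrict[OF Cons.prems(1) ge]] by simp
    moreover have "lm X (a # g) \<subseteq> lm X (a # l)"
      using gl al Cons.prems(2) by (intro left_match_nested[OF Cons.prems(1)]) auto
    ultimately show ?thesis using u as by (intro exI[of _ u]) auto
  qed
qed simp

lemma left_match_insert_small:
  assumes "matchable X l" "\<forall>x\<in>set l. y < x"
  shows "left_match (insert y X) l = left_match X l"
proof (cases l)
  case (Cons a l')
  obtain b where b: "b = Min {c \<in> X. a \<le> c}" "a \<le> b"
    by (rule matchable_Cons[OF assms(1)[unfolded Cons]]) (rule that; assumption)
  have "{c \<in> insert y X. a \<le> c} = {c \<in> X. a \<le> c}" "{c \<in> insert y X. b < c} = {c \<in> X. b < c}"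
    using assms(2) b(2) Cons by auto
  then show ?thesis using Cons b(1) by (simp add: Let_def left_match.simps(2))
qed simp

subsection \<open>The columns of the left key under adding a box\<close>

fun WTab :: "nat set list \<Rightarrow> bool" where
  "WTab [] = True"
| "WTab (C # T) = (finite C \<and> C \<noteq> {} \<and> 0 \<notin> C \<and> wdom C (fcol T) \<and> WTab T)"

abbreviation tri :: "nat set list \<Rightarrow> nat set \<Rightarrow> nat set" where
  "tri Cs F \<equiv> foldr column_tri Cs F"

lemma columns_tri_foldr: "columns_tri (Cs @ [F]) = tri Cs F"
proof (induction Cs)
  case (Cons C Cs)
  then show ?case by (cases "Cs @ [F]") auto
qed simp

definition Chain :: "nat set list \<Rightarrow> bool" where
  "Chain Cs \<longleftrightarrow> (\<forall>C\<in>set Cs. finite C) \<and> successively wdom Cs"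

lemma matchable_asc: "finite X \<Longrightarrow> finite F \<Longrightarrow> wdom X F \<Longrightarrow> matchable X (asc F)"
  by (simp add: matchable_def wdom_def)

lemma wdom_subset: "finite F \<Longrightarrow> wdom X F \<Longrightarrow> G \<subseteq> F \<Longrightarrow> wdom X G"
  unfolding wdom_def using up_mono[of F G] by (meson order_trans)

lemma column_tri_props:
  assumes "finite X" "finite F" "wdom X F"
  shows "column_tri X F \<subseteq> X" "card (column_tri X F) = card F" "finite (column_tri X F)"
  using left_match_props[OF matchable_asc[OF assms]] by (simp_all add: column_tri_def)

lemma tri_subset:
  "Chain (Cs @ [L]) \<Longrightarrow> G \<subseteq> L \<Longrightarrow> tri Cs G \<subseteq> (case Cs of [] \<Rightarrow> G | C # _ \<Rightarrow> C) \<and> card (tri Cs G) = card G \<and> finite (tri Cs G)"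
proof (induction Cs)
  case Nil
  then show ?case by (auto simp: Chain_def intro: finite_subset)
next
  case (Cons C Cs)
  have IH: "tri Cs G \<subseteq> hd (Cs @ [L])" "card (tri Cs G) = card G" "finite (tri Cs G)"
    using Cons by (auto simp: Chain_def successively_Cons split: list.splits)
  have f: "finite (hd (Cs @ [L]))" "finite C" "wdom C (hd (Cs @ [L]))"
    using Cons.prems(1) by (auto simp: Chain_def successively_Cons hd_append)
  then have "wdom C (tri Cs G)" using IH(1) wdom_subset by blast
  then show ?case using column_tri_props[OF f(2) IH(3)] IH(2) by simp
qed

lemma tri_wdom:
  assumes "Chain (C # Cs @ [L])" "G \<subseteq> L"
  shows "wdom C (tri Cs G)"
proof -
  have "tri Cs G \<subseteq> hd (Cs @ [L])" "finite (hd (Cs @ [L]))" "wdom C (hd (Cs @ [L]))"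
    using tri_subset[of Cs L G] assms by (auto simp: Chain_def successively_Cons hd_append split: list.splits)
  then show ?thesis using wdom_subset by blast
qed

text \<open>Each column turns the least letter of the larger set that is missing from the smaller
  one into such a letter again, by \<open>left_match_add\<close>.\<close>

lemma tri_add:
  "Chain (Cs @ [L]) \<Longrightarrow> G \<subseteq> L \<Longrightarrow> v \<in> L \<Longrightarrow> v \<notin> G \<Longrightarrow> \<forall>e\<in>L. e < v \<longrightarrow> e \<in> G \<Longrightarrow>
    tri Cs G \<subseteq> tri Cs L \<and> (\<exists>u. u \<in> tri Cs L \<and> u \<notin> tri Cs G \<and> tri Cs (insert v G) = insert u (tri Cs G) \<and>
      (\<forall>x\<in>tri Cs L. x < u \<longrightarrow> x \<in> tri Cs G))"
proof (induction Cs)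
  case (Cons C Cs)
  have ch: "Chain (Cs @ [L])" using Cons.prems(1) by (auto simp: Chain_def successively_Cons)
  obtain u where u: "tri Cs G \<subseteq> tri Cs L" "u \<in> tri Cs L" "u \<notin> tri Cs G" "tri Cs (insert v G) = insert u (tri Cs G)"
      "\<forall>x\<in>tri Cs L. x < u \<longrightarrow> x \<in> tri Cs G"
    using Cons.IH[OF ch Cons.prems(2-5)] by blast
  have f: "finite (tri Cs L)" "finite (tri Cs G)" using tri_subset[OF ch, of L] tri_subset[OF ch Cons.prems(2)] by auto
  have m: "matchable C (asc (tri Cs L))"
    using tri_wdom[of C Cs L L] Cons.prems(1) f by (intro matchable_asc) (auto simp: Chain_def)
  have "lm C (asc (tri Cs G)) \<subseteq> lm C (asc (tri Cs L))"
    using left_match_nested[OF m, of "asc (tri Cs G)"] f u(1) by simp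
  moreover have "\<exists>u'. u' \<in> lm C (asc (tri Cs L)) \<and> u' \<notin> lm C (asc (tri Cs G)) \<and>
      lm C (asc (insert u (tri Cs G))) = insert u' (lm C (asc (tri Cs G))) \<and>
      (\<forall>x\<in>lm C (asc (tri Cs L)). x < u' \<longrightarrow> x \<in> lm C (asc (tri Cs G)))"
    using left_match_add[OF m, of "asc (tri Cs G)" u] f u by simp
  moreover have "tri (C # Cs) A = lm C (asc (tri Cs A))" for A by (simp add: column_tri_def)
  ultimately show ?case using u(4) by presburger
qed auto

lemma column_tri_add:
  assumes "finite L" "finite F" "wdom L (insert y F)" "\<forall>x\<in>L. y \<le> x" "\<forall>x\<in>F. y < x"
  shows "\<exists>v. v \<in> L \<and> v \<notin> column_tri L F \<and> column_tri L (insert y F) = insert v (column_tri L F) \<and>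
    (\<forall>e\<in>L. e < v \<longrightarrow> e \<in> column_tri L F)"
proof -
  have "asc (insert y F) = y # asc F" using assms by (intro asc_insert_less)
  moreover have "matchable L (asc (insert y F))" using assms by (intro matchable_asc) auto
  ultimately show ?thesis using left_match_add_least[of L y "asc F"] assms(4)
    by (simp add: column_tri_def del: sorted_list_of_set_insert_remove)
qed

subsection \<open>Adding a box to the recording tableau\<close>

definition add_box :: "nat \<Rightarrow> nat \<Rightarrow> nat set list \<Rightarrow> nat set list" where
  "add_box k y Q = (if k < length Q then Q[k := insert y (Q ! k)] else Q @ [{y}])"

definition left_key :: "nat set list \<Rightarrow> nat \<Rightarrow> nat set" where
  "left_key Q j = tri (take j Q) (col Q j)"

lemma col_add_box: "k \<le> length Q \<Longrightarrow> col (add_box k y Q) j = (if j = k then insert y (col Q j) else col Q j)"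
  by (auto simp: add_box_def col_def nth_append nth_list_update)

lemma WTab_col: "WTab Q \<longleftrightarrow> (\<forall>C\<in>set Q. finite C \<and> C \<noteq> {} \<and> 0 \<notin> C) \<and> (\<forall>j. wdom (col Q j) (col Q (Suc j)))"
proof (induction Q)
  case (Cons C Q)
  have "(\<forall>j. wdom (col (C # Q) j) (col (C # Q) (Suc j))) \<longleftrightarrow>
      wdom C (fcol Q) \<and> (\<forall>j. wdom (col Q j) (col Q (Suc j)))"
  proof (intro iffI conjI allI)
    fix j assume a: "\<forall>j. wdom (col (C # Q) j) (col (C # Q) (Suc j))"
    show "wdom C (fcol Q)" using a[rule_format, of 0] by (simp add: fcol_col)
    show "wdom (col Q j) (col Q (Suc j))" using a[rule_format, of "Suc j"] by simp
  next
    fix j assume "wdom C (fcol Q) \<and> (\<forall>j. wdom (col Q j) (col Q (Suc j)))"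
    then show "wdom (col (C # Q) j) (col (C # Q) (Suc j))" by (cases j) (auto simp: fcol_col)
  qed
  then show ?case using Cons.IH by auto
qed simp

lemma WTab_mem: "WTab Q \<Longrightarrow> C \<in> set Q \<Longrightarrow> finite C \<and> C \<noteq> {} \<and> 0 \<notin> C"
  by (simp add: WTab_col)

lemma finite_colQ: "WTab Q \<Longrightarrow> finite (col Q j)"
  using WTab_mem[of Q "Q ! j"] by (auto simp: col_def)

lemma WTab_add_box:
  assumes "WTab Q" "k \<le> length Q" "0 < y" "\<And>j. \<forall>z\<in>col Q j. y \<le> z" "\<forall>z\<in>col Q k. y < z"
    "0 < k \<Longrightarrow> card (col Q k) < card (col Q (k - 1))"
  shows "WTab (add_box k y Q)"
  unfolding WTab_col
proof (intro conjI allI ballI)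
  fix C assume "C \<in> set (add_box k y Q)"
  then have "C \<in> set Q \<or> C = insert y (col Q k)"
    using set_update_subset_insert[of Q k "insert y (Q ! k)"] by (auto simp: add_box_def col_def split: if_splits)
  then show "finite C" "C \<noteq> {}" "0 \<notin> C"
    using WTab_mem[OF assms(1)] finite_colQ[OF assms(1), of k] assms(3,5) by auto
next
  fix j
  have w: "wdom (col Q j) (col Q (Suc j))" using assms(1) by (simp add: WTab_col)
  have f: "finite (col Q i)" for i by (rule finite_colQ[OF assms(1)])
  consider "Suc j = k" | "j = k" | "j \<noteq> k" "Suc j \<noteq> k" by blast
  then show "wdom (col (add_box k y Q) j) (col (add_box k y Q) (Suc j))"
  proof cases
    case 1
    \<comment> \<open>Up to \<open>y\<close> all letters of the left column are counted, so only the
      column lengths matter; beyond \<open>y\<close> the new letter is not counted.\<close>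
    have "up (insert y (col Q k)) t \<le> up (col Q j) t" for t
    proof (cases "t \<le> y")
      case True
      then have "{c \<in> col Q j. t \<le> c} = col Q j" using assms(4)[of j] by auto
      then have "up (col Q j) t = card (col Q j)" by (simp add: up_def)
      moreover have "up (insert y (col Q k)) t \<le> Suc (card (col Q k))"
        using up_le_card[of "insert y (col Q k)" t] card_insert_le_m1 f by (auto simp: card_insert_if split: if_splits)
      ultimately show ?thesis using assms(6) 1 by auto
    next
      case False
      then have "{c \<in> insert y (col Q k). t \<le> c} = {c \<in> col Q k. t \<le> c}" by auto
      then have "up (insert y (col Q k)) t = up (col Q k) t" by (simp add: up_def)
      then show ?thesis using w 1 by (simp add: wdom_def)
    qed
    then show ?thesis using 1 assms(2) by (auto simp: col_add_box wdom_def)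
  next
    case 2
    have "up (col Q k) t \<le> up (insert y (col Q k)) t" for t using f by (intro up_mono) auto
    then show ?thesis using w 2 assms(2) unfolding wdom_def by (auto simp: col_add_box intro: order_trans)
  next
    case 3
    then show ?thesis using w assms(2) by (simp add: col_add_box)
  qed
qed

lemma hd_take_col: "hd (take j Q @ [col Q j]) = fcol Q"
  by (cases Q; cases j) auto

lemma Chain_take: "WTab Q \<Longrightarrow> Chain (take j Q @ [col Q j])"
proof (induction Q arbitrary: j)
  case (Cons C Q)
  show ?case
  proof (cases j)
    case (Suc i)
    have "Chain (take i Q @ [col Q i])" "wdom C (hd (take i Q @ [col Q i]))"
      using Cons by (simp_all add: hd_take_col)
    then show ?thesis using Cons.prems Suc by (simp add: Chain_def successively_Cons)
  qed (use Cons in \<open>simp add: Chain_def\<close>)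
qed (simp add: Chain_def)

lemma card_left_key: "WTab Q \<Longrightarrow> card (left_key Q j) = card (col Q j)"
  and finite_left_key: "WTab Q \<Longrightarrow> finite (left_key Q j)"
  using tri_subset[of "take j Q" "col Q j" "col Q j"] Chain_take[of Q j] by (simp_all add: left_key_def)

lemma tri_mono:
  "Chain (Cs @ [L]) \<Longrightarrow> G \<subseteq> L \<Longrightarrow> tri Cs G \<subseteq> tri Cs L"
proof (induction Cs)
  case (Cons C Cs)
  have ch: "Chain (Cs @ [L])" using Cons.prems(1) by (auto simp: Chain_def successively_Cons)
  have f: "finite (tri Cs L)" "finite (tri Cs G)" using tri_subset[OF ch, of L] tri_subset[OF ch Cons.prems(2)] by auto
  have m: "matchable C (asc (tri Cs L))"
    using tri_wdom[of C Cs L L] Cons.prems(1) f by (intro matchable_asc) (auto simp: Chain_def)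
  have "lm C (asc (tri Cs G)) \<subseteq> lm C (asc (tri Cs L))"
    using left_match_nested[OF m, of "asc (tri Cs G)"] f Cons.IH[OF ch Cons.prems(2)] by simp
  then show ?case by (simp add: column_tri_def[of C])
qed simp

lemma tri_empty: "tri Cs {} = {}"
proof (induction Cs)
  case (Cons C Cs)
  then show ?case by (simp add: column_tri_def[of C "{}"])
qed simp

lemma left_key_Suc:
  assumes "j < length Q"
  shows "left_key Q (Suc j) = tri (take j Q) (column_tri (col Q j) (col Q (Suc j)))"
  using assms by (simp add: left_key_def take_Suc_conv_app_nth col_def)

lemma left_key_nested: "WTab Q \<Longrightarrow> left_key Q (Suc j) \<subseteq> left_key Q j"
proof (cases "j < length Q")
  case True
  assume Q: "WTab Q"
  have "column_tri (col Q j) (col Q (Suc j)) \<subseteq> col Q j"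
    using Q finite_colQ by (intro column_tri_props) (auto simp: WTab_col)
  then show ?thesis using tri_mono[OF Chain_take[OF Q]] left_key_Suc[OF True] by (simp add: left_key_def)
qed (simp add: left_key_def col_def tri_empty)

text \<open>Whatever is matched into column \<open>k\<close> comes from the column to its right,
  whose letters exceed \<open>y\<close>; so \<open>y\<close> is never chosen.\<close>

lemma tri_add_box_right:
  "WTab Q \<Longrightarrow> k < j \<Longrightarrow> k < length Q \<Longrightarrow> (\<And>i. k < i \<Longrightarrow> \<forall>z\<in>col Q i. y < z) \<Longrightarrow>
    tri (take j (add_box k y Q)) (col Q j) = tri (take j Q) (col Q j)"
proof (induction Q arbitrary: k j)
  case (Cons C Q)
  obtain i where j: "j = Suc i" using Cons.prems(2) by (cases j) auto
  show ?case
  proof (cases k)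
    case 0
    define G where "G = tri (take i Q) (col Q i)"
    have ch: "Chain (take i Q @ [col Q i])" using Cons.prems(1) by (intro Chain_take) simp
    have "G \<subseteq> fcol Q" using tri_subset[OF ch, of "col Q i"]
      by (cases Q; cases i) (auto simp: G_def tri_empty)
    moreover have "\<forall>z\<in>fcol Q. y < z" using Cons.prems(4)[of 1] 0 by (simp add: fcol_col)
    ultimately have y: "\<forall>z\<in>G. y < z" by blast
    have f: "finite G" "finite C" using tri_subset[OF ch, of "col Q i"] Cons.prems(1) by (auto simp: G_def)
    have "wdom C G" using wdom_subset[OF _ _ \<open>G \<subseteq> fcol Q\<close>] Cons.prems(1) by (cases Q) auto
    then have "left_match (insert y C) (asc G) = left_match C (asc G)"
      using f y by (intro left_match_insert_small matchable_asc) auto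
    then show ?thesis using j 0 by (simp add: add_box_def G_def column_tri_def[of C] column_tri_def[of "insert y C"])
  next
    case (Suc k')
    have p: "\<forall>z\<in>col Q i. y < z" if "k' < i" for i using Cons.prems(4)[of "Suc i"] that Suc by simp
    have "add_box k y (C # Q) = C # add_box k' y Q" using Suc by (simp add: add_box_def)
    moreover have "tri (take i (add_box k' y Q)) (col Q i) = tri (take i Q) (col Q i)"
      using Cons.IH[of k' i] p Cons.prems Suc j by simp
    ultimately show ?thesis using j by simp
  qed
qed simp

text \<open>For \<open>k = Suc i\<close> the letter \<open>y\<close> is smaller than column
  \<open>k\<close> and at most every letter of column \<open>i\<close>, so the first matching gains
  the least letter of column \<open>i\<close> still missing (\<open>column_tri_add\<close>).
  \<open>tri_add\<close> carries this to the left end.\<close>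

lemma left_key_add_box:
  assumes "WTab Q" "WTab (add_box k y Q)" "k \<le> length Q" "\<And>j. \<forall>z\<in>col Q j. y \<le> z" "\<And>j. k \<le> j \<Longrightarrow> \<forall>z\<in>col Q j. y < z"
  shows "j \<noteq> k \<Longrightarrow> left_key (add_box k y Q) j = left_key Q j"
    and "k = 0 \<Longrightarrow> y \<notin> left_key Q 0 \<and> left_key (add_box k y Q) 0 = insert y (left_key Q 0)"
    and "k = Suc i \<Longrightarrow> \<exists>u. u \<in> left_key Q i \<and> u \<notin> left_key Q k \<and> left_key (add_box k y Q) k = insert u (left_key Q k) \<and>
      (\<forall>x\<in>left_key Q i. x < u \<longrightarrow> x \<in> left_key Q k)"
proof -
  have c: "col (add_box k y Q) j = (if j = k then insert y (col Q j) else col Q j)" for j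
    by (rule col_add_box[OF assms(3)])
  have tk: "take k (add_box k y Q) = take k Q" using assms(3) by (auto simp: add_box_def)
  {
    assume jk: "j \<noteq> k"
    show "left_key (add_box k y Q) j = left_key Q j"
    proof (cases "k < j")
      case True
      show ?thesis
      proof (cases "k < length Q")
        case T2: True
        then show ?thesis using tri_add_box_right[OF assms(1) True T2 assms(5)[OF less_imp_le]] jk c by (simp add: left_key_def)
      next
        case False
        then have "col Q j = {}" using assms(3) True by (simp add: col_def)
        then show ?thesis using c jk by (simp add: left_key_def tri_empty)
      qed
    next
      case False
      then have "take j (add_box k y Q) = take j Q" using jk assms(3) by (auto simp: add_box_def)
      then show ?thesis using c jk by (simp add: left_key_def)
    qed
  next
    assume "k = 0"
    then show "y \<notin> left_key Q 0 \<and> left_key (add_box k y Q) 0 = insert y (left_key Q 0)"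
      using c[of 0] assms(5)[of 0] by (auto simp: left_key_def)
  next
    assume k: "k = Suc i"
    then have i: "i < length Q" using assms(3) by simp
    define L F where "L = col Q i" and "F = col Q k"
    have f: "finite L" "finite F" using finite_colQ[OF assms(1)] by (simp_all add: L_def F_def)
    have w: "wdom L (insert y F)" using assms(2) k c[of i] c[of k] unfolding WTab_col L_def F_def
      by (metis n_not_Suc_n)
    obtain v where v: "v \<in> L" "v \<notin> column_tri L F" "column_tri L (insert y F) = insert v (column_tri L F)"
        "\<forall>e\<in>L. e < v \<longrightarrow> e \<in> column_tri L F"
      using column_tri_add[OF f w] assms(4)[of i] assms(5)[of k] by (auto simp: L_def F_def)
    have "wdom L F" using wdom_subset[OF _ w, of F] f by auto
    then have sub: "column_tri L F \<subseteq> L" using f by (intro column_tri_props)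
    have ch: "Chain (take i Q @ [L])" using Chain_take[OF assms(1)] by (simp add: L_def)
    obtain u where u: "u \<in> tri (take i Q) L" "u \<notin> tri (take i Q) (column_tri L F)"
        "tri (take i Q) (insert v (column_tri L F)) = insert u (tri (take i Q) (column_tri L F))"
        "\<forall>x\<in>tri (take i Q) L. x < u \<longrightarrow> x \<in> tri (take i Q) (column_tri L F)"
      using tri_add[OF ch sub v(1,2,4)] by blast
    have 1: "tri (take i Q) L = left_key Q i" by (simp add: left_key_def L_def)
    have 2: "tri (take i Q) (column_tri L F) = left_key Q k" using left_key_Suc[OF i] k by (simp add: L_def F_def)
    have "take k (add_box k y Q) = take i Q @ [L]" using tk k i by (simp add: take_Suc_conv_app_nth L_def col_def)
    then have "left_key (add_box k y Q) k = tri (take i Q) (column_tri L (insert y F))"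
      using c[of k] by (simp add: left_key_def F_def)
    then have "left_key (add_box k y Q) k = insert u (left_key Q k)" using v(3) u(3) 2 by simp
    then show "\<exists>u. u \<in> left_key Q i \<and> u \<notin> left_key Q k \<and> left_key (add_box k y Q) k = insert u (left_key Q k) \<and>
      (\<forall>x\<in>left_key Q i. x < u \<longrightarrow> x \<in> left_key Q k)" using u(1,2,4) unfolding 1 2 by blast
  }
qed

subsection \<open>Comparing the keys\<close>

definition low :: "nat set \<Rightarrow> nat \<Rightarrow> nat" where
  "low S t = card {x \<in> S. x < t}"

lemma up_low: "finite S \<Longrightarrow> up S t + low S t = card S"
proof -
  assume "finite S"
  then have "card ({x \<in> S. t \<le> x} \<union> {x \<in> S. x < t}) = up S t + low S t"
    unfolding up_def low_def by (intro card_Un_disjoint) auto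
  moreover have "{x \<in> S. t \<le> x} \<union> {x \<in> S. x < t} = S" by auto
  ultimately show ?thesis by simp
qed

text \<open>For sets of equal size, counts from below compare in the opposite direction. They suit
  the added key letters, which are described by what lies below them.\<close>

lemma wdom_low:
  assumes "finite A" "finite B" "card A = card B"
  shows "wdom A B \<longleftrightarrow> (\<forall>t. low A t \<le> low B t)"
proof -
  have "up B t \<le> up A t \<longleftrightarrow> low A t \<le> low B t" for t
    using up_low[OF assms(1), of t] up_low[OF assms(2), of t] assms(3) by linarith
  then show ?thesis by (simp add: wdom_def)
qed

lemma low_mono: "finite A \<Longrightarrow> B \<subseteq> A \<Longrightarrow> low B t \<le> low A t"
  unfolding low_def by (rule card_mono) auto

lemma low_insert: "finite A \<Longrightarrow> x \<notin> A \<Longrightarrow> low (insert x A) t = low A t + (if x < t then 1 else 0)"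
proof -
  assume a: "finite A" "x \<notin> A"
  have "{c \<in> insert x A. c < t} = (if x < t then insert x {c \<in> A. c < t} else {c \<in> A. c < t})"
    by auto
  then show ?thesis using a by (simp add: low_def)
qed

lemma low_below: "B \<subseteq> A \<Longrightarrow> \<forall>x\<in>A. x < u \<longrightarrow> x \<in> B \<Longrightarrow> t \<le> u \<Longrightarrow> low B t = low A t"
  unfolding low_def by (rule arg_cong[where f = card]) auto

text \<open>In both directions the letter added to a key column is pinned down by a neighbouring column: on the
  left key side it is the least letter missing from the column to the left, on the right key side the
  least letter missing from the column to the right.\<close>

lemma keys_step:
  assumes x: "insertable x T" and k: "k = new_col x T"
    and Q: "WTab Q" "WTab (add_box k y Q)" "\<And>j. \<forall>z\<in>col Q j. y \<le> z" "\<And>j. k \<le> j \<Longrightarrow> \<forall>z\<in>col Q j. y < z"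
    and sh: "\<And>j. card (col T j) = card (col Q j)" "k \<le> length Q"
  shows "(\<forall>j. wdom (right_key (ins x T) j) (left_key (add_box k y Q) j)) \<longleftrightarrow> (\<forall>j. wdom (right_key T j) (left_key Q j)) \<and> y \<le> x"
proof -
  define A B A' B' where "A = right_key T" and "B = right_key (ins x T)" and "A' = left_key Q" and "B' = left_key (add_box k y Q)"
  have T: "Tab T" "Tab (ins x T)" using x Tab_ins by (auto simp: insertable_def)
  have fin: "finite (A j)" "finite (B j)" "finite (A' j)" "finite (B' j)" for j
    using finite_left_key Q by (auto simp: A_def B_def A'_def B'_def)
  have cA: "card (A j) = card (A' j)" for j
    using card_right_key[OF T(1)] card_left_key[OF Q(1)] sh(1) by (simp add: A_def A'_def)
  have AB: "B j = A j" "B' j = A' j" if "j \<noteq> k" for j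
    using right_key_ins(1)[OF x k that] left_key_add_box(1)[OF Q(1,2) sh(2) Q(3,4) that] by (simp_all add: A_def B_def A'_def B'_def)
  obtain z where z: "z \<notin> A k" "B k = insert z (A k)" "\<forall>s\<in>B k. s < z \<longrightarrow> s \<in> A (Suc k)"
    using right_key_ins(2)[OF x k] by (auto simp: A_def B_def)
  have nest: "A (Suc j) \<subseteq> A j" "B (Suc j) \<subseteq> B j" "A' (Suc j) \<subseteq> A' j" "B' (Suc j) \<subseteq> B' j" for j
    using right_key_nested[OF T(1)] right_key_nested[OF T(2)] left_key_nested[OF Q(1)] left_key_nested[OF Q(2)]
    by (simp_all add: A_def B_def A'_def B'_def)
  obtain u where u: "u \<notin> A' k" "B' k = insert u (A' k)" "k = 0 \<Longrightarrow> u = y"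
    "\<And>i. k = Suc i \<Longrightarrow> u \<in> A' i \<and> (\<forall>s\<in>A' i. s < u \<longrightarrow> s \<in> A' k)"
  proof (cases k)
    case 0
    then show ?thesis using that[of y] left_key_add_box(2)[OF Q(1,2) sh(2) Q(3,4)] by (simp add: A'_def B'_def)
  next
    case (Suc i)
    then show ?thesis using that left_key_add_box(3)[OF Q(1,2) sh(2) Q(3,4) Suc] by (auto simp: A'_def B'_def)
  qed
  have cB: "card (B j) = card (B' j)" for j
    using AB[of j] cA[of j] z(1,2) u(1,2) fin by (cases "j = k") simp_all
  have y0: "\<forall>s\<in>B' 0. y \<le> s" "\<forall>s\<in>A' 0. y \<le> s"
    using Q(3)[of 0] col_add_box[OF sh(2), of y 0] by (auto simp: A'_def B'_def left_key_def)
  have wA: "wdom (A j) (A' j) \<longleftrightarrow> (\<forall>t. low (A j) t \<le> low (A' j) t)"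
    and wB: "wdom (B j) (B' j) \<longleftrightarrow> (\<forall>t. low (B j) t \<le> low (B' j) t)" for j
    using wdom_low fin cA cB by auto
  have lb: "(\<forall>s\<in>B 0. y \<le> s) \<longleftrightarrow> y \<le> x \<and> (\<forall>s\<in>A 0. y \<le> s)"
    using right_key_0_lower_bound[OF x] by (simp add: A_def B_def)
  have lb_low: "(\<forall>s\<in>S. y \<le> s) \<longleftrightarrow> low S y = 0" if "finite S" for S
    using that by (auto simp: low_def card_eq_0_iff not_less)
  have lB: "low (B k) t = low (A k) t + (if z < t then 1 else 0)"
    and lB': "low (B' k) t = low (A' k) t + (if u < t then 1 else 0)" for t
    using low_insert[OF fin(1) z(1)] low_insert[OF fin(3) u(1)] z(2) u(2) by simp_all
  have "(\<forall>j. \<forall>t. low (B j) t \<le> low (B' j) t) \<longleftrightarrow> (\<forall>j. \<forall>t. low (A j) t \<le> low (A' j) t) \<and> y \<le> x"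
  proof (intro iffI conjI allI)
    assume b: "\<forall>j. \<forall>t. low (B j) t \<le> low (B' j) t"
    have "low (B 0) y = 0" using b[rule_format, of 0 y] lb_low[OF fin(4)] y0(1) by simp
    then show "y \<le> x" using lb lb_low[OF fin(2)] by blast
    fix j t
    show "low (A j) t \<le> low (A' j) t"
    proof (cases "j = k")
      case False
      then show ?thesis using b[rule_format, of j t] AB by simp
    next
      case True
      show ?thesis
      proof (cases "t \<le> z")
        case t: True
        have "A (Suc k) \<subseteq> A k" "\<forall>s\<in>A k. s < z \<longrightarrow> s \<in> A (Suc k)" using nest z by auto
        \<comment> \<open>Up to \<open>z\<close>, column \<open>k\<close> of \<open>A\<close> agrees
          with column \<open>k + 1\<close>, where the keys do not change; nesting of the left key
          then leads back to column \<open>k\<close>.\<close>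
        then have "low (A k) t = low (A (Suc k)) t" using t low_below[of "A (Suc k)" "A k" z t] by simp
        also have "\<dots> \<le> low (A' (Suc k)) t" using b[rule_format, of "Suc k" t] AB[of "Suc k"] by simp
        also have "\<dots> \<le> low (A' k) t" using nest fin by (intro low_mono)
        finally show ?thesis using True by simp
      next
        case False
        then show ?thesis using b[rule_format, of k t] lB[of t] lB'[of t] True by (auto split: if_splits)
      qed
    qed
  next
    assume a: "(\<forall>j. \<forall>t. low (A j) t \<le> low (A' j) t) \<and> y \<le> x"
    fix j t
    show "low (B j) t \<le> low (B' j) t"
    proof (cases "j = k")
      case False
      then show ?thesis using a AB by simp
    next
      case True
      show ?thesis
      proof (cases "u < t")
        \<comment> \<open>Beyond \<open>u\<close> the left key count rises by one and the right key
          count by at most one.\<close>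
        case t: True
        then show ?thesis using a[THEN conjunct1, rule_format, of k t] lB[of t] lB'[of t] True by (auto split: if_splits)
      next
        case t: False
        show ?thesis
        proof (cases k)
          case 0
          \<comment> \<open>In the first column the added letter \<open>u\<close> is
            \<open>y\<close>, and \<open>y \<le> x\<close> ensures that nothing in
            \<open>B 0\<close> lies below it.\<close>
          have "low (A 0) y = 0" using a[THEN conjunct1, rule_format, of 0 y] lb_low[OF fin(3)] y0(2) by simp
          then have "\<forall>s\<in>B 0. y \<le> s" using lb a lb_low[OF fin(1)] by blast
          then have e: "{s \<in> B 0. s < t} = {}" using t u(3)[OF 0] by auto
          have "low (B 0) t = 0" unfolding low_def e by simp
          then show ?thesis using True 0 by simp
        next
          case (Suc i)
          \<comment> \<open>Up to \<open>u\<close>, column \<open>k\<close> of \<open>A'\<close>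
            agrees with column \<open>k - 1\<close>, where the keys do not change.\<close>
          have "low (B k) t \<le> low (B i) t" using nest(2)[of i] Suc fin by (intro low_mono) auto
          also have "\<dots> \<le> low (A' i) t" using a[THEN conjunct1, rule_format, of i t] AB(1)[of i] Suc by simp
          also have "\<dots> = low (A' k) t"
            using u(4)[OF Suc] nest(3)[of i] Suc t low_below[of "A' k" "A' i" u t] by simp
          also have "\<dots> \<le> low (B' k) t" using lB'[of t] by simp
          finally show ?thesis using True by simp
        qed
      qed
    qed
  qed
  then show ?thesis using wA wB unfolding A_def B_def A'_def B'_def by simp
qed

subsection \<open>The correspondence on biwords\<close>

definition run :: "(nat \<times> nat) list \<Rightarrow> nat set list \<times> nat set list" where
  "run ps = foldl (\<lambda>(P, Q) (x, y). (ins x P, add_box (new_col x P) y Q)) ([], []) ps"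

lemma run_Nil [simp]: "run [] = ([], [])"
  by (simp add: run_def)

lemma run_snoc: "run ps = (P, Q) \<Longrightarrow> run (ps @ [(x, y)]) = (ins x P, add_box (new_col x P) y Q)"
  by (simp add: run_def)

text \<open>Positivity of the first components is left to reducedness of the word they form.\<close>

definition compat :: "(nat \<times> nat) list \<Rightarrow> bool" where
  "compat ps \<longleftrightarrow> (\<forall>p\<in>set ps. 0 < snd p) \<and> sorted_wrt (\<lambda>p q. snd q \<le> snd p) ps \<and>
     successively (\<lambda>p q. snd p = snd q \<longrightarrow> fst p < fst q) ps"

definition reduced_biword :: "(nat \<times> nat) list \<Rightarrow> bool" where
  "reduced_biword ps \<longleftrightarrow> compat ps \<and> reduced (map fst ps)"

lemma compat_snoc:
  "compat (ps @ [(x, y)]) \<longleftrightarrow> compat ps \<and> 0 < y \<and> (\<forall>p\<in>set ps. y \<le> snd p) \<and>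
     (ps \<noteq> [] \<longrightarrow> snd (last ps) = y \<longrightarrow> fst (last ps) < x)"
  by (auto simp: compat_def sorted_wrt_append successively_append_iff)

lemma reduced_biword_snocD: "reduced_biword (ps @ [p]) \<Longrightarrow> reduced_biword ps"
  using reduced_append1[of "map fst ps"] by (cases p) (auto simp: reduced_biword_def compat_snoc)

definition tab_pair :: "nat set list \<Rightarrow> nat set list \<Rightarrow> bool" where
  "tab_pair P Q \<longleftrightarrow> Tab P \<and> reduced (word_of P) \<and> WTab Q \<and> (\<forall>j. card (col P j) = card (col Q j))"

lemma length_col: "(\<And>C. C \<in> set T \<Longrightarrow> finite C \<and> C \<noteq> {}) \<Longrightarrow> j < length T \<longleftrightarrow> card (col T j) \<noteq> 0"
  by (auto simp: col_def)

lemma tab_pair_length: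
  assumes "tab_pair P Q" shows "length P = length Q"
proof -
  have "j < length P \<longleftrightarrow> j < length Q" for j
    using length_col[of P j] length_col[of Q j] assms Tab_mem WTab_mem unfolding tab_pair_def by metis
  then show ?thesis by (metis linorder_neqE_nat less_irrefl)
qed

text \<open>The box created last lies in the rightmost column containing its record. Combined with
  row bumping, this controls the next letter with the same record.\<close>

definition last_inv :: "(nat \<times> nat) list \<Rightarrow> nat set list \<Rightarrow> bool" where
  "last_inv ps Q \<longleftrightarrow> (\<forall>qs x y. ps = qs @ [(x, y)] \<longrightarrow> insertable x (fst (run qs)) \<and>
     y \<in> col Q (new_col x (fst (run qs))) \<and> (\<forall>j. y \<in> col Q j \<longrightarrow> j \<le> new_col x (fst (run qs))))"

definition run_inv :: "(nat \<times> nat) list \<Rightarrow> bool" where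
  "run_inv ps \<longleftrightarrow> (\<exists>P Q. run ps = (P, Q) \<and> tab_pair P Q \<and> np (rev (map fst ps)) (word_of P) \<and>
     (\<forall>z. (\<exists>j. z \<in> col Q j) \<longleftrightarrow> z \<in> snd ` set ps) \<and> last_inv ps Q)"

lemma run_step:
  assumes inv: "run_inv ps" and c: "reduced_biword (ps @ [(x, y)])" and r: "run ps = (P, Q)"
  defines "k \<equiv> new_col x P"
  shows "insertable x P" "k \<le> length Q" "0 < y" "\<And>j. \<forall>z\<in>col Q j. y \<le> z" "\<And>j. k \<le> j \<Longrightarrow> \<forall>z\<in>col Q j. y < z"
    "WTab (add_box k y Q)"
proof -
  have tab_pair: "tab_pair P Q" and n: "np (rev (map fst ps)) (word_of P)"
    and e: "\<And>z. (\<exists>j. z \<in> col Q j) \<longleftrightarrow> z \<in> snd ` set ps" and l: "last_inv ps Q"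
    using inv r by (auto simp: run_inv_def)
  have cc: "compat ps" "0 < y" "\<forall>p\<in>set ps. y \<le> snd p" "ps \<noteq> [] \<Longrightarrow> snd (last ps) = y \<Longrightarrow> fst (last ps) < x"
    using c by (auto simp: reduced_biword_def compat_snoc)
  have "reduced (rev (map fst (ps @ [(x, y)])))" using c reduced_rev unfolding reduced_biword_def by blast
  then have "reduced (x # word_of P)" using np_Cons[OF n] np_reduced by auto
  then show i: "insertable x P" using tab_pair by (simp add: insertable_def tab_pair_def)
  show kl: "k \<le> length Q" using new_col_le_length[of x P] tab_pair_length[OF tab_pair] by (simp add: k_def)
  show "0 < y" by (rule cc)
  show ge: "\<forall>z\<in>col Q j. y \<le> z" for j using e cc(3) by fastforce
  \<comment> \<open>An entry \<open>y\<close> in a column \<open>j \<ge> k\<close> would mean that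
    the preceding letter \<open>x'\<close> has the record \<open>y\<close> too, hence
    \<open>x' < x\<close>. Its box lies in the last column containing \<open>y\<close>, and row
    bumping puts the new box strictly to the right of it.\<close>
  show gt: "\<forall>z\<in>col Q j. y < z" if "k \<le> j" for j
  proof (rule ccontr)
    assume "\<not> (\<forall>z\<in>col Q j. y < z)"
    then obtain z where "z \<in> col Q j" "\<not> y < z" by blast
    moreover then have "z = y" using ge[of j] by (simp add: order.antisym not_less)
    ultimately have yj: "y \<in> col Q j" by simp
    then have "y \<in> snd ` set ps" using e by blast
    then obtain qs x' y' where ps: "ps = qs @ [(x', y')]" by (cases ps rule: rev_cases) auto
    have "y' = y" using \<open>y \<in> snd ` set ps\<close> cc(1,3) ps by (fastforce simp: compat_snoc)
    then have x: "x' < x" using cc(4) ps by simp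
    obtain P0 Q0 where 0: "run qs = (P0, Q0)" by fastforce
    have P: "P = ins x' P0" using run_snoc[OF 0] r ps by simp
    have "insertable x' P0" "j \<le> new_col x' P0" using l ps yj \<open>y' = y\<close> 0 by (auto simp: last_inv_def)
    moreover then have "new_col x' P0 < k" using new_col_less[of x' P0 x] i P x by (simp add: k_def)
    ultimately show False using that by simp
  qed
  have "card (col Q k) < card (col Q (k - 1))" if "0 < k"
  proof -
    have "Tab (ins x P)" by (rule Tab_ins[OF i])
    then have "wdom (col (ins x P) (k - 1)) (col (ins x P) k)"
      using dom_wdom[of "col (ins x P) (k - 1)" "col (ins x P) (Suc (k - 1))"] Tab_dom[of "ins x P" "k - 1"] finite_col that by simp
    then have "card (col (ins x P) k) \<le> card (col (ins x P) (k - 1))"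
      unfolding wdom_def using up_0 by metis
    then have "card (col P k) < card (col P (k - 1))" using card_ins[OF i] that by (auto simp: k_def split: if_splits)
    then show ?thesis using tab_pair by (simp add: tab_pair_def)
  qed
  then show "WTab (add_box k y Q)" using tab_pair kl cc(2) ge gt by (intro WTab_add_box) (auto simp: tab_pair_def)
qed

lemma run_inv_reduced_biword: "reduced_biword ps \<Longrightarrow> run_inv ps"
proof (induction ps rule: rev_induct)
  case Nil
  show ?case by (auto simp: run_inv_def tab_pair_def last_inv_def)
next
  case (snoc p ps)
  obtain x y where p: "p = (x, y)" by fastforce
  have inv: "run_inv ps" using snoc reduced_biword_snocD by blast
  obtain P Q where r: "run ps = (P, Q)" by fastforce
  note st = run_step[OF inv snoc.prems[unfolded p] r]
  define k where "k = new_col x P"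
  have tab_pair: "tab_pair P Q" and n: "np (rev (map fst ps)) (word_of P)"
    and e: "\<And>z. (\<exists>j. z \<in> col Q j) \<longleftrightarrow> z \<in> snd ` set ps"
    using inv r by (auto simp: run_inv_def)
  have r': "run (ps @ [p]) = (ins x P, add_box k y Q)" using run_snoc[OF r] p by (simp add: k_def)
  have c: "col (add_box k y Q) j = (if j = k then insert y (col Q j) else col Q j)" for j
    using st(2) by (simp add: col_add_box k_def)
  have yk: "y \<notin> col Q j" if "k \<le> j" for j using st(5)[of j] that by (auto simp: k_def)
  have "card (col (add_box k y Q) j) = card (col Q j) + (if j = k then 1 else 0)" for j
    using c[of j] yk[of k] finite_colQ[of Q k] tab_pair by (auto simp: tab_pair_def)
  then have "tab_pair (ins x P) (add_box k y Q)"
    using Tab_ins[OF st(1)] reduced_ins[OF st(1)] st(6) card_ins[OF st(1)] tab_pair by (auto simp: tab_pair_def k_def)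
  moreover have "np (rev (map fst (ps @ [p]))) (word_of (ins x P))"
    using np_trans[OF np_Cons[OF n, of x] ins_np[OF st(1)]] p by simp
  moreover have "(\<exists>j. z \<in> col (add_box k y Q) j) \<longleftrightarrow> z \<in> snd ` set (ps @ [p])" for z
    using e[of z] p by (auto simp: c)
  moreover have "last_inv (ps @ [p]) (add_box k y Q)"
    unfolding last_inv_def using r p st(1) c yk by (auto simp: k_def split: if_splits) (metis nat_le_linear)
  ultimately show ?case using r' unfolding run_inv_def by blast
qed

lemma add_box_not_Nil: "add_box k y Q \<noteq> []"
  by (cases Q) (auto simp: add_box_def split: nat.splits)

lemma run_inj: "reduced_biword ps \<Longrightarrow> reduced_biword ps' \<Longrightarrow> run ps = run ps' \<Longrightarrow> ps = ps'"
proof (induction ps arbitrary: ps' rule: rev_induct)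
  case Nil
  show ?case
  proof (cases ps' rule: rev_cases)
    case (snoc qs p)
    obtain P Q where r: "run qs = (P, Q)" by fastforce
    obtain x y where "p = (x, y)" by fastforce
    then show ?thesis using Nil.prems(3) run_snoc[OF r, of x y] snoc add_box_not_Nil[of "new_col x P" y Q] by simp
  qed simp
next
  case (snoc p ps)
  obtain x y where p: "p = (x, y)" by fastforce
  obtain P Q where r: "run ps = (P, Q)" by fastforce
  note st = run_step[OF run_inv_reduced_biword[OF reduced_biword_snocD[OF snoc.prems(1)]] snoc.prems(1)[unfolded p] r]
  have R: "run (ps @ [p]) = (ins x P, add_box (new_col x P) y Q)" using run_snoc[OF r] p by simp
  have "ps' \<noteq> []" using snoc.prems(3) R add_box_not_Nil[of "new_col x P" y Q] by auto
  then obtain qs x' y' where ps': "ps' = qs @ [(x', y')]" by (metis rev_exhaust surj_pair)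
  obtain P' Q' where r': "run qs = (P', Q')" by fastforce
  have c': "reduced_biword (qs @ [(x', y')])" using snoc.prems(2) ps' by simp
  note st' = run_step[OF run_inv_reduced_biword[OF reduced_biword_snocD[OF c']] c' r']
  define k k' where "k = new_col x P" and "k' = new_col x' P'"
  have "run ps' = (ins x' P', add_box k' y' Q')" using run_snoc[OF r'] ps' by (simp add: k'_def)
  then have eq: "ins x P = ins x' P'" "add_box k y Q = add_box k' y' Q'"
    using R snoc.prems(3) by (simp_all add: k_def)
  have c1: "col (add_box k y Q) j = (if j = k then insert y (col Q j) else col Q j)" for j
    using st(2) by (simp add: col_add_box k_def)
  have c2: "col (add_box k y Q) j = (if j = k' then insert y' (col Q' j) else col Q' j)" for j
    unfolding eq(2) by (rule col_add_box[OF st'(2)[folded k'_def]])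
  note c = c1 c2
  \<comment> \<open>The last step can be read off the result: its record is the least entry of the
    recording tableau, and its box lies in the last column that contains this entry.\<close>
  have "y' \<le> y" using c[of k] st'(4)[of k] by (auto split: if_splits)
  moreover have "y \<le> y'" using c[of k'] st(4)[of k'] by (auto split: if_splits)
  ultimately have y: "y' = y" by simp
  have yk: "y \<notin> col Q j" if "k \<le> j" for j using st(5)[of j] that by (auto simp: k_def)
  have yk': "y \<notin> col Q' j" if "k' \<le> j" for j using st'(5)[of j] that y by (auto simp: k'_def)
  have "\<not> k < k'" using c[of k'] yk[of k'] y by auto
  moreover have "\<not> k' < k" using c[of k] yk'[of k] y by auto
  ultimately have k: "k' = k" by simp
  have xP: "x = x' \<and> P = P'" using ins_inj[OF st(1) st'(1) eq(1)] k by (simp add: k_def k'_def)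
  have TQs: "tab_pair P Q" "tab_pair P' Q'"
    using run_inv_reduced_biword[OF reduced_biword_snocD[OF snoc.prems(1)]] run_inv_reduced_biword[OF reduced_biword_snocD[OF c']] r r' by (auto simp: run_inv_def)
  have "length Q = length Q'" using tab_pair_length[OF TQs(1)] tab_pair_length[OF TQs(2)] xP by simp
  moreover have "col Q j = col Q' j" for j
  proof (cases "j = k")
    case True
    then have "insert y (col Q k) = insert y (col Q' k)" using c[of k] k y by simp
    then show ?thesis using yk[of k] yk'[of k] k True by (metis insert_ident order_refl)
  next
    case False
    then show ?thesis using c[of j] k by simp
  qed
  then have "Q ! j = Q' ! j" if "j < length Q" for j using that calculation by (metis col_def)
  ultimately have "Q = Q'" by (intro nth_equalityI) auto
  then have "ps = qs" using snoc.IH[OF reduced_biword_snocD[OF snoc.prems(1)] reduced_biword_snocD[OF c']] r r' xP by simp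
  then show ?case using p ps' xP y by simp
qed

text \<open>Records decrease weakly and boxes with equal records move to the right, so the box to be
  removed first holds the least entry, in the last column containing it.\<close>

lemma run_surj: "tab_pair P Q \<Longrightarrow> \<exists>ps. reduced_biword ps \<and> run ps = (P, Q)"
proof (induction "length (word_of P)" arbitrary: P Q rule: less_induct)
  case less
  have P: "Tab P" "reduced (word_of P)" and Q: "WTab Q" and cd: "\<And>j. card (col P j) = card (col Q j)"
    using less.prems by (auto simp: tab_pair_def)
  have len: "length P = length Q" by (rule tab_pair_length[OF less.prems])
  show ?case
  proof (cases "Q = []")
    case True
    then show ?thesis using len by (intro exI[of _ "[]"]) (auto simp: reduced_biword_def compat_def)
  next
    case False
    define S where "S = \<Union> (set Q)"
    have S: "finite S" "S \<noteq> {}" "0 \<notin> S" using WTab_mem[OF Q] False by (auto simp: S_def)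
    have cS: "col Q j \<subseteq> S" for j using nth_mem[of j Q] by (auto simp: S_def col_def simp del: nth_mem)
    define y where "y = Min S"
    have y: "y \<in> S" "\<And>z. z \<in> S \<Longrightarrow> y \<le> z" using S by (auto simp: y_def)
    have y0: "0 < y" using y S by (metis gr0I)
    define J where "J = {j. y \<in> col Q j}"
    have J: "finite J" "J \<noteq> {}"
    proof -
      show "finite J" by (rule finite_subset[of _ "{..<length Q}"]) (auto simp: J_def col_def split: if_splits)
      obtain C where "C \<in> set Q" "y \<in> C" using y(1) unfolding S_def by blast
      then obtain j where "j < length Q" "y \<in> Q ! j" unfolding in_set_conv_nth by blast
      then have "j \<in> J" by (simp add: J_def col_def)
      then show "J \<noteq> {}" by blast
    qed
    define k where "k = Max J"
    have k: "y \<in> col Q k" "\<And>j. y \<in> col Q j \<Longrightarrow> j \<le> k" using Max_in[OF J] Max_ge[OF J(1)] by (auto simp: k_def J_def)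
    then have kl: "k < length Q" by (auto simp: col_def split: if_splits)
    define F where "F = col Q (Suc k)"
    define C where "C = col Q k"
    have f: "finite C" "finite F" using finite_colQ[OF Q] by (auto simp: C_def F_def)
    have F: "\<forall>z\<in>F. y < z" using k(2)[of "Suc k"] y(2) cS[of "Suc k"] by (force simp: F_def le_less)
    have upF: "up F (Suc y) = card F"
    proof -
      have "{c \<in> F. Suc y \<le> c} = F" using F by (auto simp: Suc_le_eq)
      then show ?thesis by (simp add: up_def)
    qed
    have upC: "up C t = card C" if "t \<le> y" for t
    proof -
      have "{c \<in> C. t \<le> c} = C" using y(2) cS[of k] that by (auto simp: C_def intro: le_trans)
      then show ?thesis by (simp add: up_def)
    qed
    have wd: "wdom (col Q j) (col Q (Suc j))" for j using Q by (simp add: WTab_col)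
    have "up F (Suc y) \<le> up C (Suc y)" using wd[of k] by (simp add: wdom_def C_def F_def)
    \<comment> \<open>All letters of \<open>F\<close> exceed \<open>y\<close>, so they are dominated
      by the letters of \<open>C\<close> other than \<open>y\<close>. Hence column \<open>k\<close>
      ends in a corner.\<close>
    then have lt: "card F < card C" using upF upC[of y] up_Suc[OF f(1), of y] k(1) by (simp add: C_def)
    obtain x P' where x: "insertable x P'" "ins x P' = P" "new_col x P' = k"
      using ins_surj[OF P, of k] kl len lt cd by (auto simp: C_def F_def)
    \<comment> \<open>A column that holds only \<open>y\<close> must disappear, since columns are
      nonempty; as \<open>F\<close> is then empty, it is the last column.\<close>
    define Q' where "Q' = (if C = {y} then take k Q else Q[k := C - {y}])"
    have colQ': "col Q' j = (if j = k then C - {y} else col Q j)" for j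
    proof (cases "C = {y}")
      case True
      then have "F = {}" using lt f by simp
      then have "Suc k = length Q" using kl WTab_mem[OF Q nth_mem, of "Suc k"] by (cases "Suc k < length Q") (auto simp: F_def col_def)
      then show ?thesis using True kl by (auto simp: Q'_def col_def)
    next
      case False
      then show ?thesis using kl by (auto simp: Q'_def col_def C_def nth_list_update)
    qed
    have add: "add_box k y Q' = Q"
    proof (cases "C = {y}")
      case True
      then have "F = {}" using lt f by simp
      then have "Suc k = length Q" using kl WTab_mem[OF Q nth_mem, of "Suc k"] by (cases "Suc k < length Q") (auto simp: F_def col_def)
      then have "take k Q @ [Q ! k] = Q" using kl by (metis take_Suc_conv_app_nth take_all order_refl)
      moreover have "Q ! k = {y}" using True kl by (simp add: C_def col_def)
      ultimately show ?thesis using True kl by (simp add: Q'_def add_box_def)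
    next
      case False
      have "insert y (C - {y}) = Q ! k" using k(1) kl by (auto simp: C_def col_def)
      then show ?thesis using False kl by (simp add: Q'_def add_box_def)
    qed
    have "WTab Q'" unfolding WTab_col
    proof (intro conjI allI ballI)
      fix D assume D: "D \<in> set Q'"
      then have "D \<in> set Q \<or> D = C - {y} \<and> C \<noteq> {y}"
        using set_update_subset_insert[of Q k "C - {y}"] set_take_subset[of k Q] by (auto simp: Q'_def split: if_splits)
      then show "finite D" "D \<noteq> {}" "0 \<notin> D"
        using WTab_mem[OF Q] f(1) S(3) cS[of k] k(1) by (auto simp: C_def)
    next
      fix j
      consider "j = k" | "Suc j = k" | "j \<noteq> k" "Suc j \<noteq> k" by blast
      then show "wdom (col Q' j) (col Q' (Suc j))"
      proof cases
        case 1
        have "up F t \<le> up (C - {y}) t" for t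
        proof (cases "t \<le> y")
          case True
          then show ?thesis using up_remove[OF f(1), of y t] k(1) upC[OF True] lt up_le_card[OF f(2), of t] by (simp add: C_def)
        next
          case False
          then have "up C t = up (C - {y}) t" using up_remove[OF f(1), of y t] k(1) by (simp add: C_def)
          moreover have "up F t \<le> up C t" using wd[of k] by (simp add: C_def F_def wdom_def)
          ultimately show ?thesis by simp
        qed
        then show ?thesis using 1 by (simp add: colQ' wdom_def F_def)
      next
        case 2
        then show ?thesis using wd[of j] wdom_subset[of C "col Q j" "C - {y}"] f by (auto simp: colQ' C_def)
      next
        case 3
        then show ?thesis using wd by (simp add: colQ')
      qed
    qed
    moreover have "card (col P' j) = card (col Q' j)" for j
      using card_ins[OF x(1), of j] x(2,3) cd[of j] colQ'[of j] k(1) f(1) by (auto simp: C_def split: if_splits)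
    moreover have "Tab P'" "reduced (word_of P')" using x(1) reduced_tl by (auto simp: insertable_def)
    ultimately have tab_pair': "tab_pair P' Q'" by (simp add: tab_pair_def)
    have n: "np (x # word_of P') (word_of P)" using ins_np[OF x(1)] x(2) by simp
    then obtain ps where ps: "reduced_biword ps" "run ps = (P', Q')" using less.hyps[OF _ tab_pair'] np_length by fastforce
    have inv: "np (rev (map fst ps)) (word_of P')" "\<And>z. (\<exists>j. z \<in> col Q' j) \<longleftrightarrow> z \<in> snd ` set ps" "last_inv ps Q'"
      using run_inv_reduced_biword[OF ps(1)] ps(2) by (auto simp: run_inv_def)
    have "np (rev (map fst (ps @ [(x, y)]))) (word_of P)" using np_trans[OF np_Cons[OF inv(1)] n] by simp
    then have "reduced (map fst (ps @ [(x, y)]))" using P(2) np_reduced reduced_rev by (metis rev_rev_ident)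
    moreover have "compat (ps @ [(x, y)])" unfolding compat_snoc
    proof (intro conjI impI ballI)
      show "compat ps" using ps(1) by (simp add: reduced_biword_def)
      show "0 < y" by (rule y0)
      fix p assume "p \<in> set ps"
      then obtain j where "snd p \<in> col Q' j" using inv(2) by blast
      then have "snd p \<in> S" using cS[of j] cS[of k] colQ'[of j] by (auto simp: C_def split: if_splits)
      then show "y \<le> snd p" by (rule y(2))
    next
      assume "ps \<noteq> []" and l: "snd (last ps) = y"
      then obtain qs x' where q: "ps = qs @ [(x', y)]" by (metis append_butlast_last_id prod.collapse)
      obtain P0 Q0 where 0: "run qs = (P0, Q0)" by fastforce
      have P': "P' = ins x' P0" using run_snoc[OF 0] ps(2) q by simp
      have i: "insertable x' P0" "y \<in> col Q' (new_col x' P0)" using inv(3) q 0 by (auto simp: last_inv_def)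
      have "new_col x' P0 \<noteq> k" using i(2) colQ'[of k] by auto
      moreover have "new_col x' P0 \<le> k" using i(2) colQ'[of "new_col x' P0"] k(2) calculation by auto
      ultimately have "new_col x' P0 < k" by simp
      \<comment> \<open>The box of \<open>x'\<close> lies strictly left of column \<open>k\<close>,
        whereas \<open>x < x'\<close> would put the box of \<open>x\<close> weakly left of it;
        equality of the letters would contradict reducedness.\<close>
      then have "\<not> x < x'" using new_col_greater[OF i(1), of x] x P' by auto
      moreover have "x \<noteq> x'" using not_insertable_twice[OF i(1)] x(1) P' by auto
      ultimately show "fst (last ps) < x" using q by simp
    qed
    ultimately show ?thesis using run_snoc[OF ps(2), of x y] x add
      by (intro exI[of _ "ps @ [(x, y)]"]) (simp add: reduced_biword_def)
  qed
qed

lemma run_keys: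
  "reduced_biword ps \<Longrightarrow> run ps = (P, Q) \<Longrightarrow> (\<forall>j. wdom (right_key P j) (left_key Q j)) \<longleftrightarrow> (\<forall>p\<in>set ps. snd p \<le> fst p)"
proof (induction ps arbitrary: P Q rule: rev_induct)
  case Nil
  then show ?case by (simp add: right_key_def left_key_def)
next
  case (snoc p ps)
  obtain x y where p: "p = (x, y)" by fastforce
  obtain P' Q' where r: "run ps = (P', Q')" by fastforce
  have c: "reduced_biword ps" using reduced_biword_snocD[OF snoc.prems(1)] .
  note st = run_step[OF run_inv_reduced_biword[OF c] snoc.prems(1)[unfolded p] r]
  have R: "P = ins x P'" "Q = add_box (new_col x P') y Q'" using run_snoc[OF r] p snoc.prems(2) by auto
  have tab_pair: "tab_pair P' Q'" using run_inv_reduced_biword[OF c] r by (auto simp: run_inv_def)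
  have "(\<forall>j. wdom (right_key P j) (left_key Q j)) \<longleftrightarrow> (\<forall>j. wdom (right_key P' j) (left_key Q' j)) \<and> y \<le> x"
    unfolding R using tab_pair by (intro keys_step[OF st(1) refl _ st(6,4,5) _ st(2)]) (auto simp: tab_pair_def)
  then show ?case using snoc.IH[OF c r] p by auto
qed

subsection \<open>Right insertion moves a column to the end\<close>

lemma card_star: "finite S \<Longrightarrow> card (star S m) = card S + (if \<exists>s\<in>S. m \<le> s then 0 else 1)"
  using up_star[of S m 0] up_pos_iff[of S m] by (auto simp: up_0)

lemma card_act_ge: "finite S \<Longrightarrow> card S \<le> card (act S w)"
proof (induction w arbitrary: S)
  case (Cons m w)
  have "card S \<le> card (star S m)" using card_star[OF Cons.prems] by simp
  also have "\<dots> \<le> card (act (star S m) w)" using Cons by simp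
  finally show ?case by simp
qed simp

lemma np_push_right_out:
  assumes "sorted_wrt (<) (d # vs)" "d < c" "sorted_wrt (<) (c # vs)"
  shows "np (c # vs @ [d]) (c # d # vs)"
  using np_sym[OF np_push_right[OF assms(3,2)]] by simp

lemma np_push_left_out:
  assumes "sorted_wrt (<) (us @ [d])" "d < c"
  shows "np (us @ c # d # vs) (c # us @ d # vs)"
  using np_sym[OF np_push_left[OF assms]] .

text \<open>Mirror image of \<open>np_column\<close>, with \<open>star\<close> as the column
  operation: \<open>d\<close> enters at the right and \<open>e\<close> leaves at the left. The last
  two clauses serve \<open>right_column\<close>: the next output lies in the new column above the
  next letter, hence is at least \<open>e\<close> and different from it.\<close>

lemma right_step:
  assumes f: "finite C" and r: "reduced (asc C @ [d])" and ex: "\<exists>s\<in>C. d \<le> s"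
  shows "\<exists>e\<in>C. np (asc C @ [d]) (e # asc (star C d)) \<and> d < e \<and> (\<forall>s\<in>star C d. d < s \<longrightarrow> e \<le> s) \<and>
    (e \<in> star C d \<longrightarrow> e = Suc d)"
proof (cases "d \<in> C")
  case True
  have st: "star C d = C"
    using True f by (intro set_eqI) (auto simp: star_iff)
  let ?us = "asc {c \<in> C. c < d}"
  have "Suc d \<in> C"
  proof (rule ccontr)
    assume n: "Suc d \<notin> C"
    have "reduced (?us @ (d # asc {c \<in> C. d < c} @ d # []))"
      using r asc_split[OF f True] by simp
    then have "reduced (d # asc {c \<in> C. d < c} @ d # [])" by (rule reduced_append2)
    moreover have "\<forall>u\<in>set (asc {c \<in> C. d < c}). Suc u < d \<or> Suc d < u"
      using f n by (auto intro: Suc_lessI)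
    ultimately show False using not_reduced_repeat by blast
  qed
  let ?vs = "asc {c \<in> C. Suc d < c}"
  have a: "asc C = ?us @ d # Suc d # ?vs"
    using f True \<open>Suc d \<in> C\<close> by (intro asc_unique) (auto simp: sorted_wrt_append)
  have s: "sorted_wrt (<) (?us @ [d])" "sorted_wrt (<) (d # ?vs)" "sorted_wrt (<) (Suc d # ?vs)"
    using f by (auto simp: sorted_wrt_append)
  have "np (Suc d # ?vs @ [d]) (Suc d # d # ?vs)" by (rule np_push_right_out[OF s(2) lessI s(3)])
  then have "np (?us @ d # Suc d # ?vs @ [d]) (?us @ d # Suc d # d # ?vs)"
    by (rule np_append2[OF np_Cons])
  also have "np \<dots> (?us @ Suc d # d # Suc d # ?vs)"
    by (rule np_append2[OF np_braid])
  also have "np \<dots> (Suc d # ?us @ d # Suc d # ?vs)"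
    by (rule np_push_left_out[OF s(1) lessI])
  finally have "np (asc C @ [d]) (Suc d # asc (star C d))" using a st by simp
  then show ?thesis using \<open>Suc d \<in> C\<close> by (intro bexI[of _ "Suc d"]) auto
next
  case False
  define e where "e = Min {s \<in> C. d \<le> s}"
  have ff: "finite {s \<in> C. d \<le> s}" "{s \<in> C. d \<le> s} \<noteq> {}" using f ex by auto
  have e: "e \<in> C" "d < e" "\<And>s. s \<in> C \<Longrightarrow> d < s \<Longrightarrow> e \<le> s"
    using Min_in[OF ff] Min_le[OF ff(1)] False by (auto simp: e_def le_less)
  have st: "star C d = insert d (C - {e})" using ex by (simp add: star_def e_def)
  let ?us = "asc {c \<in> C. c < e}" and ?vs = "asc {c \<in> C. e < c}"
  have lt: "c < e \<Longrightarrow> c \<in> C \<Longrightarrow> c < d" for c using e(3)[of c] False by (metis leD linorder_neqE_nat)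
  have s: "sorted_wrt (<) (?us @ [d])" "sorted_wrt (<) (d # ?vs)" "sorted_wrt (<) (e # ?vs)"
    using f e(2) lt by (auto simp: sorted_wrt_append)
  have "np (e # ?vs @ [d]) (e # d # ?vs)" by (rule np_push_right_out[OF s(2) e(2) s(3)])
  then have "np (?us @ e # ?vs @ [d]) (?us @ e # d # ?vs)" by (rule np_append2)
  also have "np \<dots> (e # ?us @ d # ?vs)"
    by (rule np_push_left_out[OF s(1) e(2)])
  also have "?us @ d # ?vs = asc (star C d)"
    unfolding st using f e lt False by (intro asc_unique[symmetric]) (auto simp: sorted_wrt_append)
  finally have "np (asc C @ [d]) (e # asc (star C d))" using asc_split[OF f e(1)] by simp
  moreover have "\<forall>s\<in>star C d. d < s \<longrightarrow> e \<le> s" "e \<notin> star C d" unfolding st using e by auto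
  ultimately show ?thesis using e by (intro bexI[of _ e]) auto
qed

text \<open>Equality of the cardinalities says that no letter is appended, so every letter of
  \<open>l\<close> expels one, and \<open>es\<close> has the length of \<open>l\<close>.\<close>

lemma right_column:
  "finite C \<Longrightarrow> sorted_wrt (<) l \<Longrightarrow> reduced (asc C @ l) \<Longrightarrow> card (act C l) = card C \<Longrightarrow>
   \<exists>es. sorted_wrt (<) es \<and> length es = length l \<and> np (asc C @ l) (es @ asc (act C l)) \<and>
     (l \<noteq> [] \<longrightarrow> hd es \<in> C \<and> hd l < hd es)"
proof (induction l arbitrary: C)
  case (Cons d l)
  let ?D = "star C d"
  have "card ?D \<le> card (act ?D l)" by (rule card_act_ge[OF finite_star[OF Cons.prems(1)]])
  moreover have "card C \<le> card ?D" using card_star[OF Cons.prems(1), of d] by simp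
  ultimately have c: "card ?D = card C" "card (act ?D l) = card ?D" using Cons.prems(4) by simp_all
  have "\<exists>s\<in>C. d \<le> s" using c(1) card_star[OF Cons.prems(1), of d] by (auto split: if_splits)
  moreover have "reduced (asc C @ [d])" using reduced_append1[of "asc C @ [d]" l] Cons.prems(3) by simp
  ultimately obtain e where e: "e \<in> C" "np (asc C @ [d]) (e # asc ?D)" "d < e" "\<forall>s\<in>?D. d < s \<longrightarrow> e \<le> s"
    "e \<in> ?D \<longrightarrow> e = Suc d" using right_step[OF Cons.prems(1)] by blast
  have n: "np (asc C @ d # l) (e # asc ?D @ l)" using np_append1[OF e(2), of l] by simp
  then have "reduced (asc ?D @ l)" using Cons.prems(3) np_reduced reduced_tl by blast
  then obtain es where es: "sorted_wrt (<) es" "length es = length l" "np (asc ?D @ l) (es @ asc (act ?D l))"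
    "l \<noteq> [] \<longrightarrow> hd es \<in> ?D \<and> hd l < hd es"
    using Cons.IH[of ?D] Cons.prems c by auto
  have "sorted_wrt (<) (e # es)"
  proof (cases es)
    case (Cons e' es')
    then obtain d' l' where l: "l = d' # l'" using es(2) by (cases l) auto
    then have d: "d < d'" "e' \<in> ?D" "d' < e'" using Cons.prems(2) es(4) \<open>es = e' # es'\<close> by auto
    then have "e \<le> e'" "e \<noteq> e'" using e(4,5) by auto
    then show ?thesis using es(1) Cons by auto
  qed simp
  moreover have "np (asc C @ d # l) ((e # es) @ asc (act C (d # l)))"
    using np_trans[OF n] np_Cons[OF es(3), of e] by simp
  ultimately show ?case using e es(2) by (intro exI[of _ "e # es"]) auto
qed simp

text \<open>The column \<open>S\<close> travels to the right through \<open>T\<close>, leaving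
  behind one increasing factor of the same length for each column it passes.\<close>

lemma right_tableau:
  "finite S \<Longrightarrow> Tab T \<Longrightarrow> wdom S (fcol T) \<Longrightarrow> reduced (asc S @ word_of T) \<Longrightarrow>
   \<exists>es. map length es = map card T \<and> (\<forall>e\<in>set es. sorted_wrt (<) e) \<and>
     np (asc S @ word_of T) (concat es @ asc (act S (word_of T)))"
proof (induction T arbitrary: S)
  case (Cons C T)
  have f: "finite C" using Cons.prems by simp
  let ?D = "act S (asc C)"
  have c: "card ?D = card S" using Cons.prems by (intro card_act_sorted) (auto simp: wdom_def)
  have "reduced (asc S @ asc C)" using reduced_append1[of "asc S @ asc C"] Cons.prems(4) by simp
  then obtain e where e: "sorted_wrt (<) e" "length e = card C" "np (asc S @ asc C) (e @ asc ?D)"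
    using right_column[OF Cons.prems(1) sorted_asc[of C] _ c] by auto
  have n: "np (asc S @ word_of (C # T)) (e @ asc ?D @ word_of T)" using np_append1[OF e(3), of "word_of T"] by simp
  then have r: "reduced (asc ?D @ word_of T)" using Cons.prems(4) np_reduced reduced_append2 by blast
  have "C \<subseteq> ?D" using act_superset[OF Cons.prems(1), of "asc C"] f by simp
  then have "up C t \<le> up ?D t" for t using Cons.prems by (intro up_mono) auto
  moreover have "wdom C (fcol T)" using dom_wdom Cons.prems(2) by simp
  ultimately have "wdom ?D (fcol T)" unfolding wdom_def by (meson le_trans)
  then obtain es where es: "map length es = map card T" "\<forall>e\<in>set es. sorted_wrt (<) e"
      "np (asc ?D @ word_of T) (concat es @ asc (act ?D (word_of T)))"
    using Cons.IH[of ?D] Cons.prems r by auto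
  have "np (e @ asc ?D @ word_of T) (e @ concat es @ asc (act ?D (word_of T)))" by (rule np_append2[OF es(3)])
  then show ?case using np_trans[OF n] e es by (intro exI[of _ "e # es"]) auto
qed (intro exI[of _ "[]"], simp)

text \<open>Column \<open>j\<close> is moved past the columns to its right; by
  \<open>right_key_eq\<close> it arrives as column \<open>j\<close> of the right key.\<close>

lemma key_factorization:
  assumes "Tab P" "reduced (word_of P)" "j < length P"
  shows "\<exists>es. map length es = map card (take j P @ drop (Suc j) P) \<and> (\<forall>e\<in>set es. sorted_wrt (<) e) \<and>
    np (word_of P) (concat es @ asc (right_key P j))"
proof -
  define C U where "C = P ! j" and "U = drop (Suc j) P"
  have P: "P = take j P @ C # U" using assms(3) by (simp add: C_def U_def id_take_nth_drop)
  have "Tab (C # U)" using Tab_drop[OF assms(1), of j] assms(3) by (simp add: C_def U_def Cons_nth_drop_Suc)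
  then have U: "finite C" "Tab U" "wdom C (fcol U)" using dom_wdom by auto
  have w: "word_of P = word_of (take j P) @ asc C @ word_of U" by (subst P) simp
  then have "reduced (asc C @ word_of U)" using assms(2) reduced_append2 by metis
  then obtain es where es: "map length es = map card U" "\<forall>e\<in>set es. sorted_wrt (<) e"
     "np (asc C @ word_of U) (concat es @ asc (act C (word_of U)))"
    using right_tableau[OF U] by blast
  have "right_key P j = act C (word_of U)" using right_key_eq[OF assms(1)] assms(3) by (simp add: C_def U_def col_def)
  then have "np (word_of P) (concat (map asc (take j P) @ es) @ asc (right_key P j))"
    unfolding w using np_append2[OF es(3)] by (simp add: word_of_def)
  then show ?thesis using es by (intro exI[of _ "map asc (take j P) @ es"]) (auto simp: U_def)
qed

subsection \<open>Uniqueness of factorizations\<close>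

text \<open>An increasing word of length \<open>n\<close> adds a vertical strip, whose \<open>i\<close>-th box lies in row \<open>i\<close> or lower. The
  number of boxes below row \<open>s\<close> therefore grows by at least \<open>n - s\<close>, and a factorization whose lengths
  are a rearrangement of the column lengths has no slack in these estimates.\<close>

definition deep :: "nat \<Rightarrow> nat list \<Rightarrow> nat" where
  "deep s ls = sum_list (map (\<lambda>l. l - s) ls)"

lemma deep_simps [simp]: "deep s [] = 0" "deep s (l # ls) = (l - s) + deep s ls" "deep s (ls @ ms) = deep s ls + deep s ms"
  by (simp_all add: deep_def)

lemma deep_mset: "mset ls = mset ms \<Longrightarrow> deep s ls = deep s ms"
  unfolding deep_def by (metis mset_map sum_mset_sum_list)

lemma deep_Suc: "deep s ls = deep (Suc s) ls + length (filter (\<lambda>l. s < l) ls)"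
  by (induction ls) auto

text \<open>The first difference of \<open>deep\<close> in \<open>s\<close> counts the parts
  exceeding \<open>s\<close>, the second one the parts equal to \<open>Suc s\<close>.\<close>

lemma mset_eq_deep:
  assumes "\<And>s. deep s ls = deep s ms" "0 \<notin> set ls" "0 \<notin> set ms"
  shows "mset ls = mset ms"
proof (rule multiset_eqI)
  fix n
  have 1: "length (filter (\<lambda>l. s < l) ls) = length (filter (\<lambda>l. s < l) ms)" for s
    using deep_Suc[of s ls] deep_Suc[of s ms] assms(1) by simp
  have 2: "length (filter (\<lambda>l. s < l) xs) = length (filter (\<lambda>l. Suc s < l) xs) + count (mset xs) (Suc s)" for s xs
    by (induction xs) auto
  show "count (mset ls) n = count (mset ms) n"
  proof (cases n)
    case 0
    then show ?thesis using assms(2,3) by (metis count_eq_zero_iff set_mset_mset)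
  next
    case (Suc s)
    then show ?thesis using 1[of s] 1[of "Suc s"] 2[of s ls] 2[of s ms] by simp
  qed
qed

lemma deep_ins: "insertable x T \<Longrightarrow>
  deep s (map card (ins x T)) = deep s (map card T) + (if s \<le> card (col T (new_col x T)) then 1 else 0)"
proof (induction T arbitrary: x)
  case Nil
  then show ?case using insertable_pos by auto
next
  case (Cons C T)
  have "0 < x" using Cons.prems by (rule insertable_pos)
  then show ?case
    using Cons.IH[of "out x C"] insertable_next[OF Cons.prems] card_bump[OF insertable_good_Cons[OF Cons.prems]]
    by (cases "out x C = 0") auto
qed

lemma insertable_insw:
  assumes "Tab T" "reduced (x # v @ word_of T)"
  shows "insertable x (insw v T)"
proof -
  have "Tab (insw v T)" "np (v @ word_of T) (word_of (insw v T))"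
    using insw_np[OF assms(1), of v] assms(2) reduced_tl by auto
  then show ?thesis using np_reduced[OF np_Cons] assms(2) unfolding insertable_def by blast
qed

lemma card_col_mono:
  assumes T: "Tab T" and "i \<le> j"
  shows "card (col T j) \<le> card (col T i)"
  using assms(2)
proof (induction rule: dec_induct)
  case (step n)
  have "wdom (col T n) (col T (Suc n))" by (rule dom_wdom[OF finite_col[OF T] Tab_dom[OF T]])
  then have "card (col T (Suc n)) \<le> card (col T n)" unfolding wdom_def by (metis up_0)
  then show ?case using step.IH by simp
qed simp

lemma strip_step:
  assumes "Tab T" "sorted_wrt (<) (x # x' # v)" "reduced (x # x' # v @ word_of T)"
  shows "new_col x (insw (x' # v) T) \<le> new_col x' (insw v T)"
  using new_col_greater[of x' "insw v T" x] insertable_insw[OF assms(1), of x' v] insertable_insw[OF assms(1), of x "x' # v"]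
    assms(2) reduced_tl[OF assms(3)] assms(3) by simp

text \<open>An increasing word enters from its right end, so its letters decrease and every new box
  lies weakly left of the previous one; it is therefore at least one row lower.\<close>

lemma strip_row:
  "Tab T \<Longrightarrow> sorted_wrt (<) (x # v) \<Longrightarrow> reduced (x # v @ word_of T) \<Longrightarrow>
    length v \<le> card (col (insw v T) (new_col x (insw v T)))"
proof (induction v arbitrary: x)
  case (Cons x' v)
  let ?T = "insw v T"
  have r: "reduced (x' # v @ word_of T)" using Cons.prems(3) reduced_tl by auto
  have IH: "length v \<le> card (col ?T (new_col x' ?T))" using Cons r by simp
  have i: "insertable x' ?T" using insertable_insw Cons.prems(1) r by blast
  have "Suc (length v) \<le> card (col (ins x' ?T) (new_col x' ?T))" using IH card_ins[OF i] by simp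
  also have "\<dots> \<le> card (col (ins x' ?T) (new_col x (ins x' ?T)))"
    using card_col_mono[OF Tab_ins[OF i]] strip_step[OF Cons.prems(1,2)] Cons.prems(3) by simp
  finally show ?case by simp
qed simp

lemma deep_insw:
  "Tab T \<Longrightarrow> sorted_wrt (<) v \<Longrightarrow> reduced (v @ word_of T) \<Longrightarrow>
    deep s (map card T) + (length v - s) \<le> deep s (map card (insw v T))"
proof (induction v)
  case (Cons x v)
  have i: "insertable x (insw v T)" using insertable_insw Cons.prems by simp
  have "deep s (map card T) + (length v - s) \<le> deep s (map card (insw v T))"
    using Cons reduced_tl by simp
  moreover have "length v \<le> card (col (insw v T) (new_col x (insw v T)))" using strip_row Cons.prems by simp
  ultimately show ?case using deep_ins[OF i, of s] by auto
qed simp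

lemma deep_factors:
  "\<forall>v\<in>set vs. sorted_wrt (<) v \<Longrightarrow> Tab T \<Longrightarrow> reduced (concat vs @ word_of T) \<Longrightarrow>
    deep s (map length vs) + deep s (map card T) \<le> deep s (map card (insw (concat vs) T))"
proof (induction vs)
  case (Cons v vs)
  have r: "reduced (concat vs @ word_of T)" using Cons.prems(3) reduced_append2[of v] by simp
  have T: "Tab (insw (concat vs) T)" "np (concat vs @ word_of T) (word_of (insw (concat vs) T))"
    using insw_np[OF Cons.prems(2) r] by auto
  have "reduced (v @ word_of (insw (concat vs) T))"
    using np_reduced[OF np_append2[OF T(2), of v]] Cons.prems(3) by simp
  then have "deep s (map card (insw (concat vs) T)) + (length v - s) \<le> deep s (map card (insw v (insw (concat vs) T)))"
    using deep_insw[OF T(1), of v s] Cons.prems(1) by simp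
  then show ?case using Cons r by auto
qed simp

lemma sorted_mset_unique: "sorted_wrt (\<ge>) ls \<Longrightarrow> sorted_wrt (\<ge>) ms \<Longrightarrow> mset ls = mset ms \<Longrightarrow> ls = ms" for ls ms :: "nat list"
proof -
  assume s: "sorted_wrt (\<ge>) ls" "sorted_wrt (\<ge>) ms" and m: "mset ls = mset ms"
  have "sorted (rev ls)" "sorted (rev ms)" using s by (simp_all add: sorted_wrt_rev)
  then have "rev ls = rev ms" using m by (metis mset_rev properties_for_sort)
  then show "ls = ms" by simp
qed

lemma Tab_cards_sorted: "Tab T \<Longrightarrow> sorted_wrt (\<ge>) (map card T)"
proof (induction T)
  case (Cons C T)
  have "card D \<le> card C" if D: "D \<in> set T" for D
  proof -
    obtain j where "j < length T" "D = T ! j" using D by (metis in_set_conv_nth)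
    then show ?thesis using card_col_mono[OF Cons.prems, of 0 "Suc j"] by (simp add: col_def)
  qed
  then show ?case using Cons by auto
qed simp

lemma Tab_cards_pos: "Tab T \<Longrightarrow> 0 \<notin> set (map card T)"
  using Tab_mem by fastforce

text \<open>The lower bounds for \<open>ws\<close> and for \<open>us\<close> add up to the value for
  the whole shape, so both are equalities.\<close>

lemma suffix_shape:
  assumes P: "insw (concat (us @ ws)) [] = P" "mset (map card P) = mset (map length (us @ ws))"
    and s: "\<forall>v\<in>set (us @ ws). sorted_wrt (<) v" and r: "reduced (concat (us @ ws))"
  shows "mset (map card (insw (concat ws) [])) = mset (map length ws)"
proof (rule mset_eq_deep)
  let ?T = "insw (concat ws) []"
  have rw: "reduced (concat ws)" using r reduced_append2 by simp
  have T: "Tab ?T" "np (concat ws) (word_of ?T)" using insw_np[of "[]" "concat ws"] rw by auto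
  have ru: "reduced (concat us @ word_of ?T)" using np_reduced[OF np_append2[OF T(2), of "concat us"]] r by simp
  fix i
  have "deep i (map length ws) \<le> deep i (map card ?T)" using deep_factors[of ws "[]" i] s rw by simp
  moreover have "deep i (map length us) + deep i (map card ?T) \<le> deep i (map card P)"
    using deep_factors[OF _ T(1) ru, of i] s P(1) by simp
  ultimately show "deep i (map card ?T) = deep i (map length ws)"
    using deep_mset[OF P(2), of i] by simp
next
  have "Tab P" using insw_np[of "[]" "concat (us @ ws)"] r P(1) by simp
  then show "0 \<notin> set (map length ws)"
    using Tab_cards_pos mset_eq_setD[OF P(2)] by (metis UnI2 map_append set_append)
  show "0 \<notin> set (map card (insw (concat ws) []))"
    using insw_np[of "[]" "concat ws"] r reduced_append2 by (intro Tab_cards_pos) auto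
qed

lemma card_insw_ge: "Tab T \<Longrightarrow> reduced (v @ word_of T) \<Longrightarrow> card (col T j) \<le> card (col (insw v T) j)"
proof (induction v)
  case (Cons x v)
  have "insertable x (insw v T)" using insertable_insw Cons.prems by simp
  then show ?case using Cons card_ins[of x "insw v T" j] reduced_tl by fastforce
qed simp

text \<open>The letter \<open>x\<close> enters last and creates the leftmost of the new
  boxes.\<close>

lemma strip_least_column:
  "Tab T \<Longrightarrow> sorted_wrt (<) (x # v) \<Longrightarrow> reduced (x # v @ word_of T) \<Longrightarrow> j < new_col x (insw v T) \<Longrightarrow>
    card (col (insw (x # v) T) j) = card (col T j)"
proof (induction v arbitrary: x)
  case Nil
  then show ?case using card_ins[of x T j] by (simp add: insertable_def)
next
  case (Cons x' v)
  have r: "reduced (x' # v @ word_of T)" using Cons.prems(3) reduced_tl by auto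
  have "j < new_col x' (insw v T)" using strip_step[OF Cons.prems(1,2)] Cons.prems(3,4) by simp
  then have "card (col (insw (x' # v) T) j) = card (col T j)" using Cons.IH[of x'] Cons.prems(1,2) r by simp
  moreover have "insertable x (insw (x' # v) T)" using insertable_insw[of T x "x' # v"] Cons.prems by simp
  ultimately show ?case using card_ins[of x "insw (x' # v) T" j] Cons.prems(4) by simp
qed

text \<open>By \<open>strip_least_column\<close> the box created last lies in the first column in
  which the two shapes differ. It is thus fixed by the shapes, and \<open>ins_inj\<close> undoes the
  same step on both sides.\<close>

lemma strip_unique:
  "length v = length v' \<Longrightarrow> Tab T \<Longrightarrow> Tab T' \<Longrightarrow> sorted_wrt (<) v \<Longrightarrow> sorted_wrt (<) v' \<Longrightarrow>
    reduced (v @ word_of T) \<Longrightarrow> reduced (v' @ word_of T') \<Longrightarrow> (\<And>j. card (col T j) = card (col T' j)) \<Longrightarrow>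
    insw v T = insw v' T' \<Longrightarrow> v = v' \<and> T = T'"
proof (induction v v' rule: list_induct2)
  case (Cons x v x' v')
  have i: "insertable x (insw v T)" "insertable x' (insw v' T')" using insertable_insw Cons.prems by simp_all
  define k k' where "k = new_col x (insw v T)" and "k' = new_col x' (insw v' T')"
  have r: "reduced (v @ word_of T)" "reduced (v' @ word_of T')" using Cons.prems(5,6) reduced_tl by auto
  have "card (col T k) < card (col (insw (x # v) T) k)"
    using card_insw_ge[OF Cons.prems(1) r(1), of k] card_ins[OF i(1), of k] by (simp add: k_def)
  moreover have "card (col T' k') < card (col (insw (x' # v') T') k')"
    using card_insw_ge[OF Cons.prems(2) r(2), of k'] card_ins[OF i(2), of k'] by (simp add: k'_def)
  ultimately have "\<not> k < k'" "\<not> k' < k"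
    using strip_least_column[OF Cons.prems(1,3), of k'] strip_least_column[OF Cons.prems(2,4), of k]
      Cons.prems(5-8) by (auto simp: k_def k'_def)
  then have "k = k'" by simp
  then have "x = x' \<and> insw v T = insw v' T'"
    using ins_inj[OF i] Cons.prems(8) by (simp add: k_def k'_def)
  then show ?case using Cons.IH[OF Cons.prems(1,2) _ _ r Cons.prems(7)] Cons.prems(3,4) by simp
qed simp

lemma col_cards:
  assumes "map card T = map card T'"
  shows "card (col T j) = card (col T' j)"
proof -
  have l: "length T = length T'" using assms by (rule map_eq_imp_length_eq)
  show ?thesis
  proof (cases "j < length T")
    case True
    then have "card (T ! j) = card (T' ! j)" using assms l by (metis nth_map)
    then show ?thesis using l by (simp add: col_def)
  qed (use l in \<open>simp add: col_def\<close>)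
qed

text \<open>By \<open>suffix_shape\<close> the tableaux of corresponding suffixes have the same
  sorted column lengths, so \<open>strip_unique\<close> splits off equal first factors.\<close>

lemma factorization_unique:
  "length vs = length vs' \<Longrightarrow> map length vs = map length vs' \<Longrightarrow> \<forall>v\<in>set vs. sorted_wrt (<) v \<Longrightarrow> \<forall>v\<in>set vs'. sorted_wrt (<) v \<Longrightarrow>
    reduced (concat vs) \<Longrightarrow> reduced (concat vs') \<Longrightarrow> insw (concat vs) [] = P \<Longrightarrow> insw (concat vs') [] = P \<Longrightarrow>
    mset (map card P) = mset (map length vs) \<Longrightarrow> vs = vs'"
proof (induction vs vs' arbitrary: P rule: list_induct2)
  case (Cons v us v' us')
  let ?T = "insw (concat us) []" and ?T' = "insw (concat us') []"
  have r: "reduced (concat us)" "reduced (concat us')" using Cons.prems(4,5) reduced_append2 by auto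
  have T: "Tab ?T" "np (concat us) (word_of ?T)" "Tab ?T'" "np (concat us') (word_of ?T')"
    using insw_np[of "[]" "concat us"] insw_np[of "[]" "concat us'"] r by auto
  have l: "length v = length v'" "map length us = map length us'" using Cons.prems(1) by auto
  have m: "mset (map card ?T) = mset (map length us)" "mset (map card ?T') = mset (map length us')"
    using suffix_shape[of "[v]" us P] suffix_shape[of "[v']" us' P] Cons.prems l by auto
  then have "map card ?T = map card ?T'" using T l by (intro sorted_mset_unique Tab_cards_sorted) auto
  then have "card (col ?T j) = card (col ?T' j)" for j by (rule col_cards)
  moreover have "reduced (v @ word_of ?T)" "reduced (v' @ word_of ?T')"
    using np_reduced[OF np_append2[OF T(2), of v]] np_reduced[OF np_append2[OF T(4), of v']] Cons.prems(4,5) by simp_all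
  moreover have "insw v ?T = insw v' ?T'" using Cons.prems(6,7) by simp
  moreover have "sorted_wrt (<) v" "sorted_wrt (<) v'" "\<forall>v\<in>set us. sorted_wrt (<) v" "\<forall>v\<in>set us'. sorted_wrt (<) v"
    using Cons.prems(2,3) by simp_all
  ultimately have e: "v = v'" "?T' = ?T" using strip_unique[OF l(1) T(1,3)] by metis+
  have "us = us'"
    by (rule Cons.IH[OF l(2) _ _ r refl e(2) m(1)]) fact+
  with e(1) show ?case by simp
qed simp

text \<open>The lengths in \<open>us\<close> come in any order, while
  \<open>factorization_unique\<close> compares equal sequences of lengths. Replacing
  \<open>us\<close> by the columns of its insertion tableau sorts them into the order that
  \<open>key_factorization\<close> produces.\<close>

lemma last_factor:
  assumes P: "Tab P" "reduced (word_of P)" and j: "j < length P"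
    and vs: "np (word_of P) (concat (us @ [v]))" "\<forall>v\<in>set (us @ [v]). sorted_wrt (<) v"
      "mset (map length (us @ [v])) = mset (map card P)" "length v = card (P ! j)"
  shows "set v = right_key P j"
proof -
  let ?T = "insw (concat us) []"
  have r: "reduced (concat us @ v)" using vs(1) P(2) np_reduced by simp
  then have ru: "reduced (concat us)" using reduced_append1 by blast
  have T: "Tab ?T" "np (concat us) (word_of ?T)" using insw_np[of "[]" "concat us"] ru by auto
  define ws where "ws = map asc ?T @ [v]"
  have nw: "np (concat us @ v) (concat ws)" using np_append1[OF T(2), of v] by (simp add: ws_def word_of_def)
  then have nP: "np (word_of P) (concat ws)" using np_trans vs(1) by simp
  have rw: "reduced (concat ws)" using nP P(2) np_reduced by blast
  have iw: "insw (concat ws) [] = P" using insw_invariant[OF nP P(2)] insw_word_of[OF P] by simp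
  have sw: "\<forall>v\<in>set ws. sorted_wrt (<) v" using vs(2) by (auto simp: ws_def)
  have lw: "map length ws = map card ?T @ [length v]" by (simp add: ws_def)
  define R where "R = take j P @ drop (Suc j) P"
  have PR: "P = take j P @ P ! j # drop (Suc j) P" using j by (simp add: id_take_nth_drop)
  have mP: "mset (map card P) = add_mset (card (P ! j)) (mset (map card R))"
    by (subst PR) (simp add: R_def)
  have mu: "mset (map length us) = mset (map card R)" using vs(3,4) mP by simp
  \<comment> \<open>The factors in \<open>us\<close> bound the shape from below, and adding
    \<open>v\<close> to its columns bounds it from above by the shape of \<open>P\<close>.\<close>
  have "mset (map card ?T) = mset (map length us)"
  proof (rule mset_eq_deep)
    fix i
    have "deep i (map length us) \<le> deep i (map card ?T)" using deep_factors[of us "[]" i] vs(2) ru by simp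
    moreover have "deep i (map length ws) \<le> deep i (map card P)" using deep_factors[OF sw, of "[]" i] iw rw by simp
    moreover have "deep i (map card P) = deep i (map length us) + (length v - i)"
      using deep_mset[OF vs(3), of i] by simp
    ultimately show "deep i (map card ?T) = deep i (map length us)" using lw by simp
  next
    show "0 \<notin> set (map card ?T)" by (rule Tab_cards_pos[OF T(1)])
    show "0 \<notin> set (map length us)"
      using Tab_cards_pos[OF P(1)] mset_eq_setD[OF vs(3)] by (metis UnI1 map_append set_append)
  qed
  then have m: "mset (map card ?T) = mset (map card R)" using mu by simp
  have "sorted_wrt (\<ge>) (map card (take j P @ P ! j # drop (Suc j) P))"
    using Tab_cards_sorted[OF P(1)] PR by metis
  then have "sorted_wrt (\<ge>) (map card R)" by (auto simp: R_def sorted_wrt_append)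
  then have cT: "map card ?T = map card R" using m Tab_cards_sorted[OF T(1)] by (intro sorted_mset_unique)
  obtain es where es: "map length es = map card R" "\<forall>e\<in>set es. sorted_wrt (<) e"
      "np (word_of P) (concat es @ asc (right_key P j))"
    using key_factorization[OF P j] by (auto simp: R_def)
  define xs where "xs = es @ [asc (right_key P j)]"
  have nx: "np (word_of P) (concat xs)" using es(3) by (simp add: xs_def)
  have "length (asc (right_key P j)) = length v" using card_right_key[OF P(1), of j] vs(4) j by (simp add: col_def)
  then have lx: "map length ws = map length xs" using lw cT es(1) by (simp add: xs_def)
  have "ws = xs"
  proof (rule factorization_unique[where P = P])
    show "length ws = length xs" using lx by (metis length_map)
    show "\<forall>v\<in>set xs. sorted_wrt (<) v" using es(2) by (auto simp: xs_def)
    show "reduced (concat xs)" using nx P(2) np_reduced by blast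
    show "insw (concat xs) [] = P" using insw_invariant[OF nx P(2)] insw_word_of[OF P] by simp
    show "mset (map card P) = mset (map length ws)" using lw cT mP vs(4) by simp
  qed (use lx sw rw iw in auto)
  then have "v = asc (right_key P j)" by (simp add: ws_def xs_def)
  then show ?thesis by simp
qed

subsection \<open>Fillings as lists of columns\<close>

declare EG_from.simps [simp del] hecke_from.simps [simp del]

abbreviation dc :: "nat set \<Rightarrow> nat list" where
  "dc \<equiv> decreasing_column"

lemma dc_unique: "sorted_wrt (>) l \<Longrightarrow> dc (set l) = l"
proof -
  assume "sorted_wrt (>) l"
  then have "asc (set l) = rev l" by (intro asc_unique) (auto simp: sorted_wrt_rev)
  then show ?thesis by (simp add: decreasing_column_def)
qed

lemma set_dc [simp]: "finite S \<Longrightarrow> set (dc S) = S"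
  by (simp add: decreasing_column_def)

lemma length_dc [simp]: "length (dc S) = card S"
  by (simp add: decreasing_column_def)

lemma sorted_dc [simp]: "sorted_wrt (>) (dc S)"
  by (simp add: decreasing_column_def sorted_wrt_rev)

lemma rev_dc [simp]: "rev (dc S) = asc S"
  by (simp add: decreasing_column_def)

lemma dc_append: "finite C \<Longrightarrow> \<forall>z\<in>C. x < z \<Longrightarrow> dc C @ [x] = dc (insert x C)"
  using asc_insert_less[of C x] by (simp add: decreasing_column_def)

lemma up_set_card: "distinct c \<Longrightarrow> up (set c) t = card {r. r < length c \<and> t \<le> c ! r}"
proof -
  assume d: "distinct c"
  have "{x \<in> set c. t \<le> x} = (!) c ` {r. r < length c \<and> t \<le> c ! r}"
    by (auto simp: in_set_conv_nth)
  moreover have "inj_on ((!) c) {r. r < length c \<and> t \<le> c ! r}"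
    using d by (auto simp: inj_on_def nth_eq_iff_index_eq)
  ultimately show ?thesis by (simp add: up_def card_image)
qed

lemma decreasing_distinct: "sorted_wrt (>) c \<Longrightarrow> distinct c" for c :: "nat list"
  by (induction c) auto

text \<open>\<open>e = 1\<close> describes strict rows and \<open>e = 0\<close> weak ones.\<close>

lemma columns_compare:
  assumes c: "sorted_wrt (>) c" and d: "sorted_wrt (>) d"
  shows "(length d \<le> length c \<and> (\<forall>r<length d. d ! r + e \<le> c ! r)) \<longleftrightarrow> (\<forall>t. up (set d) t \<le> up (set c) (t + e))"
proof -
  have dist: "distinct c" "distinct d" using c d decreasing_distinct by blast+
  note u = up_set_card[OF dist(1)] up_set_card[OF dist(2)]
  show ?thesis
  proof
    assume a: "length d \<le> length c \<and> (\<forall>r<length d. d ! r + e \<le> c ! r)"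
    show "\<forall>t. up (set d) t \<le> up (set c) (t + e)" unfolding u
    proof
      fix t
      have "{r. r < length d \<and> t \<le> d ! r} \<subseteq> {r. r < length c \<and> t + e \<le> c ! r}"
        using a by (auto intro: le_trans[OF add_right_mono])
      then show "card {r. r < length d \<and> t \<le> d ! r} \<le> card {r. r < length c \<and> t + e \<le> c ! r}"
        by (intro card_mono) auto
    qed
  next
    assume a: "\<forall>t. up (set d) t \<le> up (set c) (t + e)"
    \<comment> \<open>At the threshold \<open>d ! r\<close> the list \<open>d\<close> has at least
      \<open>r + 1\<close> entries, but a failure at \<open>r\<close> would leave at most
      \<open>r\<close> entries for \<open>c\<close>.\<close>
    have *: "r < length c \<and> d ! r + e \<le> c ! r" if r: "r < length d" for r
    proof (rule ccontr)
      assume n: "\<not> (r < length c \<and> d ! r + e \<le> c ! r)"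
      have "{s. s < length c \<and> d ! r + e \<le> c ! s} \<subseteq> {..<r}"
      proof
        fix s assume s: "s \<in> {s. s < length c \<and> d ! r + e \<le> c ! s}"
        have "c ! s \<le> c ! r" if "r \<le> s" using that s c
          by (cases "r = s") (auto simp: sorted_wrt_iff_nth_less less_imp_le)
        then show "s \<in> {..<r}" using s n by (auto simp: not_less[symmetric] intro: ccontr)
      qed
      then have "card {s. s < length c \<and> d ! r + e \<le> c ! s} \<le> r" using card_mono[of "{..<r}"] by fastforce
      moreover have "{..r} \<subseteq> {s. s < length d \<and> d ! r \<le> d ! s}"
      proof
        fix s assume s: "s \<in> {..r}"
        then show "s \<in> {s. s < length d \<and> d ! r \<le> d ! s}"
          using r d by (cases "s = r") (auto simp: sorted_wrt_iff_nth_less less_imp_le)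
      qed
      then have "Suc r \<le> card {s. s < length d \<and> d ! r \<le> d ! s}" using card_mono[of _ "{..r}"] by fastforce
      moreover have "card {s. s < length d \<and> d ! r \<le> d ! s} \<le> card {s. s < length c \<and> d ! r + e \<le> c ! s}"
        using a[rule_format, of "d ! r"] unfolding u .
      ultimately show False by simp
    qed
    have "length d \<le> length c" using *[of "length c"] by (meson less_irrefl not_le)
    then show "length d \<le> length c \<and> (\<forall>r<length d. d ! r + e \<le> c ! r)" using * by blast
  qed
qed

text \<open>The common form of \<open>decreasing_tableau\<close> and \<open>RSSYT\<close>, which
  differ only in the relation along rows.\<close>

definition filling_wrt :: "(nat \<Rightarrow> nat \<Rightarrow> bool) \<Rightarrow> nat filling \<Rightarrow> bool" where
  "filling_wrt R T \<longleftrightarrow> partition_shape T \<and> (\<forall>C\<in>set T. positive_word C) \<and> (\<forall>C\<in>set T. sorted_wrt (>) C) \<and> rows_wrt R T"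

lemma rows_wrt_Cons: "rows_wrt R (C # T) \<longleftrightarrow> (T \<noteq> [] \<longrightarrow> (\<forall>r<length (hd T). R (C ! r) (hd T ! r))) \<and> rows_wrt R T"
proof (cases T)
  case (Cons D U)
  have "(\<forall>j<length T. \<forall>r<length ((C # T) ! Suc j). R ((C # T) ! j ! r) ((C # T) ! Suc j ! r)) \<longleftrightarrow>
      (\<forall>r<length D. R (C ! r) (D ! r)) \<and> (\<forall>j<length T - 1. \<forall>r<length (T ! Suc j). R (T ! j ! r) (T ! Suc j ! r))"
    using Cons by (auto simp: less_Suc_eq_0_disj all_conj_distrib)
  then show ?thesis using Cons by (simp add: rows_wrt_def)
qed (simp add: rows_wrt_def)

lemma filling_wrt_Cons: "filling_wrt R (C # T) \<longleftrightarrow> C \<noteq> [] \<and> positive_word C \<and> sorted_wrt (>) C \<and>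
   (T \<noteq> [] \<longrightarrow> length (hd T) \<le> length C \<and> (\<forall>r<length (hd T). R (C ! r) (hd T ! r))) \<and> filling_wrt R T"
proof -
  have "(\<forall>D\<in>set T. length D \<le> length C) \<longleftrightarrow> (T \<noteq> [] \<longrightarrow> length (hd T) \<le> length C)"
    if "sorted_wrt (\<ge>) (map length T)"
    using that by (cases T) auto
  then show ?thesis unfolding filling_wrt_def partition_shape_def rows_wrt_Cons by auto
qed

lemma filling_wrt_Nil [simp]: "filling_wrt R []"
  by (simp add: filling_wrt_def partition_shape_def rows_wrt_def)

lemma decreasing_tableau_iff: "decreasing_tableau T \<longleftrightarrow> Tab (map set T) \<and> (\<forall>C\<in>set T. sorted_wrt (>) C)"
proof -
  have "filling_wrt (>) T \<longleftrightarrow> Tab (map set T) \<and> (\<forall>C\<in>set T. sorted_wrt (>) C)"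
  proof (induction T)
    case (Cons C T)
    have "length (hd T) \<le> length C \<and> (\<forall>r<length (hd T). C ! r > hd T ! r) \<longleftrightarrow> dom (set C) (fcol (map set T))"
      if "T \<noteq> []" "sorted_wrt (>) C" "\<forall>C\<in>set T. sorted_wrt (>) C"
      using columns_compare[of C "hd T" 1] that by (cases T) (auto simp: dom_def Suc_le_eq)
    moreover have "positive_word C \<longleftrightarrow> 0 \<notin> set C" by (auto intro: gr0I)
    ultimately show ?case unfolding filling_wrt_Cons Cons.IH by (cases "T = []") auto
  qed simp
  then show ?thesis by (simp add: filling_wrt_def decreasing_tableau_def)
qed

lemma RSSYT_iff: "RSSYT T \<longleftrightarrow> WTab (map set T) \<and> (\<forall>C\<in>set T. sorted_wrt (>) C)"
proof -
  have "filling_wrt (\<ge>) T \<longleftrightarrow> WTab (map set T) \<and> (\<forall>C\<in>set T. sorted_wrt (>) C)"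
  proof (induction T)
    case (Cons C T)
    have "length (hd T) \<le> length C \<and> (\<forall>r<length (hd T). C ! r \<ge> hd T ! r) \<longleftrightarrow> wdom (set C) (fcol (map set T))"
      if "T \<noteq> []" "sorted_wrt (>) C" "\<forall>C\<in>set T. sorted_wrt (>) C"
      using columns_compare[of C "hd T" 0] that by (cases T) (auto simp: wdom_def)
    moreover have "positive_word C \<longleftrightarrow> 0 \<notin> set C" by (auto intro: gr0I)
    ultimately show ?case unfolding filling_wrt_Cons Cons.IH by (cases "T = []") auto
  qed simp
  then show ?thesis by (simp add: filling_wrt_def RSSYT_def)
qed

abbreviation lst :: "nat set list \<Rightarrow> nat filling" where
  "lst T \<equiv> map dc T"

lemma map_set_lst: "\<forall>C\<in>set T. finite C \<Longrightarrow> map set (lst T) = T"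
  by (simp add: map_idI)

lemma lst_map_set: "\<forall>C\<in>set T. sorted_wrt (>) C \<Longrightarrow> lst (map set T) = T"
  by (simp add: map_idI dc_unique)

lemma tableau_word_lst: "tableau_word (lst T) = word_of T"
  by (simp add: tableau_word_def word_of_def o_def)

lemma decreasing_tableau_lst: "\<forall>C\<in>set T. finite C \<Longrightarrow> decreasing_tableau (lst T) \<longleftrightarrow> Tab T"
  by (simp add: decreasing_tableau_iff map_set_lst del: map_map)

lemma RSSYT_lst: "\<forall>C\<in>set T. finite C \<Longrightarrow> RSSYT (lst T) \<longleftrightarrow> WTab T"
  by (simp add: RSSYT_iff map_set_lst del: map_map)

lemma rdt_lst: "Tab T \<Longrightarrow> reduced (word_of T) \<Longrightarrow> reduced_decreasing_tableau (lst T)"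
  using Tab_mem by (simp add: reduced_decreasing_tableau_def decreasing_tableau_lst tableau_word_lst)

lemma rdtE:
  assumes "reduced_decreasing_tableau P"
  obtains T where "P = lst T" "Tab T" "reduced (word_of T)"
proof -
  have T: "Tab (map set P)" "P = lst (map set P)"
    using assms lst_map_set unfolding reduced_decreasing_tableau_def decreasing_tableau_iff by metis+
  then have "reduced (word_of (map set P))"
    using assms tableau_word_lst unfolding reduced_decreasing_tableau_def by metis
  then show ?thesis using that T by blast
qed

subsection \<open>Edelman--Greene and Hecke insertion\<close>

lemma largest_below_dc:
  assumes "good x C" "out x C \<noteq> 0"
  shows "largest_below x (dc C) = out x C"
proof -
  have f: "finite C" using assms by (simp add: good_def)
  have "Max {z \<in> C. z < x} = out x C"
    using out_in[OF assms] out_less[OF assms(1)] out_gap[OF assms(1)] f by (intro Max_eqI) auto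
  then show ?thesis using f by (simp add: largest_below_def)
qed

lemma replace_entry_dc:
  assumes "good x C" "x \<notin> C" "out x C \<noteq> 0"
  shows "replace_entry (out x C) x (dc C) = dc (bump x C)"
proof -
  define y where "y = out x C"
  have f: "finite C" using assms by (simp add: good_def)
  have y: "y \<in> C" "y < x" "\<And>z. z \<in> C \<Longrightarrow> z < x \<Longrightarrow> z \<le> y"
    using out_in[OF assms(1,3)] out_less[OF assms(1)] out_gap[OF assms(1)] by (auto simp: y_def)
  have "sorted_wrt (>) (replace_entry y x (dc C))"
    unfolding replace_entry_def sorted_wrt_map
  proof (rule sorted_wrt_mono_rel[OF _ sorted_dc])
    fix a b assume "a \<in> set (dc C)" "b \<in> set (dc C)" "b < a"
    then have ab: "a \<in> C" "b \<in> C" "b < a" using f by auto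
    have "a \<noteq> x" "b \<noteq> x" using ab assms(2) by auto
    then have "a < x \<or> x < a" by linarith
    then show "(if b = y then x else b) < (if a = y then x else a)"
      using ab y(2) y(3)[of a] y(3)[of b] by auto
  qed
  moreover have "set (replace_entry y x (dc C)) = bump x C"
    using f y assms(2) by (auto simp: replace_entry_def bump_def y_def[symmetric])
  ultimately show ?thesis using dc_unique y_def by metis
qed

lemma column_lst: "column (lst (pre @ C # U)) (length pre) = dc C" "column (lst pre) (length pre) = []"
  by (simp_all add: column_def nth_append)

lemma set_column_lst: "set_column (lst (pre @ C # U)) (length pre) (dc D) = lst (pre @ D # U)"
  "set_column (lst pre) (length pre) (dc D) = lst (pre @ [D])"
  by (simp_all add: set_column_def list_update_append)

text \<open>\<open>pre\<close> holds the columns already passed, so that the recursion on the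
  starting column becomes an induction over the remaining ones.\<close>

lemma EG_from_lst:
  "insertable x U \<Longrightarrow> EG_from (length pre) x (lst (pre @ U)) =
    (lst (pre @ ins x U), (card (col U (new_col x U)), length pre + new_col x U))"
proof (induction U arbitrary: pre x)
  case Nil
  have "0 < x" using Nil insertable_pos by auto
  moreover have "[x] = dc {x}" by (simp add: decreasing_column_def)
  ultimately show ?case
    by (subst EG_from.simps) (simp add: column_lst set_column_lst Let_def)
next
  case (Cons C U)
  have p: "0 < x" using Cons.prems by (rule insertable_pos)
  have g: "good x C" by (rule insertable_good_Cons[OF Cons.prems])
  have f: "finite C" using g by (simp add: good_def)
  show ?case
  proof (cases "out x C = 0")
    case True
    then have lt: "\<forall>z\<in>C. x < z" using out_0_iff[OF g] by simp
    have "dc C @ [x] = dc (bump x C)" using dc_append[OF f lt] bump_append[OF g True] by simp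
    then show ?thesis using lt p f True
      by (subst EG_from.simps) (simp add: column_lst set_column_lst Let_def del: map_append list.map)
  next
    case False
    have nlt: "\<not> (\<forall>z\<in>C. x < z)" using False out_0_iff[OF g] by simp
    note IH = Cons.IH[OF insertable_next[OF Cons.prems False], of "pre @ [bump x C]"]
    show ?thesis
    proof (cases "x \<in> C")
      case True
      have "EG_from (length pre) x (lst (pre @ C # U)) = EG_from (Suc (length pre)) (out x C) (lst (pre @ C # U))"
        using True f out_mem[OF g True]
        by (subst EG_from.simps) (simp only: column_lst Let_def if_not_P[OF nlt] set_dc if_True)
      then show ?thesis using IH True p False by (simp add: bump_mem)
    next
      case n: False
      have "EG_from (length pre) x (lst (pre @ C # U)) =
          EG_from (Suc (length pre)) (out x C) (set_column (lst (pre @ C # U)) (length pre) (dc (bump x C)))"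
        using n f
        by (subst EG_from.simps) (simp only: column_lst Let_def if_not_P[OF nlt] set_dc if_False
          largest_below_dc[OF g False] replace_entry_dc[OF g n False])
      then show ?thesis using IH n p False by (simp add: set_column_lst del: map_append list.map)
    qed
  qed
qed

lemma Tab_append_cong:
  "Tab (pre @ U) \<Longrightarrow> Tab U' \<Longrightarrow> (pre \<noteq> [] \<Longrightarrow> dom (last pre) (fcol U')) \<Longrightarrow> Tab (pre @ U')"
proof (induction pre)
  case (Cons C pre)
  then show ?case by (cases pre) auto
qed simp

lemma Tab_appendD: "Tab (pre @ U) \<Longrightarrow> Tab U"
  by (induction pre) auto

lemma Tab_append_dom: "Tab (pre @ U) \<Longrightarrow> pre \<noteq> [] \<Longrightarrow> finite (last pre) \<and> dom (last pre) (fcol U)"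
proof (induction pre)
  case (Cons C pre)
  then show ?case by (cases pre) auto
qed simp

lemma Tab_finite_mem: "Tab T \<Longrightarrow> \<forall>C\<in>set T. finite C"
  using Tab_mem by blast

text \<open>For a reduced word the two insertions agree. If \<open>x\<close> is in the column then replacing \<open>x - 1\<close> by \<open>x\<close> would
  repeat \<open>x\<close>; otherwise \<open>valid\<close> guarantees that the replacement keeps the rows decreasing.\<close>

lemma hecke_from_lst:
  "insertable x U \<Longrightarrow> Tab (pre @ U) \<Longrightarrow> (pre \<noteq> [] \<Longrightarrow> valid (last pre) (fcol U) x) \<Longrightarrow>
    hecke_from (length pre) x (lst (pre @ U)) =
    (lst (pre @ ins x U), (card (col U (new_col x U)), length pre + new_col x U), 1)"
proof (induction U arbitrary: pre x)
  case Nil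
  have p: "0 < x" using Nil insertable_pos by auto
  have d: "[x] = dc {x}" by (simp add: decreasing_column_def)
  have "dom (last pre) {x}" if "pre \<noteq> []"
    using dom_bump[of "last pre" "{}" x] Tab_append_dom[OF Nil(2) that] Nil(3)[OF that] p by simp
  then have "Tab (pre @ [{x}])" using p Tab_append_cong[OF Nil(2), of "[{x}]"] by simp
  then have "decreasing_tableau (lst (pre @ [{x}]))" using decreasing_tableau_lst[OF Tab_finite_mem] by metis
  then have "hecke_from (length pre) x (lst pre) = (lst (pre @ [{x}]), (0, length pre), 1)"
    by (subst hecke_from.simps) (simp only: column_lst Let_def list.set ball_empty append_Nil d set_column_lst
      if_True list.size)
  then show ?case using p by simp
next
  case (Cons C U)
  have p: "0 < x" using Cons.prems(1) by (rule insertable_pos)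
  have g: "good x C" by (rule insertable_good_Cons[OF Cons.prems(1)])
  have f: "finite C" using g by (simp add: good_def)
  have CU: "Tab (C # U)" using Cons.prems(2) by (rule Tab_appendD)
  have "dom (bump x C) (fcol U)" using CU up_bump_ge[OF g] unfolding Tab.simps dom_def by (meson le_trans)
  then have "Tab (bump x C # U)" using CU p bump_0[of C x] bump_in[of x C] by (auto simp del: bump_in)
  moreover have "dom (last pre) (bump x C)" if "pre \<noteq> []"
    using dom_bump[OF _ _ g] Tab_append_dom[OF Cons.prems(2) that] Cons.prems(3)[OF that] by simp
  ultimately have T': "Tab (pre @ bump x C # U)" using Tab_append_cong[OF Cons.prems(2), of "bump x C # U"] by simp
  then have dt: "decreasing_tableau (lst (pre @ bump x C # U))" using decreasing_tableau_lst[OF Tab_finite_mem] by metis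
  show ?case
  proof (cases "out x C = 0")
    case True
    then have lt: "\<forall>z\<in>C. x < z" using out_0_iff[OF g] by simp
    then have le: "\<forall>z\<in>set (dc C). x \<le> z" using f by auto
    have "dc C @ [x] = dc (bump x C)" using dc_append[OF f lt] bump_append[OF g True] by simp
    then show ?thesis using le p f True dt
      by (subst hecke_from.simps) (simp add: column_lst set_column_lst Let_def del: map_append list.map)
  next
    case False
    have "out x C \<in> set (dc C)" using out_in[OF g False] f by simp
    then have nle: "\<not> (\<forall>z\<in>set (dc C). x \<le> z)" using out_less[OF g] by fastforce
    have v: "valid (bump x C) (fcol U) (out x C)"
      using valid_next(2)[OF _ _ g False] CU Tab_finite by simp
    note IH = Cons.IH[OF insertable_next[OF Cons.prems(1) False], of "pre @ [bump x C]"]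
    have step: "hecke_from (length pre) x (lst (pre @ C # U)) =
        hecke_from (Suc (length pre)) (out x C) (lst (pre @ bump x C # U))"
    proof (cases "x \<in> C")
      case True
      define L where "L = replace_entry (out x C) x (dc C)"
      have "\<not> distinct L"
      proof -
        have "set L \<subseteq> C - {out x C}" using out_less[OF g] True f by (auto simp: L_def replace_entry_def)
        then have "card (set L) \<le> card (C - {out x C})" using f by (intro card_mono) auto
        also have "\<dots> < length L" using card_Diff1_less[OF f out_in[OF g False]] by (simp add: L_def replace_entry_def)
        finally show ?thesis using distinct_card by fastforce
      qed
      then have "\<not> sorted_wrt (>) L"
        using decreasing_distinct by blast
      then have "\<not> decreasing_tableau (set_column (lst (pre @ C # U)) (length pre) L)"
        by (auto simp: decreasing_tableau_iff set_column_def list_update_append)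
      then show ?thesis unfolding bump_mem[OF True]
        by (subst hecke_from.simps) (simp only: column_lst Let_def largest_below_dc[OF g False] L_def
          if_not_P[OF nle] if_False)
    next
      case n: False
      show ?thesis using dt
        by (subst hecke_from.simps) (simp only: column_lst Let_def largest_below_dc[OF g False]
          replace_entry_dc[OF g n False] set_column_lst if_not_P[OF nle] if_True)
    qed
    show ?thesis unfolding step using IH T' v p False by simp
  qed
qed

lemma adjoin_box_lst:
  assumes "k \<le> length Q" "\<forall>z\<in>col Q k. y < z" "finite (col Q k)"
  shows "adjoin_box (r, k) y (lst Q) = lst (add_box k y Q)"
proof -
  have "column (lst Q) k @ [y] = dc (insert y (col Q k))"
    using dc_append[OF assms(3,2)] by (cases "k < length Q") (auto simp: column_def col_def decreasing_column_def)
  then show ?thesis using assms(1) by (auto simp: add_box_def set_column_def map_update col_def)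
qed

lemma adjoin_box_set_valued: "adjoin_box c {y} (set_valued Q) = set_valued (adjoin_box c y Q)"
  by (cases c) (auto simp: set_valued_def column_def set_column_def map_update)

text \<open>On reduced biwords each insertion creates a box, so \<alpha> is always 1 and the
  recorded sets remain singletons.\<close>

lemma Insert_run:
  "reduced_biword ps \<Longrightarrow> run ps = (P, Q) \<Longrightarrow> foldl EG_step ([], []) ps = (lst P, lst Q) \<and>
    foldl Insert_step ([], []) ps = (lst P, set_valued (lst Q))"
proof (induction ps arbitrary: P Q rule: rev_induct)
  case Nil
  then show ?case by (simp add: set_valued_def)
next
  case (snoc p ps)
  obtain x y where p: "p = (x, y)" by fastforce
  obtain P' Q' where r: "run ps = (P', Q')" by fastforce
  have c: "reduced_biword ps" using reduced_biword_snocD[OF snoc.prems(1)] .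
  note st = run_step[OF run_inv_reduced_biword[OF c] snoc.prems(1)[unfolded p] r]
  have R: "P = ins x P'" "Q = add_box (new_col x P') y Q'" using run_snoc[OF r] p snoc.prems(2) by auto
  have tab_pair: "tab_pair P' Q'" using run_inv_reduced_biword[OF c] r by (auto simp: run_inv_def)
  have "EG_from 0 x (lst P') = (lst P, (card (col P' (new_col x P')), new_col x P'))"
    "hecke_insert x (lst P') = (lst P, (card (col P' (new_col x P')), new_col x P'), 1)"
    using EG_from_lst[OF st(1), of "[]"] hecke_from_lst[OF st(1), of "[]"] tab_pair R(1) by (simp_all add: tab_pair_def hecke_insert_def)
  moreover have "adjoin_box (card (col P' (new_col x P')), new_col x P') y (lst Q') = lst Q"
    unfolding R(2) using st(2,5) finite_colQ tab_pair by (intro adjoin_box_lst) (auto simp: tab_pair_def)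
  ultimately show ?case using snoc.IH[OF c r] p
    by (simp add: EG_step_def Insert_step_def adjoin_box_set_valued del: adjoin_box.simps)
qed

subsection \<open>Keys of fillings\<close>

lemma K_plus_lst: "K_plus (lst P) = map (\<lambda>j. dc (right_key P j)) [0..<length P]"
  by (simp add: K_plus_def right_key_def drop_map tableau_word_lst)

lemma K_minus_lst:
  assumes "\<forall>C\<in>set Q. finite C"
  shows "K_minus (lst Q) = map (\<lambda>k. dc (left_key Q k)) [0..<length Q]"
proof -
  have "columns_tri (map set (take (Suc k) (lst Q))) = left_key Q k" if "k < length Q" for k
  proof -
    have "map set (take (Suc k) (lst Q)) = take k Q @ [col Q k]"
      unfolding take_map[symmetric] map_set_lst[OF assms] using that by (simp add: take_Suc_conv_app_nth col_def)
    then show ?thesis by (simp add: columns_tri_foldr left_key_def)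
  qed
  then show ?thesis by (simp add: K_minus_def)
qed

lemma key_ge_lst:
  assumes "tab_pair P Q"
  shows "key_ge (K_plus (lst P)) (K_minus (lst Q)) \<longleftrightarrow> (\<forall>j. wdom (right_key P j) (left_key Q j))"
proof -
  have T: "Tab P" "WTab Q" and c: "\<And>j. card (col P j) = card (col Q j)" and l: "length P = length Q"
    using assms tab_pair_length by (auto simp: tab_pair_def)
  have fin: "\<forall>C\<in>set Q. finite C" using WTab_mem[OF T(2)] by blast
  have "list_all2 (\<ge>) (dc (right_key P j)) (dc (left_key Q j)) \<longleftrightarrow> wdom (right_key P j) (left_key Q j)" for j
  proof -
    have "card (right_key P j) = card (left_key Q j)" using card_right_key[OF T(1)] card_left_key[OF T(2)] c by simp
    then show ?thesis
      using columns_compare[OF sorted_dc sorted_dc, of "left_key Q j" "right_key P j" 0] finite_left_key[OF T(2)]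
      by (auto simp: list_all2_conv_all_nth wdom_def)
  qed
  moreover have "wdom (right_key P j) (left_key Q j)" if "\<not> j < length P" for j
    using that l by (simp add: right_key_def left_key_def col_def tri_empty)
  ultimately show ?thesis unfolding key_ge_def K_plus_lst K_minus_lst[OF fin]
    by (auto simp: list_all2_conv_all_nth l)
qed

lemma Tb0_iff: "(P, Q) \<in> Tb0 \<longleftrightarrow> (\<exists>T U. P = lst T \<and> Q = lst U \<and> tab_pair T U \<and> (\<forall>j. wdom (right_key T j) (left_key U j)))"
proof
  assume "(P, Q) \<in> Tb0"
  then have a: "col_lengths P = col_lengths Q" "reduced_decreasing_tableau P" "RSSYT Q" "key_ge (K_plus P) (K_minus Q)"
    by (auto simp: Tb0_def)
  obtain T where T: "P = lst T" "Tab T" "reduced (word_of T)" using rdtE[OF a(2)] .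
  define U where "U = map set Q"
  have U: "WTab U" "Q = lst U" using a(3) lst_map_set[of Q] by (auto simp: RSSYT_iff U_def)
  have "map card T = map card U" using a(1) T(1) U(2) by (simp add: o_def)
  then have "tab_pair T U" using T U col_cards[of T U] by (simp add: tab_pair_def)
  then show "\<exists>T U. P = lst T \<and> Q = lst U \<and> tab_pair T U \<and> (\<forall>j. wdom (right_key T j) (left_key U j))"
    using a(4) T U key_ge_lst by metis
next
  assume "\<exists>T U. P = lst T \<and> Q = lst U \<and> tab_pair T U \<and> (\<forall>j. wdom (right_key T j) (left_key U j))"
  then obtain T U where a: "P = lst T" "Q = lst U" "tab_pair T U" "\<forall>j. wdom (right_key T j) (left_key U j)" by blast
  have "map card T = map card U"
  proof (rule nth_equalityI)
    show "length (map card T) = length (map card U)" using tab_pair_length[OF a(3)] by simp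
    fix j assume "j < length (map card T)"
    moreover have "card (col T j) = card (col U j)" using a(3) by (simp add: tab_pair_def)
    ultimately show "map card T ! j = map card U ! j" using tab_pair_length[OF a(3)] by (simp add: col_def)
  qed
  then have "col_lengths P = col_lengths Q" using a by (simp add: o_def)
  moreover have "\<forall>C\<in>set U. finite C" using a(3) WTab_mem by (auto simp: tab_pair_def)
  ultimately show "(P, Q) \<in> Tb0" using a rdt_lst[of T] RSSYT_lst[of U] key_ge_lst[OF a(3)] by (simp add: Tb0_def tab_pair_def)
qed

section \<open>Compatible pairs as biwords, and the bijection\<close>

lemma reduced_biword_iff: "reduced_biword ps \<longleftrightarrow> compatible (map fst ps) (map snd ps) \<and> reduced (map fst ps)"
proof -
  have "successively (\<lambda>p q. snd p = snd q \<longrightarrow> fst p < fst q) ps \<longleftrightarrow>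
     (\<forall>j. Suc j < length ps \<longrightarrow> snd (ps ! j) = snd (ps ! Suc j) \<longrightarrow> fst (ps ! j) < fst (ps ! Suc j))"
    by (simp add: successively_conv_nth)
  then show ?thesis unfolding reduced_biword_def compat_def compatible_def
    by (auto simp: sorted_wrt_map reduced_iff)
qed

lemma Cb0_iff: "(a, i) \<in> Cb0 \<longleftrightarrow> (\<exists>ps. a = map fst ps \<and> i = map snd ps \<and> reduced_biword ps \<and> (\<forall>p\<in>set ps. snd p \<le> fst p))"
proof
  assume a: "(a, i) \<in> Cb0"
  then have l: "length a = length i" by (auto simp: Cb0_def bounded_compatible_def compatible_def)
  then have m: "map fst (zip a i) = a" "map snd (zip a i) = i" by simp_all
  have "reduced_biword (zip a i)" "\<forall>p\<in>set (zip a i). snd p \<le> fst p"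
    using a m l unfolding reduced_biword_iff by (auto simp: Cb0_def bounded_compatible_def in_set_zip)
  then show "\<exists>ps. a = map fst ps \<and> i = map snd ps \<and> reduced_biword ps \<and> (\<forall>p\<in>set ps. snd p \<le> fst p)" using m by metis
qed (auto simp: Cb0_def bounded_compatible_def reduced_biword_iff)

lemma zip_map_fst_snd: "zip (map fst ps) (map snd ps) = ps"
  by (induction ps) auto

lemma Insert_Cb0:
  assumes "reduced_biword ps" "run ps = (P, Q)"
  shows "Insert (map fst ps, map snd ps) = (lst P, set_valued (lst Q))"
    "EG_Insert (map fst ps, map snd ps) = (lst P, lst Q)"
  using Insert_run[OF assms] by (simp_all add: Insert_def EG_Insert_def zip_map_fst_snd)

lemma set_valued_inj: "set_valued Q = set_valued Q' \<Longrightarrow> Q = Q'"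
proof -
  have "inj (map (map (\<lambda>x. {x})))" by (intro inj_mapI) (simp add: inj_def)
  then show "set_valued Q = set_valued Q' \<Longrightarrow> Q = Q'" unfolding set_valued_def by (rule injD)
qed

lemma lst_inj: "\<forall>C\<in>set T. finite C \<Longrightarrow> \<forall>C\<in>set T'. finite C \<Longrightarrow> lst T = lst T' \<Longrightarrow> T = T'"
  using map_set_lst by metis

lemma tab_pair_finite: "tab_pair P Q \<Longrightarrow> (\<forall>C\<in>set P. finite C) \<and> (\<forall>C\<in>set Q. finite C)"
  using Tab_mem WTab_mem by (auto simp: tab_pair_def)

lemma Insert_bij: "bij_betw Insert Cb0 ((\<lambda>(P, Q). (P, set_valued Q)) ` Tb0)"
  unfolding bij_betw_def
proof
  show "inj_on Insert Cb0"
  proof (rule inj_onI)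
    fix u u' assume a: "u \<in> Cb0" "u' \<in> Cb0" "Insert u = Insert u'"
    obtain ps where ps: "u = (map fst ps, map snd ps)" "reduced_biword ps" using a(1) by (cases u) (auto simp: Cb0_iff)
    obtain ps' where ps': "u' = (map fst ps', map snd ps')" "reduced_biword ps'" using a(2) by (cases u') (auto simp: Cb0_iff)
    obtain P Q P' Q' where r: "run ps = (P, Q)" "run ps' = (P', Q')" by fastforce
    have "tab_pair P Q" "tab_pair P' Q'" using run_inv_reduced_biword[OF ps(2)] run_inv_reduced_biword[OF ps'(2)] r by (auto simp: run_inv_def)
    moreover have "lst P = lst P'" "lst Q = lst Q'"
      using a(3) Insert_Cb0(1)[OF ps(2) r(1)] Insert_Cb0(1)[OF ps'(2) r(2)] ps ps' set_valued_inj by auto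
    ultimately have "P = P'" "Q = Q'" using lst_inj tab_pair_finite by blast+
    then have "ps = ps'" using run_inj[OF ps(2) ps'(2)] r by simp
    then show "u = u'" using ps ps' by simp
  qed
  show "Insert ` Cb0 = (\<lambda>(P, Q). (P, set_valued Q)) ` Tb0"
  proof (intro set_eqI iffI)
    fix v assume "v \<in> Insert ` Cb0"
    then obtain ps where ps: "v = Insert (map fst ps, map snd ps)" "reduced_biword ps" "\<forall>p\<in>set ps. snd p \<le> fst p"
      by (auto simp: Cb0_iff)
    obtain P Q where r: "run ps = (P, Q)" by fastforce
    have "tab_pair P Q" using run_inv_reduced_biword[OF ps(2)] r by (auto simp: run_inv_def)
    then have "(lst P, lst Q) \<in> Tb0" using run_keys[OF ps(2) r] ps(3) Tb0_iff by blast
    then show "v \<in> (\<lambda>(P, Q). (P, set_valued Q)) ` Tb0"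
      using Insert_Cb0(1)[OF ps(2) r] ps(1) by (auto intro!: image_eqI[of _ _ "(lst P, lst Q)"])
  next
    fix v assume "v \<in> (\<lambda>(P, Q). (P, set_valued Q)) ` Tb0"
    then obtain T U where v: "v = (lst T, set_valued (lst U))" "tab_pair T U" "\<forall>j. wdom (right_key T j) (left_key U j)"
      by (auto simp: Tb0_iff)
    obtain ps where ps: "reduced_biword ps" "run ps = (T, U)" using run_surj[OF v(2)] by blast
    have "(map fst ps, map snd ps) \<in> Cb0" using run_keys[OF ps] v(3) ps(1) Cb0_iff by blast
    then show "v \<in> Insert ` Cb0" using Insert_Cb0(1)[OF ps] v(1) by (metis image_eqI)
  qed
qed

lemma EG_Insert_Cb0:
  assumes "(a, i) \<in> Cb0" "EG_Insert (a, i) = (P, Q)"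
  shows "reduced_decreasing_tableau P \<and> RSSYT Q \<and> Insert (a, i) = (P, set_valued Q)"
proof -
  obtain ps where ps: "a = map fst ps" "i = map snd ps" "reduced_biword ps" using assms(1) by (auto simp: Cb0_iff)
  obtain T U where r: "run ps = (T, U)" by fastforce
  have tab_pair: "tab_pair T U" using run_inv_reduced_biword[OF ps(3)] r by (auto simp: run_inv_def)
  have "P = lst T" "Q = lst U" "Insert (a, i) = (P, set_valued Q)"
    using Insert_Cb0[OF ps(3) r] assms(2) ps by auto
  then show ?thesis using tab_pair tab_pair_finite[OF tab_pair] rdt_lst[of T] RSSYT_lst[of U] by (simp add: tab_pair_def)
qed

text \<open>\<open>key_factorization\<close> supplies a factorization with this last factor, and
  \<open>last_factor\<close> shows that every other one agrees.\<close>

lemma nil_last_factor_lst: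
  assumes T: "Tab T" "reduced (word_of T)" and j: "j < length T"
  shows "nil_last_factor (lst T) (card (T ! j)) = right_key T j"
  unfolding nil_last_factor_def
proof (rule the_equality)
  have nf: "nil_factorization (lst T) vs \<longleftrightarrow> np (word_of T) (concat vs) \<and> (\<forall>v\<in>set vs. sorted_wrt (<) v) \<and>
      mset (map length vs) = mset (map card T)" for vs
    using nilplactic_iff[OF T(2)] by (simp add: nil_factorization_def tableau_word_lst o_def)
  obtain es where es: "map length es = map card (take j T @ drop (Suc j) T)" "\<forall>e\<in>set es. sorted_wrt (<) e"
      "np (word_of T) (concat es @ asc (right_key T j))"
    using key_factorization[OF T j] by blast
  have k: "card (right_key T j) = card (T ! j)" using card_right_key[OF T(1), of j] j by (simp add: col_def)
  have "T = take j T @ T ! j # drop (Suc j) T" using j by (simp add: id_take_nth_drop)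
  then have "mset (map card T) = mset (map card (take j T @ T ! j # drop (Suc j) T))" by simp
  then have "mset (map card T) = mset (map length (es @ [asc (right_key T j)]))" using k es(1) by simp
  moreover have "np (word_of T) (concat (es @ [asc (right_key T j)]))" "\<forall>v\<in>set (es @ [asc (right_key T j)]). sorted_wrt (<) v"
    using es by auto
  ultimately have "nil_factorization (lst T) (es @ [asc (right_key T j)])" unfolding nf by metis
  then show "\<exists>vs. nil_factorization (lst T) vs \<and> length (last vs) = card (T ! j) \<and> right_key T j = set (last vs)"
    using k by (intro exI[of _ "es @ [asc (right_key T j)]"]) simp
  fix S assume "\<exists>vs. nil_factorization (lst T) vs \<and> length (last vs) = card (T ! j) \<and> S = set (last vs)"
  then obtain vs where vs: "nil_factorization (lst T) vs" "length (last vs) = card (T ! j)" "S = set (last vs)" by blast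
  have "vs \<noteq> []" using vs(1) nf j by (cases vs) auto
  then have e: "butlast vs @ [last vs] = vs" by simp
  show "S = right_key T j"
    unfolding vs(3) using last_factor[OF T j, of "butlast vs" "last vs"] vs(1,2) nf unfolding e by blast
qed

lemma right_nil_key_eq:
  assumes "reduced_decreasing_tableau P"
  shows "right_nil_key P = K_plus P"
proof -
  obtain T where T: "P = lst T" "Tab T" "reduced (word_of T)" using rdtE[OF assms] .
  have "right_nil_key (lst T) = map (\<lambda>m. dc (nil_last_factor (lst T) m)) (map card T)"
    by (simp add: right_nil_key_def o_def)
  also have "\<dots> = map (\<lambda>j. dc (right_key T j)) [0..<length T]"
    by (rule nth_equalityI) (auto simp: nil_last_factor_lst[OF T(2,3)])
  finally show ?thesis using T(1) K_plus_lst by simp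
qed

theorem theorem1p11:
  shows "(\<forall>P. reduced_decreasing_tableau P \<longrightarrow> right_nil_key P = K_plus P) \<and>
    bij_betw Insert Cb0 ((\<lambda>(P, Q). (P, set_valued Q)) ` Tb0) \<and>
    (\<forall>a i P Q. (a, i) \<in> Cb0 \<longrightarrow> EG_Insert (a, i) = (P, Q) \<longrightarrow>
       reduced_decreasing_tableau P \<and> RSSYT Q \<and> Insert (a, i) = (P, set_valued Q))"
  using right_nil_key_eq Insert_bij EG_Insert_Cb0 by blast

end
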